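(* The problem \textsc{BC-Size} is in $\Delta^p_2$ and is $D^P$-hard.
   Context: Broadcast model: $G=(V,E)$ is a finite undirected graph. A broadcast from an originator $v$ proceeds in discrete time units. At time $0$ only $v$ is informed. In each time unit, every informed vertex may call at most one neighbor, which thereby becomes informed. $b(G,v)$ is the minimum number of time units until all vertices are informed. The broadcast center $BC_G$ is the set of vertices $v$ with $b(G,v)=\min_{u\in V}b(G,u)$. \textsc{BC-Size} is the problem: input a graph $G$ and $x\in\mathbb{N}$; question: is $|BC_G|=x$? $\Delta^p_2=P^{NP}$ is the class of problems decidable in polynomial time with an NP oracle. $D^P$ is the class of languages of the form $L_1\cap L_2$ with $L_1\in NP$ and $L_2\in coNP$. Hardness is with respect to polynomial-time many-one reductions. *)

theory Defs
  imports Main "HOL-Library.Extended_Nat" "HOL-Computational_Algebra.Polynomial"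
begin

section \<open>Broadcasting in graphs\<close>

definition ugraph :: "'a set \<Rightarrow> 'a set set \<Rightarrow> bool" where
  "ugraph V E \<longleftrightarrow> finite V \<and> (\<forall>e\<in>E. e \<subseteq> V \<and> card e = 2)"

text \<open>One time unit takes the informed set \<open>I\<close> to \<open>I'\<close>. The partial function \<open>c\<close> gives the
  calls: an informed \<open>u\<close> calls \<open>w\<close> if \<open>c u = Some w\<close> and is idle if \<open>c u = None\<close>.\<close>

definition broadcast_round :: "'a set set \<Rightarrow> 'a set \<Rightarrow> 'a set \<Rightarrow> bool" where
  "broadcast_round E I I' \<longleftrightarrow>
     (\<exists>c :: 'a \<Rightarrow> 'a option.
        (\<forall>u\<in>I. \<forall>w. c u = Some w \<longrightarrow> {u, w} \<in> E) \<and>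
        I' = I \<union> {w. \<exists>u\<in>I. c u = Some w})"

text \<open>The value is \<open>\<infinity>\<close> iff the originator cannot reach all vertices.\<close>

definition broadcast_time :: "'a set \<Rightarrow> 'a set set \<Rightarrow> 'a \<Rightarrow> enat" where
  "broadcast_time V E v = (INF t\<in>{t. (broadcast_round E ^^ t) {v} V}. enat t)"

definition broadcast_center :: "'a set \<Rightarrow> 'a set set \<Rightarrow> 'a set" where
  "broadcast_center V E = {v \<in> V. broadcast_time V E v = (INF u\<in>V. broadcast_time V E u)}"

section \<open>Multi-tape oracle Turing machines\<close>

text \<open>Tapes are infinite in both directions; a tape is its contents together with the head
  position. Tape symbols are natural numbers: 0 is the blank, 1 and 2 are the bits
  \<open>False\<close> and \<open>True\<close>, and larger numbers are further symbols of the machine.\<close>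

datatype move = MLeft | MStay | MRight

type_synonym tape = "(int \<Rightarrow> nat) \<times> int"

fun move_pos :: "move \<Rightarrow> int \<Rightarrow> int" where
  "move_pos MLeft i = i - 1"
| "move_pos MStay i = i"
| "move_pos MRight i = i + 1"

definition tape_read :: "tape \<Rightarrow> nat" where
  "tape_read t = fst t (snd t)"

definition tape_act :: "nat \<times> move \<Rightarrow> tape \<Rightarrow> tape" where
  "tape_act a t = ((fst t)(snd t := fst a), move_pos (snd a) (snd t))"

definition tape_of :: "bool list \<Rightarrow> tape" where
  "tape_of w =
     ((\<lambda>j. if 0 \<le> j \<and> j < int (length w) then (if w ! nat j then 2 else 1) else 0), 0)"

text \<open>The word on a tape is the maximal block of bit symbols beginning at cell 0. Only finitely
  many cells are nonblank at any point of a computation, so the block is finite.\<close>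

definition tape_word :: "tape \<Rightarrow> bool list" where
  "tape_word t = map (\<lambda>i. fst t (int i) = 2) [0..<(LEAST i. fst t (int i) \<notin> {1, 2})]"

text \<open>A machine is the list of its commands, state \<open>q\<close> executing the \<open>q\<close>-th command. \<open>Act \<delta>\<close> maps
  the scanned symbols to the next state and the symbol to write and the head move on each tape.
  \<open>Query y n\<close> asks the oracle about the word on tape 1 and goes to \<open>y\<close> or \<open>n\<close>.
  The initial state is 0; the states \<open>length M\<close> and \<open>length M + 1\<close> are halting.\<close>

datatype cmd =
    Act "nat list \<Rightarrow> nat \<times> (nat \<times> move) list"
  | Query nat nat

type_synonym machine = "cmd list"
type_synonym config = "nat \<times> tape list"

definition acc :: "machine \<Rightarrow> nat" where "acc M = length M"
definition rej :: "machine \<Rightarrow> nat" where "rej M = length M + 1"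

fun wf_cmd :: "nat \<Rightarrow> nat \<Rightarrow> machine \<Rightarrow> cmd \<Rightarrow> bool" where
  "wf_cmd k g M (Act \<delta>) \<longleftrightarrow>
     (\<forall>ss. length ss = k \<and> (\<forall>s\<in>set ss. s < g) \<longrightarrow>
        fst (\<delta> ss) \<le> rej M \<and> length (snd (\<delta> ss)) = k \<and> (\<forall>a\<in>set (snd (\<delta> ss)). fst a < g))"
| "wf_cmd k g M (Query y n) \<longleftrightarrow> y \<le> rej M \<and> n \<le> rej M"

text \<open>\<open>M\<close> is an oracle machine with \<open>k\<close> tapes and the tape alphabet \<open>{0..<g}\<close>.\<close>

definition oracle_tm :: "nat \<Rightarrow> nat \<Rightarrow> machine \<Rightarrow> bool" where
  "oracle_tm k g M \<longleftrightarrow> 2 \<le> k \<and> 3 \<le> g \<and> (\<forall>c\<in>set M. wf_cmd k g M c)"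

definition tm :: "nat \<Rightarrow> nat \<Rightarrow> machine \<Rightarrow> bool" where
  "tm k g M \<longleftrightarrow> oracle_tm k g M \<and> (\<forall>c\<in>set M. \<exists>\<delta>. c = Act \<delta>)"

definition tm_step :: "machine \<Rightarrow> bool list set \<Rightarrow> config \<Rightarrow> config" where
  "tm_step M A = (\<lambda>(q, ts).
     if q < length M then
       (case M ! q of
          Act \<delta> \<Rightarrow> (let (q', as) = \<delta> (map tape_read ts) in (q', map2 tape_act as ts))
        | Query y n \<Rightarrow> (if tape_word (ts ! 1) \<in> A then y else n, ts))
     else (q, ts))"

text \<open>The words \<open>ws\<close> are initially on the first tapes and the other tapes are blank.\<close>

definition start :: "nat \<Rightarrow> bool list list \<Rightarrow> config" where
  "start k ws = (0, map (\<lambda>i. tape_of (if i < length ws then ws ! i else [])) [0..<k])"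

text \<open>Halting configurations are fixed points of \<open>tm_step\<close>, so being in a halting state after \<open>n\<close>
  steps means having halted within \<open>n\<close> steps.\<close>

definition run :: "machine \<Rightarrow> bool list set \<Rightarrow> nat \<Rightarrow> bool list list \<Rightarrow> nat \<Rightarrow> config" where
  "run M A k ws n = (tm_step M A ^^ n) (start k ws)"

section \<open>Complexity classes and reductions\<close>

type_synonym lang = "bool list set"

text \<open>Polynomial-time verifiers: the input is on tape 0 and the certificate on tape 1.\<close>

definition NP :: "lang set" where
  "NP = {L. \<exists>k g M (r :: nat poly) (p :: nat poly). tm k g M \<and>
     (\<forall>x u. length u \<le> poly r (length x) \<longrightarrow>
        fst (run M {} k [x, u] (poly p (length x))) \<in> {acc M, rej M}) \<and>
     (\<forall>x. x \<in> L \<longleftrightarrow> (\<exists>u. length u \<le> poly r (length x) \<and>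
        fst (run M {} k [x, u] (poly p (length x))) = acc M))}"

definition coNP :: "lang set" where
  "coNP = {L. - L \<in> NP}"

definition DP :: "lang set" where
  "DP = {L1 \<inter> L2 | L1 L2. L1 \<in> NP \<and> L2 \<in> coNP}"

definition P_oracle :: "lang \<Rightarrow> lang set" where
  "P_oracle A = {L. \<exists>k g M (p :: nat poly). oracle_tm k g M \<and>
     (\<forall>x. fst (run M A k [x] (poly p (length x))) = (if x \<in> L then acc M else rej M))}"

definition Delta2P :: "lang set" where
  "Delta2P = (\<Union>A\<in>NP. P_oracle A)"

text \<open>The output is the word on tape 1 after halting.\<close>

definition poly_time_computable :: "(bool list \<Rightarrow> bool list) \<Rightarrow> bool" where
  "poly_time_computable f \<longleftrightarrow> (\<exists>k g M (p :: nat poly). tm k g M \<and>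
     (\<forall>x. case run M {} k [x] (poly p (length x)) of
        (q, ts) \<Rightarrow> q \<in> {acc M, rej M} \<and> tape_word (ts ! 1) = f x))"

definition poly_reducible :: "lang \<Rightarrow> lang \<Rightarrow> bool" where
  "poly_reducible L L' \<longleftrightarrow> (\<exists>f. poly_time_computable f \<and> (\<forall>x. x \<in> L \<longleftrightarrow> f x \<in> L'))"

definition hard_for :: "lang set \<Rightarrow> lang \<Rightarrow> bool" where
  "hard_for C L \<longleftrightarrow> (\<forall>L'\<in>C. poly_reducible L' L)"

section \<open>The problem BC-Size\<close>

text \<open>Binary representation, least significant bit first.\<close>

fun nat_bits :: "nat \<Rightarrow> bool list" where
  "nat_bits n = (if n = 0 then [] else odd n # nat_bits (n div 2))"

declare nat_bits.simps [simp del]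

text \<open>A graph on \<open>{0..<n}\<close> and a number \<open>x\<close> are encoded by \<open>n\<close> in unary, the adjacency matrix row
  by row, and \<open>x\<close> in binary.\<close>

definition encode_instance :: "nat \<Rightarrow> nat set set \<Rightarrow> nat \<Rightarrow> bool list" where
  "encode_instance n E x =
     replicate n True @ [False] @ concat (map (\<lambda>i. map (\<lambda>j. {i, j} \<in> E) [0..<n]) [0..<n])
     @ nat_bits x"

definition BC_Size :: lang where
  "BC_Size = {encode_instance n E x | n E x.
     ugraph {0..<n} E \<and> card (broadcast_center {0..<n} E) = x}"

end

theory Submission
  imports Defs
begin

text \<open>
  Membership. Let \<open>q t c\<close> say that at least \<open>c\<close> vertices inform the whole graph within \<open>t\<close> rounds. This is
  an NP question, the certificate being a set of calls. The least \<open>t\<close> with \<open>q t 1\<close> is the minimal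
  broadcast time, and the center has \<open>m\<close> vertices if \<open>q t m\<close> holds and \<open>q t (m + 1)\<close> does not. If there is
  no such \<open>t\<close>, the graph is disconnected and every vertex belongs to the center.

  Hardness. Tableaux turn a language in NP into the satisfiability of clauses, so it suffices to decide
  whether a formula \<open>f\<close> is satisfiable and a formula \<open>g\<close> is not. In the gadget the root is adjacent to
  two literals for each of \<open>B\<close> variables and to four special elements; long paths lead from the
  literals to the clauses, and pendant tails impose deadlines. Within \<open>5 * B + 10\<close> rounds only the
  root and the special elements can be originators. Then the first call along the edges of the root joins it to one
  special element, the next one goes to its tail, and the following \<open>B\<close> calls have to reach one literal of every
  variable, which amounts to an assignment. It has to satisfy all clauses that the special element
  does not already satisfy. The special element 0 satisfies all clauses, the element 1
  those of \<open>g\<close> and the elements 2 and 3 those of \<open>f\<close>, so that the center consists of the root, the element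
  0, the element 1 if \<open>f\<close> is satisfiable, and the elements 2 and 3 if \<open>g\<close> is satisfiable. It has
  three vertices iff \<open>f\<close> is satisfiable and \<open>g\<close> is not.

  All machines come from functions definable by bounded sums, which counter machines compute in
  polynomial time.
\<close>

section \<open>Programs\<close>

text \<open>The constants of the gadget come from counting backwards from the deadline
  \<open>5 * B + 10\<close>. A signal takes \<open>B + 2\<close> rounds between an element and a
  clause, so an element reached back through a clause is informed in round \<open>B + 3\<close> at
  the earliest, while the clause tails demand a useful element by round \<open>B + 2\<close>. As
  rounds 1 and 2 are spent on the special element and the tail of the root, exactly the
  \<open>B\<close> rounds from 3 to \<open>B + 2\<close> remain for \<open>B\<close> variables, and
  no further literal can be called in time. Only the first \<open>m\<close> variables occur in the
  formula. The others are padding with \<open>m + nF < B\<close>, so that a literal of the formula,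
  called by round \<open>m + 2\<close>, can still serve up to \<open>nF\<close> clauses one after
  the other. The elements 2 and 3 are twins to give the second formula weight 2: the size
  \<open>2 + [f] + 2 * [g]\<close> of the center separates all four cases.

  Numbers are kept in unary, so that a closure proof for \<open>definable\<close> amounts to a
  polynomial time bound. The price is that exponentially large values must not occur; binary numbers
  are found by a search below a polynomial bound.\<close>

datatype prog =
    Skip
  | Step nat "nat option" move
  | Seq prog prog (infixr ";;" 60)
  | Cond nat nat prog prog
  | While nat nat prog
  | Ask prog prog

text \<open>\<open>exec A p f c f'\<close>: with oracle \<open>A\<close> the program \<open>p\<close> takes the tapes \<open>f\<close> to \<open>f'\<close> within time \<open>c\<close>.
  \<open>While i s p\<close> repeats \<open>p\<close> until the symbol scanned on tape \<open>i\<close> is \<open>s\<close>.\<close>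

inductive exec :: "lang \<Rightarrow> prog \<Rightarrow> (nat \<Rightarrow> tape) \<Rightarrow> nat \<Rightarrow> (nat \<Rightarrow> tape) \<Rightarrow> bool" for A where
  exec_Skip: "exec A Skip f c f"
| exec_Step: "1 \<le> c \<Longrightarrow> f' = f(i := tape_act (case w of None \<Rightarrow> tape_read (f i) | Some s \<Rightarrow> s, m) (f i)) \<Longrightarrow>
    exec A (Step i w m) f c f'"
| exec_Seq: "exec A p f a f' \<Longrightarrow> exec A q f' b f'' \<Longrightarrow> a + b \<le> c \<Longrightarrow> exec A (p ;; q) f c f''"
| exec_CondT: "tape_read (f i) = s \<Longrightarrow> exec A p f a f' \<Longrightarrow> a + 2 \<le> c \<Longrightarrow> exec A (Cond i s p q) f c f'"
| exec_CondF: "tape_read (f i) \<noteq> s \<Longrightarrow> exec A q f a f' \<Longrightarrow> a + 2 \<le> c \<Longrightarrow> exec A (Cond i s p q) f c f'"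
| exec_WhileF: "tape_read (f i) = s \<Longrightarrow> 1 \<le> c \<Longrightarrow> exec A (While i s p) f c f"
| exec_WhileT: "tape_read (f i) \<noteq> s \<Longrightarrow> exec A p f a f' \<Longrightarrow> exec A (While i s p) f' b f'' \<Longrightarrow>
    a + b + 2 \<le> c \<Longrightarrow> exec A (While i s p) f c f''"
| exec_AskT: "tape_word (f 1) \<in> A \<Longrightarrow> exec A p f a f' \<Longrightarrow> a + 2 \<le> c \<Longrightarrow> exec A (Ask p q) f c f'"
| exec_AskF: "tape_word (f 1) \<notin> A \<Longrightarrow> exec A q f a f' \<Longrightarrow> a + 2 \<le> c \<Longrightarrow> exec A (Ask p q) f c f'"

lemma exec_mono: "exec A p f c f' \<Longrightarrow> c \<le> c' \<Longrightarrow> exec A p f c' f'"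
proof (erule exec.cases, goal_cases)
  case 1 then show ?case by (simp add: exec_Skip)
next
  case 2 then show ?case by (simp add: exec_Step)
next
  case 3 then show ?case using exec_Seq le_trans by blast
next
  case 4 then show ?case using exec_CondT le_trans by blast
next
  case 5 then show ?case using exec_CondF le_trans by blast
next
  case 6 then show ?case by (simp add: exec_WhileF)
next
  case 7 then show ?case using exec_WhileT le_trans by blast
next
  case 8 then show ?case using exec_AskT le_trans by blast
next
  case 9 then show ?case using exec_AskF le_trans by blast
qed

text \<open>The index of \<open>st\<close> is the number of iterations still to come, hence the
  downward numbering. Each iteration pays 2 for the test and the jump back, and the last test costs
  1.\<close>

lemma exec_loop:
  assumes "\<And>j. j \<le> n \<Longrightarrow> tape_read (st j i) = s \<longleftrightarrow> j = 0"
    and "\<And>j. j < n \<Longrightarrow> exec A p (st (Suc j)) c (st j)"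
    and "n * (c + 2) + 1 \<le> c'"
  shows "exec A (While i s p) (st n) c' (st 0)"
  using assms
proof (induction n arbitrary: c')
  case 0
  have "tape_read (st 0 i) = s" using 0(1)[of 0] by simp
  then show ?case by (rule exec_WhileF) (use 0(3) in simp)
next
  case (Suc n)
  have 1: "exec A (While i s p) (st n) (n * (c + 2) + 1) (st 0)"
    by (rule Suc.IH) (use Suc.prems in auto)
  have 2: "tape_read (st (Suc n) i) \<noteq> s" using Suc.prems(1)[of "Suc n"] by simp
  show ?case
    by (rule exec_WhileT[OF 2 Suc.prems(2)[of n] 1]) (use Suc.prems(3) in simp_all)
qed

section \<open>Compilation of programs into machine commands\<close>

fun plen :: "prog \<Rightarrow> nat" where
  "plen Skip = 0"
| "plen (Step i w m) = 1"
| "plen (p ;; q) = plen p + plen q"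
| "plen (Cond i s p q) = plen p + plen q + 2"
| "plen (While i s p) = plen p + 2"
| "plen (Ask p q) = plen p + plen q + 2"

definition one_tape :: "nat \<Rightarrow> nat \<Rightarrow> (nat \<Rightarrow> nat \<times> nat \<times> move) \<Rightarrow> cmd" where
  "one_tape K i h = Act (\<lambda>ss. (fst (h (ss ! i)),
     map (\<lambda>j. if j = i then snd (h (ss ! i)) else (ss ! j, MStay)) [0..<K]))"

text \<open>The code is position dependent: it starts in the state \<open>off\<close> and always
  leaves in \<open>off + plen p\<close>, the state just behind it, so that sequencing is
  concatenation. A command on tape 0 whose successor ignores the scanned symbol serves as an
  unconditional jump.\<close>

fun comp :: "nat \<Rightarrow> nat \<Rightarrow> prog \<Rightarrow> cmd list" where
  "comp K off Skip = []"
| "comp K off (Step i w m) = [one_tape K i (\<lambda>s. (off + 1, (case w of None \<Rightarrow> s | Some s' \<Rightarrow> s', m)))]"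
| "comp K off (p ;; q) = comp K off p @ comp K (off + plen p) q"
| "comp K off (Cond i s p q) =
     one_tape K i (\<lambda>s'. (if s' = s then off + 1 else off + plen p + 2, (s', MStay))) #
     comp K (off + 1) p @
     one_tape K 0 (\<lambda>s'. (off + plen p + plen q + 2, (s', MStay))) # comp K (off + plen p + 2) q"
| "comp K off (While i s p) =
     one_tape K i (\<lambda>s'. (if s' = s then off + plen p + 2 else off + 1, (s', MStay))) #
     comp K (off + 1) p @ [one_tape K 0 (\<lambda>s'. (off, (s', MStay)))]"
| "comp K off (Ask p q) = Query (off + 1) (off + plen p + 2) # comp K (off + 1) p @
     one_tape K 0 (\<lambda>s'. (off + plen p + plen q + 2, (s', MStay))) # comp K (off + plen p + 2) q"

fun wf_prog :: "nat \<Rightarrow> prog \<Rightarrow> bool" where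
  "wf_prog K Skip \<longleftrightarrow> True"
| "wf_prog K (Step i w m) \<longleftrightarrow> i < K \<and> (\<forall>s. w = Some s \<longrightarrow> s < 3)"
| "wf_prog K (p ;; q) \<longleftrightarrow> wf_prog K p \<and> wf_prog K q"
| "wf_prog K (Cond i s p q) \<longleftrightarrow> i < K \<and> wf_prog K p \<and> wf_prog K q"
| "wf_prog K (While i s p) \<longleftrightarrow> i < K \<and> wf_prog K p"
| "wf_prog K (Ask p q) \<longleftrightarrow> wf_prog K p \<and> wf_prog K q"

fun no_ask :: "prog \<Rightarrow> bool" where
  "no_ask (p ;; q) \<longleftrightarrow> no_ask p \<and> no_ask q"
| "no_ask (Cond i s p q) \<longleftrightarrow> no_ask p \<and> no_ask q"
| "no_ask (While i s p) \<longleftrightarrow> no_ask p"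
| "no_ask (Ask p q) \<longleftrightarrow> False"
| "no_ask _ \<longleftrightarrow> True"

lemma wf_prog_mono: "wf_prog K p \<Longrightarrow> K \<le> K' \<Longrightarrow> wf_prog K' p"
  by (induction p) auto

lemma length_comp [simp]: "length (comp K off p) = plen p"
  by (induction p arbitrary: off) auto

lemma tape_act_stay [simp]: "tape_act (tape_read t, MStay) t = t"
  by (simp add: tape_act_def tape_read_def)

lemma tm_step_one_tape:
  assumes "M ! q = one_tape K i h" "q < length M" "i < K"
  shows "tm_step M A (q, map f [0..<K]) =
    (fst (h (tape_read (f i))), map (f(i := tape_act (snd (h (tape_read (f i)))) (f i))) [0..<K])"
proof -
  have "tm_step M A (q, map f [0..<K]) = (fst (h (tape_read (f i))),
     map2 tape_act (map (\<lambda>j. if j = i then snd (h (tape_read (f i))) else (map tape_read (map f [0..<K]) ! j, MStay)) [0..<K])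
      (map f [0..<K]))"
  proof -
    have r: "map tape_read (map f [0..<K]) ! i = tape_read (f i)" using assms(3) by simp
    show ?thesis using assms(1,2) unfolding tm_step_def one_tape_def r[symmetric] by simp
  qed
  also have "map2 tape_act (map (\<lambda>j. if j = i then snd (h (tape_read (f i))) else (map tape_read (map f [0..<K]) ! j, MStay)) [0..<K])
      (map f [0..<K]) = map (f(i := tape_act (snd (h (tape_read (f i)))) (f i))) [0..<K]"
    by (rule nth_equalityI) auto
  finally show ?thesis .
qed

lemma tm_step_test:
  assumes "M ! q = one_tape K i (\<lambda>s. (h s, (s, MStay)))" "q < length M" "i < K"
  shows "tm_step M A (q, map f [0..<K]) = (h (tape_read (f i)), map f [0..<K])"
  using tm_step_one_tape[OF assms, of A f] by simp

lemma funpow_steps: "(g ^^ n) x = y \<Longrightarrow> (g ^^ m) y = z \<Longrightarrow> (g ^^ (n + m)) x = z"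
  by (metis add.commute comp_apply funpow_add)

text \<open>The context \<open>pre\<close>, \<open>post\<close> is arbitrary because a subprogram
  runs inside the same machine at another offset. Program states are families of tapes over all
  indices; the machine sees the first \<open>K\<close> of them.\<close>

theorem comp_correct:
  assumes "exec A p f c f'" "wf_prog K p" "2 \<le> K" "M = pre @ comp K (length pre) p @ post"
  shows "\<exists>n\<le>c. (tm_step M A ^^ n) (length pre, map f [0..<K]) = (length pre + plen p, map f' [0..<K])"
  using assms
proof (induction arbitrary: pre post rule: exec.induct)
  case (exec_Skip f c)
  then show ?case by (intro exI[of _ 0]) auto
next
  case (exec_Step c f' f i w m)
  have "tm_step M A (length pre, map f [0..<K]) = (length pre + 1, map f' [0..<K])"
    using exec_Step tm_step_one_tape[of M "length pre" K i "\<lambda>s. (length pre + 1, (case w of None \<Rightarrow> s | Some s' \<Rightarrow> s', m))" A f]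
    by simp
  then show ?case using exec_Step by (intro exI[of _ 1]) simp
next
  case (exec_Seq p f a f' q b f'' c)
  have M1: "M = pre @ comp K (length pre) p @ (comp K (length pre + plen p) q @ post)"
    using exec_Seq.prems(3) by simp
  have M2: "M = (pre @ comp K (length pre) p) @ comp K (length (pre @ comp K (length pre) p)) q @ post"
    using exec_Seq.prems(3) by simp
  have wf: "wf_prog K p" "wf_prog K q" using exec_Seq.prems(1) by simp_all
  obtain n1 where n1: "n1 \<le> a" "(tm_step M A ^^ n1) (length pre, map f [0..<K]) = (length pre + plen p, map f' [0..<K])"
    using exec_Seq.IH(1)[OF wf(1) exec_Seq.prems(2) M1] by blast
  obtain n2 where n2: "n2 \<le> b" "(tm_step M A ^^ n2) (length pre + plen p, map f' [0..<K]) = (length pre + plen p + plen q, map f'' [0..<K])"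
    using exec_Seq.IH(2)[OF wf(2) exec_Seq.prems(2) M2] by auto
  have "(tm_step M A ^^ (n1 + n2)) (length pre, map f [0..<K]) = (length pre + plen p + plen q, map f'' [0..<K])"
    by (rule funpow_steps[OF n1(2) n2(2)])
  then show ?case using n1(1) n2(1) exec_Seq.hyps(3)
    by (intro exI[of _ "n1 + n2"]) (simp add: add.assoc)
next
  case (exec_CondT f i s p a f' c q)
  let ?post = "one_tape K 0 (\<lambda>s'. (length pre + plen p + plen q + 2, (s', MStay))) # comp K (length pre + plen p + 2) q @ post"
  let ?c = "one_tape K i (\<lambda>s'. (if s' = s then length pre + 1 else length pre + plen p + 2, (s', MStay)))"
  have M: "M = (pre @ [?c]) @ comp K (length (pre @ [?c])) p @ ?post"
    using exec_CondT.prems by simp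
  then obtain n where n: "n \<le> a" "(tm_step M A ^^ n) (length pre + 1, map f [0..<K]) = (length pre + 1 + plen p, map f' [0..<K])"
    using exec_CondT.IH[OF _ _ M] exec_CondT.prems by auto
  have 1: "tm_step M A (length pre, map f [0..<K]) = (length pre + 1, map f [0..<K])"
    using M exec_CondT by (subst tm_step_test[where i = i and h = "\<lambda>s'. if s' = s then length pre + 1 else length pre + plen p + 2"]) auto
  have 2: "tm_step M A (length pre + 1 + plen p, map f' [0..<K]) = (length pre + plen p + plen q + 2, map f' [0..<K])"
    using M exec_CondT by (subst tm_step_test[where i = 0 and h = "\<lambda>s'. length pre + plen p + plen q + 2"])
      (auto simp: nth_append)
  have "(tm_step M A ^^ (1 + (n + 1))) (length pre, map f [0..<K]) = (length pre + plen p + plen q + 2, map f' [0..<K])"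
    by (rule funpow_steps[OF _ funpow_steps[OF n(2)]]) (use 1 2 in auto)
  then show ?case using n exec_CondT.hyps by (intro exI[of _ "1 + (n + 1)"]) (auto simp: add_ac)
next
  case (exec_CondF f i s q a f' c p)
  let ?c = "one_tape K i (\<lambda>s'. (if s' = s then length pre + 1 else length pre + plen p + 2, (s', MStay)))"
  let ?pre = "pre @ ?c # comp K (length pre + 1) p @ [one_tape K 0 (\<lambda>s'. (length pre + plen p + plen q + 2, (s', MStay)))]"
  have M: "M = ?pre @ comp K (length ?pre) q @ post"
    using exec_CondF.prems by (simp add: add_ac)
  then obtain n where n: "n \<le> a" "(tm_step M A ^^ n) (length pre + plen p + 2, map f [0..<K]) = (length pre + plen p + 2 + plen q, map f' [0..<K])"
    using exec_CondF.IH[OF _ _ M] exec_CondF.prems by (auto simp: add_ac)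
  have 1: "tm_step M A (length pre, map f [0..<K]) = (length pre + plen p + 2, map f [0..<K])"
    using M exec_CondF by (subst tm_step_test[where i = i and h = "\<lambda>s'. if s' = s then length pre + 1 else length pre + plen p + 2"]) auto
  have "(tm_step M A ^^ (1 + n)) (length pre, map f [0..<K]) = (length pre + plen p + 2 + plen q, map f' [0..<K])"
    by (rule funpow_steps[OF _ n(2)]) (use 1 in auto)
  then show ?case using n exec_CondF.hyps by (intro exI[of _ "1 + n"]) (auto simp: add_ac)
next
  case (exec_WhileF f i s c p)
  have "tm_step M A (length pre, map f [0..<K]) = (length pre + plen p + 2, map f [0..<K])"
    using exec_WhileF by (subst tm_step_test[where i = i and h = "\<lambda>s'. if s' = s then length pre + plen p + 2 else length pre + 1"]) auto
  then show ?case using exec_WhileF by (intro exI[of _ 1]) auto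
next
  case (exec_WhileT f i s p a f' b f'' c)
  let ?post = "one_tape K 0 (\<lambda>s'. (length pre, (s', MStay))) # post"
  let ?c = "one_tape K i (\<lambda>s'. (if s' = s then length pre + plen p + 2 else length pre + 1, (s', MStay)))"
  have M: "M = (pre @ [?c]) @ comp K (length (pre @ [?c])) p @ ?post"
    using exec_WhileT.prems by simp
  then obtain n where n: "n \<le> a" "(tm_step M A ^^ n) (length pre + 1, map f [0..<K]) = (length pre + 1 + plen p, map f' [0..<K])"
    using exec_WhileT.IH(1)[OF _ _ M] exec_WhileT.prems by auto
  obtain m where m: "m \<le> b" "(tm_step M A ^^ m) (length pre, map f' [0..<K]) = (length pre + plen (While i s p), map f'' [0..<K])"
    using exec_WhileT.IH(2)[of pre post] exec_WhileT.prems by auto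
  have 1: "tm_step M A (length pre, map f [0..<K]) = (length pre + 1, map f [0..<K])"
    using M exec_WhileT by (subst tm_step_test[where i = i and h = "\<lambda>s'. if s' = s then length pre + plen p + 2 else length pre + 1"]) auto
  have 2: "tm_step M A (length pre + 1 + plen p, map f' [0..<K]) = (length pre, map f' [0..<K])"
    using M exec_WhileT by (subst tm_step_test[where i = 0 and h = "\<lambda>s'. length pre"])
      (auto simp: nth_append)
  have "(tm_step M A ^^ (1 + (n + (1 + m)))) (length pre, map f [0..<K]) = (length pre + plen (While i s p), map f'' [0..<K])"
    by (rule funpow_steps[OF _ funpow_steps[OF n(2) funpow_steps[OF _ m(2)]]]) (use 1 2 in auto)
  then show ?case using n m exec_WhileT.hyps by (intro exI[of _ "1 + (n + (1 + m))"]) auto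
next
  case (exec_AskT f p a f' c q)
  let ?post = "one_tape K 0 (\<lambda>s'. (length pre + plen p + plen q + 2, (s', MStay))) # comp K (length pre + plen p + 2) q @ post"
  let ?c = "Query (length pre + 1) (length pre + plen p + 2)"
  have M: "M = (pre @ [?c]) @ comp K (length (pre @ [?c])) p @ ?post"
    using exec_AskT.prems by simp
  then obtain n where n: "n \<le> a" "(tm_step M A ^^ n) (length pre + 1, map f [0..<K]) = (length pre + 1 + plen p, map f' [0..<K])"
    using exec_AskT.IH[OF _ _ M] exec_AskT.prems by auto
  have 1: "tm_step M A (length pre, map f [0..<K]) = (length pre + 1, map f [0..<K])"
    using M exec_AskT by (simp add: tm_step_def)
  have 2: "tm_step M A (length pre + 1 + plen p, map f' [0..<K]) = (length pre + plen p + plen q + 2, map f' [0..<K])"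
    using M exec_AskT by (subst tm_step_test[where i = 0 and h = "\<lambda>s'. length pre + plen p + plen q + 2"])
      (auto simp: nth_append)
  have "(tm_step M A ^^ (1 + (n + 1))) (length pre, map f [0..<K]) = (length pre + plen p + plen q + 2, map f' [0..<K])"
    by (rule funpow_steps[OF _ funpow_steps[OF n(2)]]) (use 1 2 in auto)
  then show ?case using n exec_AskT.hyps by (intro exI[of _ "1 + (n + 1)"]) (auto simp: add_ac)
next
  case (exec_AskF f q a f' c p)
  let ?c = "Query (length pre + 1) (length pre + plen p + 2)"
  let ?pre = "pre @ ?c # comp K (length pre + 1) p @ [one_tape K 0 (\<lambda>s'. (length pre + plen p + plen q + 2, (s', MStay)))]"
  have M: "M = ?pre @ comp K (length ?pre) q @ post"
    using exec_AskF.prems by (simp add: add_ac)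
  then obtain n where n: "n \<le> a" "(tm_step M A ^^ n) (length pre + plen p + 2, map f [0..<K]) = (length pre + plen p + 2 + plen q, map f' [0..<K])"
    using exec_AskF.IH[OF _ _ M] exec_AskF.prems by (auto simp: add_ac)
  have 1: "tm_step M A (length pre, map f [0..<K]) = (length pre + plen p + 2, map f [0..<K])"
    using M exec_AskF by (simp add: tm_step_def)
  have "(tm_step M A ^^ (1 + n)) (length pre, map f [0..<K]) = (length pre + plen p + 2 + plen q, map f' [0..<K])"
    by (rule funpow_steps[OF _ n(2)]) (use 1 in auto)
  then show ?case using n exec_AskF.hyps by (intro exI[of _ "1 + n"]) (auto simp: add_ac)
qed

lemma wf_cmd_one_tape:
  assumes "i < K" "\<And>s. s < 3 \<Longrightarrow> fst (h s) \<le> rej M \<and> fst (snd (h s)) < 3"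
  shows "wf_cmd K 3 M (one_tape K i h)"
  using assms by (auto simp: one_tape_def)

lemma wf_comp:
  assumes "wf_prog K p" "2 \<le> K" "off + plen p \<le> rej M" "c \<in> set (comp K off p)"
  shows "wf_cmd K 3 M c"
  using assms
proof (induction p arbitrary: off)
  case Skip
  then show ?case by simp
next
  case (Step i w m)
  then show ?case by (auto intro!: wf_cmd_one_tape split: option.split)
next
  case (Seq p q)
  have "off + plen p \<le> rej M" "off + plen p + plen q \<le> rej M" using Seq.prems(3) by simp_all
  then show ?case using Seq.prems Seq.IH(1)[of off] Seq.IH(2)[of "off + plen p"] by auto
next
  case (Cond i s p q)
  have 1: "off + 1 + plen p \<le> rej M" "off + plen p + 2 + plen q \<le> rej M" "off + 1 \<le> rej M" "0 < K"
    using Cond.prems by simp_all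
  consider "c = one_tape K i (\<lambda>s'. (if s' = s then off + 1 else off + plen p + 2, (s', MStay)))"
    | "c \<in> set (comp K (off + 1) p)" | "c = one_tape K 0 (\<lambda>s'. (off + plen p + plen q + 2, (s', MStay)))"
    | "c \<in> set (comp K (off + plen p + 2) q)" using Cond.prems(4) by auto
  then show ?case
  proof cases
    case 1
    show ?thesis unfolding 1 using \<open>off + plen p + 2 + plen q \<le> rej M\<close> Cond.prems by (intro wf_cmd_one_tape) auto
  next
    case 2
    then show ?thesis using Cond.IH(1)[of "off + 1"] Cond.prems 1 by simp
  next
    case 3
    show ?thesis unfolding 3 using 1 by (intro wf_cmd_one_tape) auto
  next
    case 4
    then show ?thesis using Cond.IH(2)[of "off + plen p + 2"] Cond.prems 1 by simp
  qed
next
  case (While i s p)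
  have 1: "off + 1 + plen p \<le> rej M" "off + plen p + 2 \<le> rej M" "0 < K"
    using While.prems by simp_all
  consider "c = one_tape K i (\<lambda>s'. (if s' = s then off + plen p + 2 else off + 1, (s', MStay)))"
    | "c \<in> set (comp K (off + 1) p)" | "c = one_tape K 0 (\<lambda>s'. (off, (s', MStay)))"
    using While.prems(4) by auto
  then show ?case
  proof cases
    case 1
    show ?thesis unfolding 1 using \<open>off + plen p + 2 \<le> rej M\<close> While.prems by (intro wf_cmd_one_tape) auto
  next
    case 2
    then show ?thesis using While.IH[of "off + 1"] While.prems 1 by simp
  next
    case 3
    show ?thesis unfolding 3 using 1 by (intro wf_cmd_one_tape) auto
  qed
next
  case (Ask p q)
  have 1: "off + 1 + plen p \<le> rej M" "off + plen p + 2 + plen q \<le> rej M" "off + 1 \<le> rej M" "0 < K"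
    using Ask.prems by simp_all
  consider "c = Query (off + 1) (off + plen p + 2)"
    | "c \<in> set (comp K (off + 1) p)" | "c = one_tape K 0 (\<lambda>s'. (off + plen p + plen q + 2, (s', MStay)))"
    | "c \<in> set (comp K (off + plen p + 2) q)" using Ask.prems(4) by auto
  then show ?case
  proof cases
    case 1
    then show ?thesis using Ask.prems by simp
  next
    case 2
    then show ?thesis using Ask.IH(1)[of "off + 1"] Ask.prems 1 by simp
  next
    case 3
    show ?thesis unfolding 3 using 1 by (intro wf_cmd_one_tape) auto
  next
    case 4
    then show ?thesis using Ask.IH(2)[of "off + plen p + 2"] Ask.prems 1 by simp
  qed
qed

lemma no_ask_comp: "no_ask p \<Longrightarrow> c \<in> set (comp K off p) \<Longrightarrow> \<exists>\<delta>. c = Act \<delta>"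
  by (induction p arbitrary: off) (auto simp: one_tape_def)

text \<open>The whole machine has \<open>plen p + 1\<close> commands, so the two targets of the last
  command are its states \<open>acc\<close> and \<open>rej\<close>. A counter tape shows 1 exactly
  when its value is 0, hence the value 0 rejects.\<close>

definition machine_of :: "nat \<Rightarrow> prog \<Rightarrow> nat \<Rightarrow> machine" where
  "machine_of K p i = comp K 0 p @ [one_tape K i (\<lambda>s. (if s = 1 then plen p + 2 else plen p + 1, (s, MStay)))]"

lemma oracle_tm_machine_of: "wf_prog K p \<Longrightarrow> 2 \<le> K \<Longrightarrow> i < K \<Longrightarrow> oracle_tm K 3 (machine_of K p i)"
  unfolding oracle_tm_def machine_of_def
  by (auto intro!: wf_cmd_one_tape wf_comp[where p = p and off = 0 and K = K] simp: rej_def)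

lemma tm_machine_of: "wf_prog K p \<Longrightarrow> 2 \<le> K \<Longrightarrow> i < K \<Longrightarrow> no_ask p \<Longrightarrow> tm K 3 (machine_of K p i)"
  unfolding tm_def by (auto simp: oracle_tm_machine_of) (auto simp: machine_of_def one_tape_def dest: no_ask_comp)

lemma funpow_fixed: "g x = x \<Longrightarrow> (g ^^ n) x = x"
  by (induction n) auto

lemma run_machine_of:
  assumes "exec A p f c f'" "wf_prog K p" "2 \<le> K" "i < K" "c < n"
    and f: "\<And>i. i < K \<Longrightarrow> f i = tape_of (if i < length ws then ws ! i else [])"
  shows "run (machine_of K p i) A K ws n =
    (if tape_read (f' i) = 1 then rej (machine_of K p i) else acc (machine_of K p i), map f' [0..<K])"
proof -
  let ?M = "machine_of K p i"
  have "start K ws = (0, map f [0..<K])" using f by (simp add: start_def)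
  then obtain m where m: "m \<le> c" "(tm_step ?M A ^^ m) (start K ws) = (plen p, map f' [0..<K])"
    using comp_correct[OF assms(1-3), where pre = "[]" and M = ?M] by (auto simp: machine_of_def)
  have 1: "tm_step ?M A (plen p, map f' [0..<K]) =
      (if tape_read (f' i) = 1 then plen p + 2 else plen p + 1, map f' [0..<K])" (is "_ = ?y")
    using assms by (subst tm_step_test[where i = i and h = "\<lambda>s. if s = 1 then plen p + 2 else plen p + 1"])
      (auto simp: machine_of_def nth_append)
  \<comment> \<open>Halting configurations are fixed points, which fills up the run to exactly
    \<open>n\<close> steps.\<close>
  have "(tm_step ?M A ^^ (n - m - 1)) ?y = ?y"
    by (rule funpow_fixed) (auto simp: tm_step_def machine_of_def)
  then have "(tm_step ?M A ^^ (m + (1 + (n - m - 1)))) (start K ws) = ?y"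
    by (intro funpow_steps[OF m(2) funpow_steps]) (use 1 in auto)
  moreover have "m + (1 + (n - m - 1)) = n" using m assms(5) by simp
  ultimately show ?thesis by (simp add: run_def acc_def rej_def machine_of_def)
qed

section \<open>Counters\<close>

definition cnt :: "nat \<Rightarrow> tape" where "cnt n = ((\<lambda>_. 0)(0 := 1), int n)"

lemma tape_read_cnt [simp]: "tape_read (cnt n) = (if n = 0 then 1 else 0)"
  by (simp add: tape_read_def cnt_def)

text \<open>Tapes 0 and 1 hold words; tape \<open>r + 2\<close> is a counter register \<open>r\<close>, whose value is the
  distance of the head from a marker in cell 0.\<close>

definition tapes :: "(nat \<Rightarrow> tape) \<Rightarrow> (nat \<Rightarrow> nat) \<Rightarrow> nat \<Rightarrow> tape" where
  "tapes \<tau> \<sigma> i = (if i < 2 then \<tau> i else cnt (\<sigma> (i - 2)))"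

definition Inc :: "nat \<Rightarrow> prog" where "Inc r = Step (r + 2) None MRight"
definition Dec :: "nat \<Rightarrow> prog" where "Dec r = Step (r + 2) None MLeft"
definition Loop :: "nat \<Rightarrow> prog \<Rightarrow> prog" where "Loop r p = While (r + 2) 1 p"

lemma wf_Inc [simp]: "wf_prog K (Inc r) \<longleftrightarrow> r + 2 < K" by (simp add: Inc_def)
lemma wf_Dec [simp]: "wf_prog K (Dec r) \<longleftrightarrow> r + 2 < K" by (simp add: Dec_def)
lemma wf_Loop [simp]: "wf_prog K (Loop r p) \<longleftrightarrow> r + 2 < K \<and> wf_prog K p" by (simp add: Loop_def)
lemma no_ask_Inc [simp]: "no_ask (Inc r)" by (simp add: Inc_def)
lemma no_ask_Dec [simp]: "no_ask (Dec r)" by (simp add: Dec_def)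
lemma no_ask_Loop [simp]: "no_ask (Loop r p) = no_ask p" by (simp add: Loop_def)

lemma tape_act_read: "tape_act (tape_read t, m) t = (fst t, move_pos m (snd t))"
  by (simp add: tape_act_def tape_read_def)

lemma exec_Inc: "1 \<le> c \<Longrightarrow> exec A (Inc r) (tapes \<tau> \<sigma>) c (tapes \<tau> (\<sigma>(r := Suc (\<sigma> r))))"
  unfolding Inc_def by (rule exec_Step) (auto simp: tapes_def tape_act_read cnt_def fun_eq_iff)

lemma exec_Dec: "\<sigma> r = Suc n \<Longrightarrow> 1 \<le> c \<Longrightarrow> exec A (Dec r) (tapes \<tau> \<sigma>) c (tapes \<tau> (\<sigma>(r := n)))"
  unfolding Dec_def by (rule exec_Step) (auto simp: tapes_def tape_act_read cnt_def fun_eq_iff)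

lemma exec_move: "i < 2 \<Longrightarrow> 1 \<le> c \<Longrightarrow>
    exec A (Step i None m) (tapes \<tau> \<sigma>) c (tapes (\<tau>(i := (fst (\<tau> i), move_pos m (snd (\<tau> i))))) \<sigma>)"
  by (rule exec_Step) (auto simp: tapes_def tape_act_read fun_eq_iff)

lemma exec_write: "i < 2 \<Longrightarrow> 1 \<le> c \<Longrightarrow>
    exec A (Step i (Some s) m) (tapes \<tau> \<sigma>) c (tapes (\<tau>(i := tape_act (s, m) (\<tau> i))) \<sigma>)"
  by (rule exec_Step) (auto simp: tapes_def fun_eq_iff)

lemma exec_Loop:
  assumes "\<And>j. j < n \<Longrightarrow> exec A p (tapes (\<tau> (Suc j)) (\<sigma> (Suc j))) c (tapes (\<tau> j) (\<sigma> j))"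
    and "\<And>j. j \<le> n \<Longrightarrow> \<sigma> j r = j" and "n * (c + 2) + 1 \<le> c'"
  shows "exec A (Loop r p) (tapes (\<tau> n) (\<sigma> n)) c' (tapes (\<tau> 0) (\<sigma> 0))"
  unfolding Loop_def
  by (rule exec_loop[of n "\<lambda>j. tapes (\<tau> j) (\<sigma> j)"]) (use assms in \<open>auto simp: tapes_def\<close>)

definition addto :: "nat \<Rightarrow> nat \<Rightarrow> prog" where "addto a b = Loop a (Dec a ;; Inc b)"

lemma exec_addto:
  assumes "a \<noteq> b" "4 * \<sigma> a + 1 \<le> c"
  shows "exec A (addto a b) (tapes \<tau> \<sigma>) c (tapes \<tau> (\<sigma>(a := 0, b := \<sigma> b + \<sigma> a)))"
proof -
  let ?s = "\<lambda>j. \<sigma>(a := j, b := \<sigma> b + (\<sigma> a - j))"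
  have "exec A (addto a b) (tapes \<tau> (?s (\<sigma> a))) c (tapes \<tau> (?s 0))"
    unfolding addto_def
  proof (rule exec_Loop[where c = 2])
    fix j assume j: "j < \<sigma> a"
    have "exec A (Dec a) (tapes \<tau> (?s (Suc j))) 1 (tapes \<tau> ((?s (Suc j))(a := j)))"
      using assms by (intro exec_Dec) auto
    moreover have "exec A (Inc b) (tapes \<tau> ((?s (Suc j))(a := j))) 1 (tapes \<tau> (?s j))"
    proof -
      have "?s j = ((?s (Suc j))(a := j))(b := Suc (((?s (Suc j))(a := j)) b))"
        using assms(1) j by (auto simp: fun_eq_iff)
      then show ?thesis by (metis exec_Inc order_refl)
    qed
    ultimately show "exec A (Dec a ;; Inc b) (tapes \<tau> (?s (Suc j))) 2 (tapes \<tau> (?s j))"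
      by (rule exec_Seq) simp
  qed (use assms in auto)
  moreover have "?s (\<sigma> a) = \<sigma>" by auto
  ultimately show ?thesis by simp
qed

definition subfrom :: "nat \<Rightarrow> nat \<Rightarrow> prog" where
  "subfrom a b = Loop a (Dec a ;; Cond (b + 2) 1 Skip (Dec b))"

lemma exec_subfrom:
  assumes "a \<noteq> b" "6 * \<sigma> a + 1 \<le> c"
  shows "exec A (subfrom a b) (tapes \<tau> \<sigma>) c (tapes \<tau> (\<sigma>(a := 0, b := \<sigma> b - \<sigma> a)))"
proof -
  let ?s = "\<lambda>j. \<sigma>(a := j, b := \<sigma> b - (\<sigma> a - j))"
  have "exec A (subfrom a b) (tapes \<tau> (?s (\<sigma> a))) c (tapes \<tau> (?s 0))"
    unfolding subfrom_def
  proof (rule exec_Loop[where c = 4])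
    fix j assume j: "j < \<sigma> a"
    let ?r = "(?s (Suc j))(a := j)"
    have 1: "exec A (Dec a) (tapes \<tau> (?s (Suc j))) 1 (tapes \<tau> ?r)"
      using assms by (intro exec_Dec) auto
    have 2: "exec A (Cond (b + 2) 1 Skip (Dec b)) (tapes \<tau> ?r) 3 (tapes \<tau> (?s j))"
    proof (cases "?r b = 0")
      case True
      then have "\<sigma> b - (\<sigma> a - Suc j) = 0" using assms(1) by auto
      then have "\<sigma> b - (\<sigma> a - j) = 0" by simp
      then have s: "?s j = ?r" using True assms(1) by (auto simp: fun_eq_iff)
      have r: "tape_read (tapes \<tau> ?r (b + 2)) = 1" using True by (simp add: tapes_def)
      show ?thesis unfolding s by (rule exec_CondT[where f = "tapes \<tau> ?r" and i = "b + 2", OF r exec_Skip[of _ _ 0]]) simp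
    next
      case False
      then obtain n where n: "?r b = Suc n" by (cases "?r b") auto
      then have "\<sigma> b - (\<sigma> a - Suc j) = Suc n" using assms(1) by auto
      then have "\<sigma> b - (\<sigma> a - j) = n" using j by simp
      then have s: "?s j = ?r(b := n)" using assms(1) by (auto simp: fun_eq_iff)
      have r: "tape_read (tapes \<tau> ?r (b + 2)) \<noteq> 1" using False by (simp add: tapes_def)
      show ?thesis unfolding s by (rule exec_CondF[where f = "tapes \<tau> ?r" and i = "b + 2", OF r exec_Dec[where \<sigma> = ?r and r = b, OF n order_refl]]) simp
    qed
    show "exec A (Dec a ;; Cond (b + 2) 1 Skip (Dec b)) (tapes \<tau> (?s (Suc j))) 4 (tapes \<tau> (?s j))"
      by (rule exec_Seq[OF 1 2]) simp
  qed (use assms in auto)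
  moreover have "?s (\<sigma> a) = \<sigma>" by auto
  ultimately show ?thesis by simp
qed

text \<open>Reading out a counter destroys it, so two copies are made at once and the auxiliary one
  is moved back.\<close>

definition copyto :: "nat \<Rightarrow> nat \<Rightarrow> nat \<Rightarrow> prog" where
  "copyto a b t = Loop a (Dec a ;; Inc b ;; Inc t) ;; addto t a"

lemma exec_copyto:
  assumes "a \<noteq> b" "a \<noteq> t" "b \<noteq> t" "\<sigma> b = 0" "\<sigma> t = 0" "9 * \<sigma> a + 2 \<le> c"
  shows "exec A (copyto a b t) (tapes \<tau> \<sigma>) c (tapes \<tau> (\<sigma>(b := \<sigma> a)))"
proof -
  let ?s = "\<lambda>j. \<sigma>(a := j, b := \<sigma> a - j, t := \<sigma> a - j)"
  have 1: "exec A (Loop a (Dec a ;; Inc b ;; Inc t)) (tapes \<tau> (?s (\<sigma> a))) (5 * \<sigma> a + 1) (tapes \<tau> (?s 0))"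
  proof (rule exec_Loop[where c = 3])
    fix j assume j: "j < \<sigma> a"
    let ?r = "(?s (Suc j))(a := j)" let ?r' = "?r(b := \<sigma> a - j)"
    have 1: "exec A (Dec a) (tapes \<tau> (?s (Suc j))) 1 (tapes \<tau> ?r)"
      using assms by (intro exec_Dec) auto
    have "?r' = ?r(b := Suc (?r b))" "?s j = ?r'(t := Suc (?r' t))"
      using assms(1-3) j by (auto simp: fun_eq_iff)
    then have "exec A (Inc b) (tapes \<tau> ?r) 1 (tapes \<tau> ?r')" "exec A (Inc t) (tapes \<tau> ?r') 1 (tapes \<tau> (?s j))"
      by (metis exec_Inc order_refl)+
    from exec_Seq[OF 1 exec_Seq[OF this order_refl], of 3]
    show "exec A (Dec a ;; Inc b ;; Inc t) (tapes \<tau> (?s (Suc j))) 3 (tapes \<tau> (?s j))" by simp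
  qed (use assms in auto)
  have "exec A (addto t a) (tapes \<tau> (?s 0)) (4 * \<sigma> a + 1) (tapes \<tau> ((?s 0)(t := 0, a := ?s 0 a + ?s 0 t)))"
    using assms by (intro exec_addto) auto
  moreover have "(?s 0)(t := 0, a := ?s 0 a + ?s 0 t) = \<sigma>(b := \<sigma> a)" using assms by (auto simp: fun_eq_iff)
  moreover have "?s (\<sigma> a) = \<sigma>" using assms by (auto simp: fun_eq_iff)
  ultimately have s: "exec A (addto t a) (tapes \<tau> (?s 0)) (4 * \<sigma> a + 1) (tapes \<tau> (\<sigma>(b := \<sigma> a)))"
    "exec A (Loop a (Dec a ;; Inc b ;; Inc t)) (tapes \<tau> \<sigma>) (5 * \<sigma> a + 1) (tapes \<tau> (?s 0))"
    using 1 by simp_all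
  show ?thesis unfolding copyto_def by (rule exec_Seq[OF s(2,1)]) (use assms(6) in linarith)
qed

section \<open>Definable functions\<close>

type_synonym tables = "nat \<Rightarrow> nat \<Rightarrow> nat"
type_synonym scheme = "nat \<Rightarrow> lang \<Rightarrow> (nat \<Rightarrow> tape) \<Rightarrow> tables \<Rightarrow> bool"

text \<open>Functions of an environment of natural numbers (addressed by de Bruijn indices) with access to
  the tables in \<open>T\<close>. All their values are polynomially bounded, so that counter machines compute
  them in polynomial time.\<close>

inductive definable :: "nat set \<Rightarrow> (tables \<Rightarrow> (nat \<Rightarrow> nat) \<Rightarrow> nat) \<Rightarrow> bool" for T where
  d_var: "definable T (\<lambda>Tb s. s n)"
| d_one: "definable T (\<lambda>Tb s. 1)"
| d_add: "definable T f \<Longrightarrow> definable T g \<Longrightarrow> definable T (\<lambda>Tb s. f Tb s + g Tb s)"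
| d_sub: "definable T f \<Longrightarrow> definable T g \<Longrightarrow> definable T (\<lambda>Tb s. f Tb s - g Tb s)"
| d_sum': "definable T f \<Longrightarrow> definable T g \<Longrightarrow> definable T (\<lambda>Tb s. \<Sum>i<f Tb s. g Tb (case_nat i s))"
| d_tab: "j \<in> T \<Longrightarrow> definable T f \<Longrightarrow> definable T (\<lambda>Tb s. Tb j (f Tb s))"

text \<open>A scheme relates a size bound, an oracle and the contents of tapes 0 and 1 to the tables they
  represent. The flag \<open>b\<close> forbids oracle queries. Registers from \<open>d\<close> on are free, and the result goes to
  register \<open>d\<close>.\<close>

definition implements_table :: "bool \<Rightarrow> scheme \<Rightarrow> nat \<Rightarrow> bool" where
  "implements_table b S j \<longleftrightarrow> (\<exists>B. \<forall>N A \<tau> Tb v. S N A \<tau> Tb \<longrightarrow> Tb j v \<le> B) \<and>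
     (\<forall>d. \<exists>p K (P :: nat poly). wf_prog K p \<and> (b \<longrightarrow> no_ask p) \<and>
       (\<forall>N A \<tau> Tb \<sigma>. S N A \<tau> Tb \<longrightarrow> \<sigma> d \<le> N \<longrightarrow> (\<forall>r>d. \<sigma> r = 0) \<longrightarrow>
          exec A p (tapes \<tau> \<sigma>) (poly P N) (tapes \<tau> (\<sigma>(d := Tb j (\<sigma> d))))))"

definition bounds :: "scheme \<Rightarrow> (tables \<Rightarrow> (nat \<Rightarrow> nat) \<Rightarrow> nat) \<Rightarrow> nat poly \<Rightarrow> bool" where
  "bounds S f B \<longleftrightarrow> (\<forall>N A \<tau> Tb s. S N A \<tau> Tb \<longrightarrow> (\<forall>n. s n \<le> N) \<longrightarrow> f Tb s \<le> poly B N)"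

definition runs :: "bool \<Rightarrow> scheme \<Rightarrow> (nat \<Rightarrow> nat) \<Rightarrow> nat \<Rightarrow> (tables \<Rightarrow> (nat \<Rightarrow> nat) \<Rightarrow> nat) \<Rightarrow>
    prog \<Rightarrow> nat \<Rightarrow> nat poly \<Rightarrow> bool" where
  "runs b S \<rho> d f p K P \<longleftrightarrow> wf_prog K p \<and> (b \<longrightarrow> no_ask p) \<and>
     (\<forall>N A \<tau> Tb \<sigma>. S N A \<tau> Tb \<longrightarrow> (\<forall>n. \<sigma> (\<rho> n) \<le> N) \<longrightarrow> (\<forall>r\<ge>d. \<sigma> r = 0) \<longrightarrow>
        exec A p (tapes \<tau> \<sigma>) (poly P N) (tapes \<tau> (\<sigma>(d := f Tb (\<lambda>n. \<sigma> (\<rho> n))))))"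

text \<open>The allocation \<open>\<rho>\<close> of variables to registers need not be injective, so
  that the infinitely many variables of an environment fit below \<open>d\<close>. It is universally
  quantified because a sum binds a new variable and evaluates its body under a changed
  allocation.\<close>

definition implements :: "bool \<Rightarrow> scheme \<Rightarrow> (tables \<Rightarrow> (nat \<Rightarrow> nat) \<Rightarrow> nat) \<Rightarrow> bool" where
  "implements b S f \<longleftrightarrow> (\<exists>B. bounds S f B) \<and>
     (\<forall>\<rho> d. (\<forall>n. \<rho> n < d) \<longrightarrow> (\<exists>p K P. runs b S \<rho> d f p K P))"

lemma implements_prog:
  "implements b S f \<Longrightarrow> \<forall>n. \<rho> n < d \<Longrightarrow> \<exists>p K P. runs b S \<rho> d f p K P"
  unfolding implements_def by simp

lemma implements_bounds: "implements b S f \<Longrightarrow> \<exists>B. bounds S f B"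
  unfolding implements_def by simp

lemma boundsD: "bounds S f B \<Longrightarrow> S N A \<tau> Tb \<Longrightarrow> \<forall>n. s n \<le> N \<Longrightarrow> f Tb s \<le> poly B N"
  unfolding bounds_def by blast

lemma runsD:
  assumes "runs b S \<rho> d f p K P" "S N A \<tau> Tb" "\<forall>n. \<sigma> (\<rho> n) \<le> N" "\<forall>r\<ge>d. \<sigma> r = 0"
  shows "exec A p (tapes \<tau> \<sigma>) (poly P N) (tapes \<tau> (\<sigma>(d := f Tb (\<lambda>n. \<sigma> (\<rho> n)))))"
  using assms(1)[unfolded runs_def, THEN conjunct2, THEN conjunct2, rule_format, of N A \<tau> Tb \<sigma>] assms(2-) by simp

lemma implementsI:
  assumes "bounds S f B" "\<And>\<rho> d. \<forall>n. \<rho> n < d \<Longrightarrow> \<exists>p K P. runs b S \<rho> d f p K P"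
  shows "implements b S f"
  using assms unfolding implements_def by blast

lemma runsI:
  assumes "wf_prog K p" "b \<Longrightarrow> no_ask p"
    "\<And>N A \<tau> Tb \<sigma>. S N A \<tau> Tb \<Longrightarrow> \<forall>n. \<sigma> (\<rho> n) \<le> N \<Longrightarrow> \<forall>r\<ge>d. \<sigma> r = 0 \<Longrightarrow>
        exec A p (tapes \<tau> \<sigma>) (poly P N) (tapes \<tau> (\<sigma>(d := f Tb (\<lambda>n. \<sigma> (\<rho> n)))))"
  shows "runs b S \<rho> d f p K P"
  using assms unfolding runs_def by blast

lemma runs_wf: "runs b S \<rho> d f p K P \<Longrightarrow> K \<le> K' \<Longrightarrow> wf_prog K' p"
  unfolding runs_def using wf_prog_mono by blast

lemma runs_no_ask: "runs b S \<rho> d f p K P \<Longrightarrow> b \<Longrightarrow> no_ask p"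
  unfolding runs_def by blast

text \<open>The condition on \<open>h\<close> covers both addition and truncated subtraction and
  keeps the values polynomially bounded.\<close>

lemma implements_binary:
  assumes f: "implements b S f" and g: "implements b S g"
    and h: "\<And>x y. h x y \<le> x + y"
    and wf: "\<And>d. wf_prog (d + 4) (q d)" "\<And>d. no_ask (q d)"
    and q: "\<And>A \<tau> \<sigma> d. exec A (q d) (tapes \<tau> \<sigma>) (6 * \<sigma> (Suc d) + 1) (tapes \<tau> (\<sigma>(Suc d := 0, d := h (\<sigma> d) (\<sigma> (Suc d)))))"
  shows "implements b S (\<lambda>Tb s. h (f Tb s) (g Tb s))"
proof -
  obtain Bf Bg where B: "bounds S f Bf" "bounds S g Bg" using implements_bounds[OF f] implements_bounds[OF g] by blast
  show ?thesis
  proof (rule implementsI)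
    show "bounds S (\<lambda>Tb s. h (f Tb s) (g Tb s)) (Bf + Bg)"
      unfolding bounds_def
    proof (intro allI impI)
      fix N A \<tau> Tb and s :: "nat \<Rightarrow> nat" assume *: "S N A \<tau> Tb" "\<forall>n. s n \<le> N"
      show "h (f Tb s) (g Tb s) \<le> poly (Bf + Bg) N"
        using h[of "f Tb s" "g Tb s"] boundsD[OF B(1), OF *] boundsD[OF B(2), OF *] unfolding poly_add by linarith
    qed
  next
    fix \<rho> :: "nat \<Rightarrow> nat" and d assume \<rho>: "\<forall>n. \<rho> n < d"
    obtain p1 K1 P1 where 1: "runs b S \<rho> d f p1 K1 P1"
      using implements_prog[OF f \<rho>] by blast
    have "\<forall>n. \<rho> n < Suc d" using \<rho> by (auto intro: less_SucI)
    from implements_prog[OF g this] obtain p2 K2 P2 where 2: "runs b S \<rho> (Suc d) g p2 K2 P2"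
      by blast
    let ?P = "P1 + (P2 + ([:6:] * Bg + [:1:]))"
    have "runs b S \<rho> d (\<lambda>Tb s. h (f Tb s) (g Tb s)) (p1 ;; p2 ;; q d) (K1 + K2 + d + 4) ?P"
    proof (rule runsI)
      show "wf_prog (K1 + K2 + d + 4) (p1 ;; p2 ;; q d)"
        using runs_wf[OF 1] runs_wf[OF 2] wf(1)[of d] by (auto elim: wf_prog_mono)
      show "no_ask (p1 ;; p2 ;; q d)" if b using runs_no_ask[OF 1 that] runs_no_ask[OF 2 that] wf(2) by simp
    next
      fix N A \<tau> Tb \<sigma> assume *: "S N A \<tau> Tb" "\<forall>n. \<sigma> (\<rho> n) \<le> N" "\<forall>r\<ge>d. \<sigma> r = 0"
      define s where "s = (\<lambda>n. \<sigma> (\<rho> n))"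
      define \<sigma>1 where "\<sigma>1 = \<sigma>(d := f Tb s)"
      have e: "\<sigma>1 (\<rho> n) = s n" for n using \<rho> by (simp add: \<sigma>1_def s_def less_imp_neq)
      have e1: "exec A p1 (tapes \<tau> \<sigma>) (poly P1 N) (tapes \<tau> \<sigma>1)"
        using runsD[OF 1, OF *] by (simp add: \<sigma>1_def s_def)
      have "exec A p2 (tapes \<tau> \<sigma>1) (poly P2 N) (tapes \<tau> (\<sigma>1(Suc d := g Tb (\<lambda>n. \<sigma>1 (\<rho> n)))))"
        by (rule runsD[OF 2, OF *(1)]) (use e * in \<open>auto simp: s_def \<sigma>1_def\<close>)
      then have e2: "exec A p2 (tapes \<tau> \<sigma>1) (poly P2 N) (tapes \<tau> (\<sigma>1(Suc d := g Tb s)))" by (simp add: e)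
      have gb: "g Tb s \<le> poly Bg N" by (rule boundsD[OF B(2), OF *(1)]) (use *(2) in \<open>simp add: s_def\<close>)
      have "exec A (q d) (tapes \<tau> (\<sigma>1(Suc d := g Tb s))) (6 * g Tb s + 1)
          (tapes \<tau> (\<sigma>1(Suc d := g Tb s, Suc d := 0, d := h (f Tb s) (g Tb s))))"
        using q[of A d \<tau> "\<sigma>1(Suc d := g Tb s)"] by (simp add: \<sigma>1_def)
      moreover have "\<sigma>1(Suc d := g Tb s, Suc d := 0, d := h (f Tb s) (g Tb s)) = \<sigma>(d := h (f Tb s) (g Tb s))"
        using *(3) by (auto simp: fun_eq_iff \<sigma>1_def)
      ultimately have e3: "exec A (q d) (tapes \<tau> (\<sigma>1(Suc d := g Tb s))) (6 * poly Bg N + 1)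
          (tapes \<tau> (\<sigma>(d := h (f Tb s) (g Tb s))))" using gb by (auto elim: exec_mono)
      have "exec A (p1 ;; p2 ;; q d) (tapes \<tau> \<sigma>) (poly ?P N) (tapes \<tau> (\<sigma>(d := h (f Tb s) (g Tb s))))"
        by (rule exec_Seq[OF e1 exec_Seq[OF e2 e3 order_refl]]) simp
      then show "exec A (p1 ;; p2 ;; q d) (tapes \<tau> \<sigma>) (poly ?P N)
          (tapes \<tau> (\<sigma>(d := h (f Tb (\<lambda>n. \<sigma> (\<rho> n))) (g Tb (\<lambda>n. \<sigma> (\<rho> n))))))" by (simp only: s_def)
    qed
    then show "\<exists>p K P. runs b S \<rho> d (\<lambda>Tb s. h (f Tb s) (g Tb s)) p K P" by blast
  qed
qed

text \<open>In the body the environment also contains the summation index, which may reach the value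
  of \<open>f\<close>. The size bound therefore grows from \<open>N\<close> to \<open>H\<close> at
  \<open>N\<close>, and the polynomials of the body are composed with \<open>H\<close>; monotonicity
  of the scheme allows this change of \<open>N\<close>.\<close>

lemma implements_sum:
  assumes f: "implements b S f" and g: "implements b S g"
    and mono: "\<And>N N' A \<tau> Tb. S N A \<tau> Tb \<Longrightarrow> N \<le> N' \<Longrightarrow> S N' A \<tau> Tb"
  shows "implements b S (\<lambda>Tb s. \<Sum>i<f Tb s. g Tb (case_nat i s))"
proof -
  obtain Bf Bg where B: "bounds S f Bf" "bounds S g Bg" using implements_bounds[OF f] implements_bounds[OF g] by blast
  define H where "H = [:0, 1:] + Bf"
  define Bg' where "Bg' = pcompose Bg H"
  have SH: "S (poly H N) A \<tau> Tb" if "S N A \<tau> Tb" for N A \<tau> Tb using mono[OF that] by (simp add: H_def)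
  have Bg': "g Tb (case_nat i s) \<le> poly Bg' N" if "S N A \<tau> Tb" "\<forall>n. s n \<le> N" "i \<le> f Tb s" for N A \<tau> Tb s i
  proof -
    have c: "\<forall>n. case_nat i s n \<le> poly H N"
      using that(2,3) boundsD[OF B(1), OF that(1,2)] by (auto simp: H_def trans_le_add1 trans_le_add2 split: nat.split)
    have "g Tb (case_nat i s) \<le> poly Bg (poly H N)" by (rule boundsD[OF B(2), OF SH[OF that(1)] c])
    then show ?thesis by (simp add: Bg'_def poly_pcompose)
  qed
  have sum: "(\<Sum>i<f Tb s. g Tb (case_nat i s)) \<le> poly (Bf * Bg') N"
    if "S N A \<tau> Tb" "\<forall>n. s n \<le> N" for N A \<tau> Tb s
  proof -
    have "(\<Sum>i<f Tb s. g Tb (case_nat i s)) \<le> of_nat (card {..<f Tb s}) * poly Bg' N"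
      by (rule sum_bounded_above) (use Bg'[OF that] in auto)
    also have "\<dots> \<le> poly Bf N * poly Bg' N"
      using boundsD[OF B(1), OF that] by (intro mult_le_mono) auto
    finally show ?thesis by simp
  qed
  show ?thesis
  proof (rule implementsI)
    show "bounds S (\<lambda>Tb s. \<Sum>i<f Tb s. g Tb (case_nat i s)) (Bf * Bg')"
      unfolding bounds_def using sum by blast
  next
    fix \<rho> :: "nat \<Rightarrow> nat" and d assume \<rho>: "\<forall>n. \<rho> n < d"
    obtain p1 K1 P1 where 1: "runs b S \<rho> d f p1 K1 P1"
      using implements_prog[OF f \<rho>] by blast
    \<comment> \<open>The loop counter in register \<open>d\<close> doubles as the summation index;
      \<open>d + 1\<close> accumulates the sum, and the body works from \<open>d + 2\<close>
      on.\<close>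
    define \<rho>' where "\<rho>' = case_nat d \<rho>"
    have "\<forall>n. \<rho>' n < d + 2" using \<rho> by (auto simp: \<rho>'_def less_Suc_eq split: nat.split)
    from implements_prog[OF g this] obtain p2 K2 P2 where 2: "runs b S \<rho>' (d + 2) g p2 K2 P2"
      by blast
    define body where "body = (Dec d ;; p2 ;; addto (d + 2) (d + 1))"
    let ?p = "p1 ;; Loop d body ;; addto (d + 1) d" let ?K = "K1 + K2 + d + 5"
    define C where "C = [:1:] + (pcompose P2 H + ([:4:] * Bg' + [:1:]))"
    define L where "L = Bf * (C + [:2:]) + [:1:]"
    let ?P = "P1 + (L + ([:4:] * (Bf * Bg') + [:1:]))"
    have "runs b S \<rho> d (\<lambda>Tb s. \<Sum>i<f Tb s. g Tb (case_nat i s)) ?p ?K ?P"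
    proof (rule runsI)
      show "wf_prog ?K ?p" using runs_wf[OF 1, of ?K] runs_wf[OF 2, of ?K] by (simp add: body_def addto_def)
      show "no_ask ?p" if b using runs_no_ask[OF 1 that] runs_no_ask[OF 2 that] by (simp add: body_def addto_def)
    next
      fix N A \<tau> Tb \<sigma> assume *: "S N A \<tau> Tb" "\<forall>n. \<sigma> (\<rho> n) \<le> N" "\<forall>r\<ge>d. \<sigma> r = 0"
      define s where "s = (\<lambda>n. \<sigma> (\<rho> n))"
      have s: "\<forall>n. s n \<le> N" using *(2) by (simp add: s_def)
      define a where "a = f Tb s"
      \<comment> \<open>Since the counter runs down, the terms are added from the largest index to
        the smallest, and \<open>G j\<close> is the part with indices at least
        \<open>j\<close>.\<close>
      define G where "G j = (\<Sum>i=j..<a. g Tb (case_nat i s))" for j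
      define R where "R j = \<sigma>(d := j, d + 1 := G j)" for j
      have a: "a \<le> poly Bf N" using boundsD[OF B(1), OF *(1) s] by (simp add: a_def)
      have e1: "exec A p1 (tapes \<tau> \<sigma>) (poly P1 N) (tapes \<tau> (R a))"
      proof -
        have "R a = \<sigma>(d := f Tb s)" using *(3) by (auto simp: fun_eq_iff R_def G_def a_def)
        then show ?thesis using runsD[OF 1, OF *] by (simp add: s_def)
      qed
      have "exec A (Loop d body) (tapes \<tau> (R a)) (poly L N) (tapes \<tau> (R 0))"
      proof (rule exec_Loop[where c = "poly C N"])
        fix j assume j: "j < a"
        define r where "r = (R (Suc j))(d := j)"
        have e1: "exec A (Dec d) (tapes \<tau> (R (Suc j))) 1 (tapes \<tau> r)"
          unfolding r_def by (rule exec_Dec) (auto simp: R_def)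
        have e: "r (\<rho>' n) = case_nat j s n" for n
        proof (cases n)
          case (Suc m)
          then show ?thesis using \<rho>[rule_format, of m] by (simp add: r_def R_def \<rho>'_def s_def)
        qed (simp add: r_def \<rho>'_def)
        have "exec A p2 (tapes \<tau> r) (poly P2 (poly H N)) (tapes \<tau> (r(d + 2 := g Tb (\<lambda>n. r (\<rho>' n)))))"
        proof (rule runsD[OF 2, OF SH[OF *(1)]])
          show "\<forall>n. r (\<rho>' n) \<le> poly H N" unfolding e
            using s a j by (auto simp: H_def trans_le_add1 trans_le_add2 split: nat.split)
          show "\<forall>i\<ge>d + 2. r i = 0" using *(3) by (simp add: r_def R_def)
        qed
        then have e2: "exec A p2 (tapes \<tau> r) (poly P2 (poly H N)) (tapes \<tau> (r(d + 2 := g Tb (case_nat j s))))"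
          unfolding e by simp
        define r2 where "r2 = r(d + 2 := g Tb (case_nat j s))"
        have "G j = G (Suc j) + g Tb (case_nat j s)"
          unfolding G_def using j by (simp add: sum.atLeast_Suc_lessThan)
        then have r2: "r2(d + 2 := 0, d + 1 := r2 (d + 1) + r2 (d + 2)) = R j"
          using *(3) by (auto simp: fun_eq_iff r2_def r_def R_def)
        have gb: "g Tb (case_nat j s) \<le> poly Bg' N"
          using Bg'[OF *(1) s] j by (simp add: a_def)
        have "exec A (addto (d + 2) (d + 1)) (tapes \<tau> r2) (4 * poly Bg' N + 1)
           (tapes \<tau> (r2(d + 2 := 0, d + 1 := r2 (d + 1) + r2 (d + 2))))"
          by (rule exec_addto) (use gb in \<open>auto simp: r2_def\<close>)
        then have e3: "exec A (addto (d + 2) (d + 1)) (tapes \<tau> r2) (4 * poly Bg' N + 1) (tapes \<tau> (R j))"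
          unfolding r2 .
        show "exec A body (tapes \<tau> (R (Suc j))) (poly C N) (tapes \<tau> (R j))"
          unfolding body_def
          by (rule exec_Seq[OF e1 exec_Seq[OF e2[folded r2_def] e3 order_refl]]) (simp add: poly_pcompose C_def)
      next
        show "a * (poly C N + 2) + 1 \<le> poly L N"
          using mult_le_mono1[OF a, of "poly C N + 2"] by (simp add: L_def)
      qed (simp add: R_def)
      moreover have "exec A (addto (d + 1) d) (tapes \<tau> (R 0)) (poly ([:4:] * (Bf * Bg') + [:1:]) N)
          (tapes \<tau> (\<sigma>(d := G 0)))"
      proof -
        have G0: "G 0 \<le> poly (Bf * Bg') N"
          using sum[OF *(1) s] by (simp add: G_def a_def lessThan_atLeast0)
        have "(R 0)(d + 1 := 0, d := R 0 d + R 0 (d + 1)) = \<sigma>(d := G 0)"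
          using *(3) by (auto simp: fun_eq_iff R_def)
        moreover have "exec A (addto (d + 1) d) (tapes \<tau> (R 0)) (poly ([:4:] * (Bf * Bg') + [:1:]) N)
            (tapes \<tau> ((R 0)(d + 1 := 0, d := R 0 d + R 0 (d + 1))))"
          by (rule exec_addto) (use G0 in \<open>auto simp: R_def\<close>)
        ultimately show ?thesis by simp
      qed
      ultimately have "exec A ?p (tapes \<tau> \<sigma>) (poly ?P N) (tapes \<tau> (\<sigma>(d := G 0)))"
        by (intro exec_Seq[OF e1 exec_Seq[OF _ _ order_refl]]) (assumption | simp)+
      then show "exec A ?p (tapes \<tau> \<sigma>) (poly ?P N)
        (tapes \<tau> (\<sigma>(d := (\<Sum>i<f Tb (\<lambda>n. \<sigma> (\<rho> n)). g Tb (case_nat i (\<lambda>n. \<sigma> (\<rho> n)))))))"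
        by (simp only: G_def a_def lessThan_atLeast0 s_def)
    qed
    then show "\<exists>p K P. runs b S \<rho> d (\<lambda>Tb s. \<Sum>i<f Tb s. g Tb (case_nat i s)) p K P" by blast
  qed
qed

lemma implements_var: "implements b S (\<lambda>Tb s. s n)"
proof (rule implementsI)
  show "bounds S (\<lambda>Tb s. s n) [:0, 1:]" by (simp add: bounds_def)
next
  fix \<rho> :: "nat \<Rightarrow> nat" and d assume \<rho>: "\<forall>n. \<rho> n < d"
  have "runs b S \<rho> d (\<lambda>Tb s. s n) (copyto (\<rho> n) d (d + 1)) (d + 4) [:2, 9:]"
  proof (rule runsI)
    fix N A \<tau> Tb \<sigma> assume *: "S N A \<tau> Tb" "\<forall>n. \<sigma> (\<rho> n) \<le> N" "\<forall>r\<ge>d. \<sigma> r = 0"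
    show "exec A (copyto (\<rho> n) d (d + 1)) (tapes \<tau> \<sigma>) (poly [:2, 9:] N) (tapes \<tau> (\<sigma>(d := \<sigma> (\<rho> n))))"
      by (rule exec_copyto) (use *(2,3) \<rho>[rule_format, of n] in auto)
  qed (use \<rho>[rule_format, of n] in \<open>auto simp: copyto_def addto_def\<close>)
  then show "\<exists>p K P. runs b S \<rho> d (\<lambda>Tb s. s n) p K P" by blast
qed

lemma implements_one: "implements b S (\<lambda>Tb s. 1)"
proof (rule implementsI)
  show "bounds S (\<lambda>Tb s. 1) [:1:]" by (simp add: bounds_def)
next
  fix \<rho> :: "nat \<Rightarrow> nat" and d assume \<rho>: "\<forall>n. \<rho> n < d"
  have "runs b S \<rho> d (\<lambda>Tb s. 1) (Inc d) (d + 4) [:1:]"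
  proof (rule runsI)
    fix N A \<tau> Tb \<sigma> assume *: "S N A \<tau> Tb" "\<forall>n. \<sigma> (\<rho> n) \<le> N" "\<forall>r\<ge>d. \<sigma> r = 0"
    show "exec A (Inc d) (tapes \<tau> \<sigma>) (poly [:1:] N) (tapes \<tau> (\<sigma>(d := 1)))"
      using exec_Inc[of 1 A d \<tau> \<sigma>] *(3) by simp
  qed auto
  then show "\<exists>p K P. runs b S \<rho> d (\<lambda>Tb s. 1) p K P" by blast
qed

lemma implements_tab:
  assumes f: "implements b S f" and tab: "implements_table b S j"
    and mono: "\<And>N N' A \<tau> Tb. S N A \<tau> Tb \<Longrightarrow> N \<le> N' \<Longrightarrow> S N' A \<tau> Tb"
  shows "implements b S (\<lambda>Tb s. Tb j (f Tb s))"
proof -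
  obtain Bf where Bf: "bounds S f Bf" using implements_bounds[OF f] by blast
  obtain B where B: "\<forall>N A \<tau> Tb v. S N A \<tau> Tb \<longrightarrow> Tb j v \<le> B"
    using tab unfolding implements_table_def by blast
  show ?thesis
  proof (rule implementsI)
    show "bounds S (\<lambda>Tb s. Tb j (f Tb s)) [:B:]" using B by (simp add: bounds_def)
  next
    fix \<rho> :: "nat \<Rightarrow> nat" and d assume \<rho>: "\<forall>n. \<rho> n < d"
    obtain p1 K1 P1 where 1: "runs b S \<rho> d f p1 K1 P1"
      using implements_prog[OF f \<rho>] by blast
    obtain p2 K2 P2 where 2: "wf_prog K2 p2" "b \<longrightarrow> no_ask p2"
      "\<forall>N A \<tau> Tb \<sigma>. S N A \<tau> Tb \<longrightarrow> \<sigma> d \<le> N \<longrightarrow> (\<forall>r>d. \<sigma> r = 0) \<longrightarrow>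
          exec A p2 (tapes \<tau> \<sigma>) (poly P2 N) (tapes \<tau> (\<sigma>(d := Tb j (\<sigma> d))))"
      using tab[unfolded implements_table_def, THEN conjunct2, THEN spec[where x = d]] by (elim exE conjE)
    define H where "H = [:0, 1:] + Bf"
    let ?P = "P1 + pcompose P2 H"
    have "runs b S \<rho> d (\<lambda>Tb s. Tb j (f Tb s)) (p1 ;; p2) (K1 + K2) ?P"
    proof (rule runsI)
      show "wf_prog (K1 + K2) (p1 ;; p2)" using runs_wf[OF 1] 2(1) by (auto elim: wf_prog_mono)
      show "no_ask (p1 ;; p2)" if b using runs_no_ask[OF 1 that] 2(2) that by simp
    next
      fix N A \<tau> Tb \<sigma> assume *: "S N A \<tau> Tb" "\<forall>n. \<sigma> (\<rho> n) \<le> N" "\<forall>r\<ge>d. \<sigma> r = 0"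
      define r where "r = \<sigma>(d := f Tb (\<lambda>n. \<sigma> (\<rho> n)))"
      have "S (poly H N) A \<tau> Tb" using mono[OF *(1)] by (simp add: H_def)
      moreover have "r d \<le> poly H N" using boundsD[OF Bf, OF *(1,2)] by (simp add: H_def r_def)
      moreover have "\<forall>i>d. r i = 0" using *(3) by (simp add: r_def)
      ultimately have "exec A p2 (tapes \<tau> r) (poly P2 (poly H N)) (tapes \<tau> (r(d := Tb j (r d))))"
        using 2(3) by blast
      moreover have "r(d := Tb j (r d)) = \<sigma>(d := Tb j (f Tb (\<lambda>n. \<sigma> (\<rho> n))))" by (simp add: r_def)
      ultimately have e2: "exec A p2 (tapes \<tau> r) (poly P2 (poly H N)) (tapes \<tau> (\<sigma>(d := Tb j (f Tb (\<lambda>n. \<sigma> (\<rho> n))))))"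
        by simp
      show "exec A (p1 ;; p2) (tapes \<tau> \<sigma>) (poly ?P N) (tapes \<tau> (\<sigma>(d := Tb j (f Tb (\<lambda>n. \<sigma> (\<rho> n))))))"
        by (rule exec_Seq[OF runsD[OF 1, OF *, folded r_def] e2]) (simp add: poly_pcompose)
    qed
    then show "\<exists>p K P. runs b S \<rho> d (\<lambda>Tb s. Tb j (f Tb s)) p K P" by blast
  qed
qed

theorem implements_definable:
  assumes "definable T f" and tab: "\<And>j. j \<in> T \<Longrightarrow> implements_table b S j"
    and mono: "\<And>N N' A \<tau> Tb. S N A \<tau> Tb \<Longrightarrow> N \<le> N' \<Longrightarrow> S N' A \<tau> Tb"
  shows "implements b S f"
  using assms(1)
proof induction
  case (d_var n)
  show ?case by (rule implements_var)
next
  case d_one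
  show ?case by (rule implements_one)
next
  case (d_add f g)
  show ?case
  proof (rule implements_binary[OF d_add.IH, where q = "\<lambda>d. addto (Suc d) d"])
    show "exec A (addto (Suc d) d) (tapes \<tau> \<sigma>) (6 * \<sigma> (Suc d) + 1) (tapes \<tau> (\<sigma>(Suc d := 0, d := \<sigma> d + \<sigma> (Suc d))))"
      for A \<tau> \<sigma> d by (rule exec_addto) auto
  qed (auto simp: addto_def)
next
  case (d_sub f g)
  show ?case
  proof (rule implements_binary[OF d_sub.IH, where q = "\<lambda>d. subfrom (Suc d) d"])
    show "exec A (subfrom (Suc d) d) (tapes \<tau> \<sigma>) (6 * \<sigma> (Suc d) + 1) (tapes \<tau> (\<sigma>(Suc d := 0, d := \<sigma> d - \<sigma> (Suc d))))"
      for A \<tau> \<sigma> d by (rule exec_subfrom) auto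
  qed (auto simp: subfrom_def)
next
  case (d_sum' f g)
  show ?case by (rule implements_sum[OF d_sum'.IH mono])
next
  case (d_tab j f)
  show ?case by (rule implements_tab[OF d_tab.IH tab[OF d_tab(1)] mono])
qed

section \<open>Machines for definable functions\<close>

definition cell :: "bool list \<Rightarrow> nat \<Rightarrow> nat" where
  "cell x v = (if v < length x then if x ! v then 2 else 1 else 0)"

lemma fst_tape_of: "fst (tape_of x) (int v) = cell x v"
  by (simp add: tape_of_def cell_def)

lemma fst_tape_of_neg: "j < 0 \<Longrightarrow> fst (tape_of x) j = 0"
  by (simp add: tape_of_def)

lemma snd_tape_of [simp]: "snd (tape_of x) = 0"
  by (simp add: tape_of_def)

lemma cell_eq_0: "cell x v = 0 \<longleftrightarrow> length x \<le> v"
  by (simp add: cell_def)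

text \<open>Register \<open>d + 1\<close> records how far the head was moved, so that it can be
  brought back to cell 0. In between, register \<open>d\<close> is 0 and receives the scanned
  symbol.\<close>

definition readp :: "nat \<Rightarrow> nat \<Rightarrow> prog" where
  "readp j d = Loop d (Dec d ;; Inc (d + 1) ;; Step j None MRight) ;;
     Cond j 1 (Inc d) (Cond j 2 (Inc d ;; Inc d) Skip) ;; Loop (d + 1) (Dec (d + 1) ;; Step j None MLeft)"

lemma exec_readp:
  assumes j: "j < 2" and x: "\<tau> j = tape_of x" and z: "\<sigma> (d + 1) = 0"
  shows "exec A (readp j d) (tapes \<tau> \<sigma>) (9 * \<sigma> d + 8) (tapes \<tau> (\<sigma>(d := cell x (\<sigma> d))))"
proof -
  define v h where "v = \<sigma> d" and "h = fst (tape_of x)"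
  define T where "T p = \<tau>(j := (h, int p))" for p
  have T0: "T 0 = \<tau>" using x by (auto simp: T_def h_def fun_eq_iff tape_of_def)
  define R where "R k = \<sigma>(d := k, d + 1 := v - k)" for k
  have "exec A (Loop d (Dec d ;; Inc (d + 1) ;; Step j None MRight)) (tapes (T (v - v)) (R v)) (5 * v + 1) (tapes (T (v - 0)) (R 0))"
  proof (rule exec_Loop[where c = 3 and \<tau> = "\<lambda>k. T (v - k)" and \<sigma> = R])
    fix k assume k: "k < v"
    define r where "r = (R (Suc k))(d := k)"
    have 1: "exec A (Dec d) (tapes (T (v - Suc k)) (R (Suc k))) 1 (tapes (T (v - Suc k)) r)"
      unfolding r_def by (rule exec_Dec) (auto simp: R_def)
    have 2: "exec A (Inc (d + 1)) (tapes (T (v - Suc k)) r) 1 (tapes (T (v - Suc k)) (R k))"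
    proof -
      have "R k = r(d + 1 := Suc (r (d + 1)))" using k by (auto simp: R_def r_def fun_eq_iff)
      then show ?thesis using exec_Inc[of 1 A "d + 1" "T (v - Suc k)" r] by simp
    qed
    have 3: "exec A (Step j None MRight) (tapes (T (v - Suc k)) (R k)) 1 (tapes (T (v - k)) (R k))"
    proof -
      have "T (v - k) = (T (v - Suc k))(j := (fst (T (v - Suc k) j), move_pos MRight (snd (T (v - Suc k) j))))"
        using k by (auto simp: T_def fun_eq_iff)
      then show ?thesis using exec_move[OF j, of 1 A MRight "T (v - Suc k)" "R k"] by simp
    qed
    show "exec A (Dec d ;; Inc (d + 1) ;; Step j None MRight) (tapes (T (v - Suc k)) (R (Suc k))) 3 (tapes (T (v - k)) (R k))"
      by (rule exec_Seq[OF 1 exec_Seq[OF 2 3 order_refl]]) simp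
  qed (auto simp: R_def)
  moreover have "R v = \<sigma>" using z by (auto simp: R_def v_def fun_eq_iff)
  ultimately have 1: "exec A (Loop d (Dec d ;; Inc (d + 1) ;; Step j None MRight)) (tapes \<tau> \<sigma>) (5 * v + 1) (tapes (T v) (R 0))"
    using T0 by simp
  define Q where "Q k = \<sigma>(d := cell x v, d + 1 := k)" for k
  have rd: "tape_read (tapes (T v) r j) = cell x v" for r
    using j by (simp add: tapes_def T_def tape_read_def h_def fst_tape_of)
  have 2: "exec A (Cond j 1 (Inc d) (Cond j 2 (Inc d ;; Inc d) Skip)) (tapes (T v) (R 0)) 6 (tapes (T v) (Q v))"
  proof -
    have "cell x v = 1 \<or> cell x v = 2 \<or> cell x v = 0" by (simp add: cell_def)
    then show ?thesis
    proof (elim disjE)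
      assume 1: "cell x v = 1"
      have "Q v = (R 0)(d := Suc (R 0 d))" using 1 by (auto simp: Q_def R_def fun_eq_iff)
      then have "exec A (Inc d) (tapes (T v) (R 0)) 1 (tapes (T v) (Q v))" using exec_Inc[of 1 A d "T v" "R 0"] by simp
      then show ?thesis by (rule exec_CondT[rotated]) (use rd 1 in auto)
    next
      assume 2: "cell x v = 2"
      let ?r = "(R 0)(d := Suc (R 0 d))"
      have "Q v = ?r(d := Suc (?r d))" using 2 by (auto simp: Q_def R_def fun_eq_iff)
      then have "exec A (Inc d) (tapes (T v) ?r) 1 (tapes (T v) (Q v))" using exec_Inc[of 1 A d "T v" ?r] by simp
      from exec_Seq[OF exec_Inc[OF order_refl] this order_refl]
      have "exec A (Inc d ;; Inc d) (tapes (T v) (R 0)) 2 (tapes (T v) (Q v))" by (simp add: numeral_2_eq_2)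
      then have "exec A (Cond j 2 (Inc d ;; Inc d) Skip) (tapes (T v) (R 0)) 4 (tapes (T v) (Q v))"
        by (rule exec_CondT[rotated]) (use rd 2 in auto)
      then show ?thesis by (rule exec_CondF[rotated]) (use rd 2 in auto)
    next
      assume 3: "cell x v = 0"
      have "Q v = R 0" using 3 by (auto simp: Q_def R_def fun_eq_iff)
      then have "exec A Skip (tapes (T v) (R 0)) 0 (tapes (T v) (Q v))" by (simp add: exec_Skip)
      then have "exec A (Cond j 2 (Inc d ;; Inc d) Skip) (tapes (T v) (R 0)) 2 (tapes (T v) (Q v))"
        by (rule exec_CondF[rotated]) (use rd 3 in auto)
      then show ?thesis by (rule exec_CondF[rotated]) (use rd 3 in auto)
    qed
  qed
  have 3: "exec A (Loop (d + 1) (Dec (d + 1) ;; Step j None MLeft)) (tapes (T v) (Q v)) (4 * v + 1) (tapes (T 0) (Q 0))"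
  proof (rule exec_Loop[where c = 2 and \<tau> = T and \<sigma> = Q])
    fix k assume k: "k < v"
    have 1: "exec A (Dec (d + 1)) (tapes (T (Suc k)) (Q (Suc k))) 1 (tapes (T (Suc k)) (Q k))"
    proof -
      have "Q k = (Q (Suc k))(d + 1 := k)" by (auto simp: Q_def)
      then show ?thesis using exec_Dec[of "Q (Suc k)" "d + 1" k 1 A "T (Suc k)"] by (simp add: Q_def)
    qed
    have 2: "exec A (Step j None MLeft) (tapes (T (Suc k)) (Q k)) 1 (tapes (T k) (Q k))"
    proof -
      have "T k = (T (Suc k))(j := (fst (T (Suc k) j), move_pos MLeft (snd (T (Suc k) j))))"
        by (auto simp: T_def fun_eq_iff)
      then show ?thesis using exec_move[OF j, of 1 A MLeft "T (Suc k)" "Q k"] by simp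
    qed
    show "exec A (Dec (d + 1) ;; Step j None MLeft) (tapes (T (Suc k)) (Q (Suc k))) 2 (tapes (T k) (Q k))"
      by (rule exec_Seq[OF 1 2]) simp
  qed (auto simp: Q_def)
  have "Q 0 = \<sigma>(d := cell x v)" using z by (auto simp: Q_def fun_eq_iff)
  then show ?thesis unfolding readp_def v_def[symmetric]
    using exec_Seq[OF 1 exec_Seq[OF 2 3 order_refl], of "9 * v + 8"] T0 by simp
qed

lemma implements_table_word:
  assumes "j < 2" "\<And>N A \<tau> Tb. S N A \<tau> Tb \<Longrightarrow> \<exists>x. \<tau> j = tape_of x \<and> Tb j = cell x"
  shows "implements_table b S j"
  unfolding implements_table_def
proof (intro conjI allI)
  have "Tb j v \<le> 2" if "S N A \<tau> Tb" for N A \<tau> Tb v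
    using assms(2)[OF that] by (auto simp: cell_def)
  then show "\<exists>B. \<forall>N A \<tau> Tb v. S N A \<tau> Tb \<longrightarrow> Tb j v \<le> B" by blast
next
  fix d
  have "exec A (readp j d) (tapes \<tau> \<sigma>) (poly [:8, 9:] N) (tapes \<tau> (\<sigma>(d := Tb j (\<sigma> d))))"
    if *: "S N A \<tau> Tb" "\<sigma> d \<le> N" "\<forall>r>d. \<sigma> r = 0" for N A \<tau> Tb \<sigma>
  proof -
    obtain x where x: "\<tau> j = tape_of x" "Tb j = cell x" using assms(2)[OF *(1)] by blast
    have "exec A (readp j d) (tapes \<tau> \<sigma>) (9 * \<sigma> d + 8) (tapes \<tau> (\<sigma>(d := cell x (\<sigma> d))))"
      using exec_readp[where \<tau> = \<tau> and \<sigma> = \<sigma>, OF assms(1) x(1)] *(3) by simp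
    then show ?thesis unfolding x(2) by (rule exec_mono) (use *(2) in simp)
  qed
  moreover have "wf_prog (d + 6) (readp j d)" "no_ask (readp j d)" using assms(1) by (auto simp: readp_def)
  ultimately show "\<exists>p K P. wf_prog K p \<and> (b \<longrightarrow> no_ask p) \<and>
       (\<forall>N A \<tau> Tb \<sigma>. S N A \<tau> Tb \<longrightarrow> \<sigma> d \<le> N \<longrightarrow> (\<forall>r>d. \<sigma> r = 0) \<longrightarrow>
          exec A p (tapes \<tau> \<sigma>) (poly P N) (tapes \<tau> (\<sigma>(d := Tb j (\<sigma> d)))))"
    by (intro exI[of _ "readp j d"] exI[of _ "d + 6"] exI[of _ "[:8, 9:]"]) blast
qed

section \<open>Words with the head at their end, and oracle queries\<close>

definition wtape :: "bool list \<Rightarrow> tape" where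
  "wtape w = (fst (tape_of w), int (length w))"

lemma wtape_Nil: "wtape [] = tape_of []" by (simp add: wtape_def tape_of_def)

lemma wtape_append: "tape_act (if b then 2 else 1, MRight) (wtape w) = wtape (w @ [b])"
  by (auto simp: wtape_def tape_act_def tape_of_def nth_append fun_eq_iff nat_less_iff)

lemma wtape_append_True: "tape_act (2, MRight) (wtape w) = wtape (w @ [True])"
  using wtape_append[of True w] by simp

lemma wtape_append_False: "tape_act (1, MRight) (wtape w) = wtape (w @ [False])"
  using wtape_append[of False w] by (simp add: eval_nat_numeral)

lemma tape_word_wtape: "tape_word (wtape w) = w"
proof -
  have "(LEAST i. fst (wtape w) (int i) \<notin> {1, 2}) = length w"
    by (rule Least_equality) (auto simp: wtape_def fst_tape_of cell_def intro: leI split: if_splits)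
  then show ?thesis
    unfolding tape_word_def by (auto simp: wtape_def fst_tape_of cell_def intro!: nth_equalityI)
qed

text \<open>The head starts on the blank behind the word. Cell -1 is blank as well and stops the
  walk to the left, one cell too far.\<close>

definition rewind :: prog where
  "rewind = Step 0 None MLeft ;; While 0 0 (Step 0 None MLeft) ;; Step 0 None MRight"

lemma exec_rewind:
  assumes "\<tau> 0 = tape_of x" "3 * length x + 3 \<le> c"
  shows "exec A rewind (tapes (\<tau>(0 := wtape x)) \<sigma>) c (tapes \<tau> \<sigma>)"
proof -
  define T where "T k = \<tau>(0 := (fst (tape_of x), int k - 1))" for k
  have 1: "exec A (Step 0 None MLeft) (tapes (\<tau>(0 := wtape x)) \<sigma>) 1 (tapes (T (length x)) \<sigma>)"
  proof -
    have "T (length x) = (\<tau>(0 := wtape x))(0 := (fst ((\<tau>(0 := wtape x)) 0), move_pos MLeft (snd ((\<tau>(0 := wtape x)) 0))))"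
      by (auto simp: T_def wtape_def)
    then show ?thesis using exec_move[of 0 1 A MLeft "\<tau>(0 := wtape x)" \<sigma>] by simp
  qed
  have 2: "exec A (While 0 0 (Step 0 None MLeft)) (tapes (T (length x)) \<sigma>) (3 * length x + 1) (tapes (T 0) \<sigma>)"
  proof (rule exec_loop[where c = 1 and st = "\<lambda>k. tapes (T k) \<sigma>"])
    fix k assume "k \<le> length x"
    then show "tape_read (tapes (T k) \<sigma> 0) = 0 \<longleftrightarrow> k = 0"
      by (cases k) (auto simp: tapes_def T_def tape_read_def fst_tape_of_neg fst_tape_of cell_eq_0)
  next
    fix k assume "k < length x"
    have "T k = (T (Suc k))(0 := (fst (T (Suc k) 0), move_pos MLeft (snd (T (Suc k) 0))))"
      by (auto simp: T_def)
    then show "exec A (Step 0 None MLeft) (tapes (T (Suc k)) \<sigma>) 1 (tapes (T k) \<sigma>)"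
      using exec_move[of 0 1 A MLeft "T (Suc k)" \<sigma>] by simp
  qed simp
  have 3: "exec A (Step 0 None MRight) (tapes (T 0) \<sigma>) 1 (tapes \<tau> \<sigma>)"
  proof -
    have "\<tau> = (T 0)(0 := (fst (T 0 0), move_pos MRight (snd (T 0 0))))"
      using assms(1) by (auto simp: T_def fun_eq_iff tape_of_def)
    then show ?thesis using exec_move[of 0 1 A MRight "T 0" \<sigma>] by simp
  qed
  show ?thesis unfolding rewind_def
    by (rule exec_Seq[OF 1 exec_Seq[OF 2 3 order_refl]]) (use assms(2) in simp)
qed

definition erase :: prog where
  "erase = Step 1 None MLeft ;; While 1 0 (Step 1 (Some 0) MLeft) ;; Step 1 None MRight"

lemma exec_erase:
  assumes "\<tau> 1 = tape_of []" "3 * length w + 3 \<le> c"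
  shows "exec A erase (tapes (\<tau>(1 := wtape w)) \<sigma>) c (tapes \<tau> \<sigma>)"
proof -
  define T where "T k = \<tau>(1 := (fst (tape_of (take k w)), int k - 1))" for k
  have 1: "exec A (Step 1 None MLeft) (tapes (\<tau>(1 := wtape w)) \<sigma>) 1 (tapes (T (length w)) \<sigma>)"
  proof -
    have "T (length w) = (\<tau>(1 := wtape w))(1 := (fst ((\<tau>(1 := wtape w)) 1), move_pos MLeft (snd ((\<tau>(1 := wtape w)) 1))))"
      by (auto simp: T_def wtape_def)
    then show ?thesis using exec_move[of 1 1 A MLeft "\<tau>(1 := wtape w)" \<sigma>] by simp
  qed
  have 2: "exec A (While 1 0 (Step 1 (Some 0) MLeft)) (tapes (T (length w)) \<sigma>) (3 * length w + 1) (tapes (T 0) \<sigma>)"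
  proof (rule exec_loop[where c = 1 and st = "\<lambda>k. tapes (T k) \<sigma>"])
    fix k assume "k \<le> length w"
    then show "tape_read (tapes (T k) \<sigma> 1) = 0 \<longleftrightarrow> k = 0"
      by (cases k) (auto simp: tapes_def T_def tape_read_def fst_tape_of_neg fst_tape_of cell_eq_0)
  next
    fix k assume k: "k < length w"
    have "tape_act (0, MLeft) (T (Suc k) 1) = T k 1"
      using k by (auto simp: T_def tape_act_def tape_of_def fun_eq_iff nat_less_iff)
    then have "T k = (T (Suc k))(1 := tape_act (0, MLeft) (T (Suc k) 1))"
      by (auto simp: T_def)
    then show "exec A (Step 1 (Some 0) MLeft) (tapes (T (Suc k)) \<sigma>) 1 (tapes (T k) \<sigma>)"
      using exec_write[of 1 1 A 0 MLeft "T (Suc k)" \<sigma>] by simp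
  qed simp
  have 3: "exec A (Step 1 None MRight) (tapes (T 0) \<sigma>) 1 (tapes \<tau> \<sigma>)"
  proof -
    have "\<tau> = (T 0)(1 := (fst (T 0 1), move_pos MRight (snd (T 0 1))))"
      using assms(1) by (auto simp: T_def fun_eq_iff tape_of_def)
    then show ?thesis using exec_move[of 1 1 A MRight "T 0" \<sigma>] by simp
  qed
  show ?thesis unfolding erase_def
    by (rule exec_Seq[OF 1 exec_Seq[OF 2 3 order_refl]]) (use assms(2) in simp)
qed

definition copy_input :: prog where
  "copy_input = While 0 0 (Cond 0 1 (Step 1 (Some 1) MRight) (Step 1 (Some 2) MRight) ;; Step 0 None MRight)"

lemma exec_copy_input:
  assumes "\<tau> 0 = tape_of x" "6 * length x + 1 \<le> c"
  shows "exec A copy_input (tapes (\<tau>(1 := wtape w)) \<sigma>) c (tapes (\<tau>(0 := wtape x, 1 := wtape (w @ x))) \<sigma>)"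
proof -
  let ?n = "length x"
  define T where "T k = \<tau>(0 := (fst (tape_of x), int (?n - k)), 1 := wtape (w @ take (?n - k) x))" for k
  have "exec A copy_input (tapes (T ?n) \<sigma>) c (tapes (T 0) \<sigma>)"
    unfolding copy_input_def
  proof (rule exec_loop[where c = 4 and st = "\<lambda>k. tapes (T k) \<sigma>"])
    fix k assume "k \<le> ?n"
    then show "tape_read (tapes (T k) \<sigma> 0) = 0 \<longleftrightarrow> k = 0"
      by (simp add: tapes_def T_def tape_read_def fst_tape_of cell_eq_0 del: of_nat_diff) arith
  next
    fix k assume k: "k < ?n"
    define i where "i = ?n - Suc k"
    have i: "i < ?n" "?n - k = Suc i" using k by (auto simp: i_def)
    define U where "U = (T (Suc k))(1 := wtape (w @ take (Suc i) x))"
    have tk: "w @ take (Suc i) x = (w @ take i x) @ [x ! i]" using i by (simp add: take_Suc_conv_app_nth)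
    have rd: "tape_read (tapes (T (Suc k)) \<sigma> 0) = (if x ! i then 2 else 1)"
      using i by (simp add: tapes_def T_def tape_read_def fst_tape_of cell_def i_def[symmetric])
    have 1: "exec A (Cond 0 1 (Step 1 (Some 1) MRight) (Step 1 (Some 2) MRight)) (tapes (T (Suc k)) \<sigma>) 3 (tapes U \<sigma>)"
    proof (cases "x ! i")
      case True
      have "U = (T (Suc k))(1 := tape_act (2, MRight) (T (Suc k) 1))"
        unfolding U_def tk using True by (auto simp: T_def i_def[symmetric] wtape_append_True)
      then have "exec A (Step 1 (Some 2) MRight) (tapes (T (Suc k)) \<sigma>) 1 (tapes U \<sigma>)"
        using exec_write[of 1 1 A 2 MRight "T (Suc k)" \<sigma>] by simp
      then show ?thesis by (rule exec_CondF[rotated]) (use rd True in auto)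
    next
      case False
      have "U = (T (Suc k))(1 := tape_act (1, MRight) (T (Suc k) 1))"
        unfolding U_def tk using False by (auto simp: T_def i_def[symmetric] wtape_append_False[simplified] wtape_append_False)
      then have "exec A (Step 1 (Some 1) MRight) (tapes (T (Suc k)) \<sigma>) 1 (tapes U \<sigma>)"
        using exec_write[of 1 1 A 1 MRight "T (Suc k)" \<sigma>] by simp
      then show ?thesis by (rule exec_CondT[rotated]) (use rd False in auto)
    qed
    have 2: "exec A (Step 0 None MRight) (tapes U \<sigma>) 1 (tapes (T k) \<sigma>)"
    proof -
      have "T k = U(0 := (fst (U 0), move_pos MRight (snd (U 0))))"
        using i by (auto simp: T_def U_def fun_eq_iff i_def[symmetric])
      then show ?thesis using exec_move[of 0 1 A MRight U \<sigma>] by simp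
    qed
    show "exec A (Cond 0 1 (Step 1 (Some 1) MRight) (Step 1 (Some 2) MRight) ;; Step 0 None MRight)
        (tapes (T (Suc k)) \<sigma>) 4 (tapes (T k) \<sigma>)"
      by (rule exec_Seq[OF 1 2]) simp
  qed (use assms(2) in simp)
  moreover have "T ?n = \<tau>(1 := wtape w)" using assms(1) by (auto simp: T_def fun_eq_iff tape_of_def)
  moreover have "T 0 = \<tau>(0 := wtape x, 1 := wtape (w @ x))" by (simp add: T_def wtape_def)
  ultimately show ?thesis by simp
qed

text \<open>The number is in unary, so that a definable function can recover it as the length of a
  block of true bits.\<close>

definition query_word :: "nat \<Rightarrow> bool list \<Rightarrow> bool list" where
  "query_word v x = replicate v True @ False # x"

definition askp :: "nat \<Rightarrow> prog" where
  "askp d = Loop d (Dec d ;; Step 1 (Some 2) MRight) ;; Step 1 (Some 1) MRight ;; copy_input ;;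
     Ask (Inc d) Skip ;; rewind ;; erase"

lemma exec_askp:
  assumes t: "\<tau> 0 = tape_of x" "\<tau> 1 = tape_of []" and c: "7 * \<sigma> d + 12 * length x + 30 \<le> c"
  shows "exec A (askp d) (tapes \<tau> \<sigma>) c (tapes \<tau> (\<sigma>(d := of_bool (query_word (\<sigma> d) x \<in> A))))"
proof -
  define v where "v = \<sigma> d"
  define w where "w = query_word v x"
  define T where "T k = \<tau>(1 := wtape (replicate (v - k) True))" for k
  define R where "R k = \<sigma>(d := k)" for k
  have "exec A (Loop d (Dec d ;; Step 1 (Some 2) MRight)) (tapes (T v) (R v)) (4 * v + 1) (tapes (T 0) (R 0))"
  proof (rule exec_Loop[where c = 2])
    fix k assume k: "k < v"
    have 1: "exec A (Dec d) (tapes (T (Suc k)) (R (Suc k))) 1 (tapes (T (Suc k)) (R k))"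
      using exec_Dec[of "R (Suc k)" d k 1 A "T (Suc k)"] by (simp add: R_def)
    have "v - k = Suc (v - Suc k)" using k by simp
    then have "replicate (v - k) True = replicate (v - Suc k) True @ [True]" by (simp add: replicate_append_same)
    then have "T k = (T (Suc k))(1 := tape_act (2, MRight) (T (Suc k) 1))"
      by (auto simp: T_def wtape_append_True)
    then have 2: "exec A (Step 1 (Some 2) MRight) (tapes (T (Suc k)) (R k)) 1 (tapes (T k) (R k))"
      using exec_write[of 1 1 A 2 MRight "T (Suc k)" "R k"] by simp
    show "exec A (Dec d ;; Step 1 (Some 2) MRight) (tapes (T (Suc k)) (R (Suc k))) 2 (tapes (T k) (R k))"
      by (rule exec_Seq[OF 1 2]) simp
  qed (auto simp: R_def)
  moreover have "T v = \<tau>" "R v = \<sigma>" using t(2) by (auto simp: T_def R_def v_def wtape_Nil)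
  ultimately have 1: "exec A (Loop d (Dec d ;; Step 1 (Some 2) MRight)) (tapes \<tau> \<sigma>) (4 * v + 1) (tapes (T 0) (R 0))"
    by simp
  define w1 where "w1 = replicate v True @ [False]"
  have 2: "exec A (Step 1 (Some 1) MRight) (tapes (T 0) (R 0)) 1 (tapes (\<tau>(1 := wtape w1)) (R 0))"
  proof -
    have "\<tau>(1 := wtape w1) = (T 0)(1 := tape_act (1, MRight) (T 0 1))"
      unfolding T_def w1_def fun_upd_upd fun_upd_same wtape_append_False by simp
    then show ?thesis using exec_write[of 1 1 A 1 MRight "T 0" "R 0"] by simp
  qed
  have 3: "exec A copy_input (tapes (\<tau>(1 := wtape w1)) (R 0)) (6 * length x + 1) (tapes (\<tau>(0 := wtape x, 1 := wtape w)) (R 0))"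
    using exec_copy_input[where \<tau> = \<tau>, OF t(1) order_refl, of A w1 "R 0"] by (simp add: w1_def w_def query_word_def)
  define b where "b = (of_bool (w \<in> A) :: nat)"
  have 4: "exec A (Ask (Inc d) Skip) (tapes (\<tau>(0 := wtape x, 1 := wtape w)) (R 0)) 3
      (tapes (\<tau>(0 := wtape x, 1 := wtape w)) (R b))"
  proof -
    have tw: "tape_word (tapes (\<tau>(0 := wtape x, 1 := wtape w)) (R 0) 1) = w" by (simp add: tapes_def tape_word_wtape)
    show ?thesis
    proof (cases "w \<in> A")
      case True
      have "R b = (R 0)(d := Suc (R 0 d))" using True by (simp add: R_def b_def)
      then have "exec A (Inc d) (tapes (\<tau>(0 := wtape x, 1 := wtape w)) (R 0)) 1 (tapes (\<tau>(0 := wtape x, 1 := wtape w)) (R b))"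
        using exec_Inc[of 1 A d "\<tau>(0 := wtape x, 1 := wtape w)" "R 0"] by simp
      then show ?thesis by (rule exec_AskT[rotated]) (use tw True in auto)
    next
      case False
      have "R b = R 0" using False by (simp add: R_def b_def)
      then have "exec A Skip (tapes (\<tau>(0 := wtape x, 1 := wtape w)) (R 0)) 0 (tapes (\<tau>(0 := wtape x, 1 := wtape w)) (R b))"
        by (simp add: exec_Skip)
      then show ?thesis by (rule exec_AskF[rotated]) (use tw False in auto)
    qed
  qed
  have 5: "exec A rewind (tapes (\<tau>(0 := wtape x, 1 := wtape w)) (R b)) (3 * length x + 3) (tapes (\<tau>(1 := wtape w)) (R b))"
    using exec_rewind[of "\<tau>(1 := wtape w)" x "3 * length x + 3" A "R b"] t(1) by (simp add: fun_upd_twist)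
  have 6: "exec A erase (tapes (\<tau>(1 := wtape w)) (R b)) (3 * length w + 3) (tapes \<tau> (R b))"
    by (rule exec_erase[where \<tau> = \<tau>, OF t(2) order_refl])
  have "R b = \<sigma>(d := of_bool (query_word (\<sigma> d) x \<in> A))" by (simp add: R_def b_def w_def v_def)
  moreover have "exec A (askp d) (tapes \<tau> \<sigma>) c (tapes \<tau> (R b))"
    unfolding askp_def
    by (rule exec_Seq[OF 1 exec_Seq[OF 2 exec_Seq[OF 3 exec_Seq[OF 4 exec_Seq[OF 5 6 order_refl]
      order_refl] order_refl] order_refl]]) (use c in \<open>simp add: v_def w_def query_word_def\<close>)
  ultimately show ?thesis by simp
qed

text \<open>The size has to bound the input length here because each query copies the whole input; a
  table lookup by \<open>readp\<close> only pays for its argument.\<close>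

definition ask_scheme :: scheme where
  "ask_scheme N A \<tau> Tb \<longleftrightarrow> (\<exists>x. length x \<le> N \<and> \<tau> 0 = tape_of x \<and> \<tau> 1 = tape_of [] \<and> Tb 0 = cell x \<and>
     Tb 2 = (\<lambda>v. of_bool (query_word v x \<in> A)))"

definition verify_scheme :: scheme where
  "verify_scheme N A \<tau> Tb \<longleftrightarrow> (\<exists>x u. \<tau> 0 = tape_of x \<and> \<tau> 1 = tape_of u \<and> Tb 0 = cell x \<and> Tb 1 = cell u)"

text \<open>Tape 1 is left unconstrained, since the output grows there between the
  evaluations.\<close>

definition output_scheme :: scheme where
  "output_scheme N A \<tau> Tb \<longleftrightarrow> (\<exists>x. \<tau> 0 = tape_of x \<and> Tb 0 = cell x)"

lemma implements_table_ask: "implements_table False ask_scheme 2"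
  unfolding implements_table_def
proof (intro conjI allI)
  show "\<exists>B. \<forall>N A \<tau> Tb v. ask_scheme N A \<tau> Tb \<longrightarrow> Tb 2 v \<le> B"
    by (rule exI[of _ 1]) (auto simp: ask_scheme_def)
next
  fix d
  have "exec A (askp d) (tapes \<tau> \<sigma>) (poly [:30, 19:] N) (tapes \<tau> (\<sigma>(d := Tb 2 (\<sigma> d))))"
    if *: "ask_scheme N A \<tau> Tb" "\<sigma> d \<le> N" "\<forall>r>d. \<sigma> r = 0" for N A \<tau> Tb \<sigma>
  proof -
    obtain x where x: "length x \<le> N" "\<tau> 0 = tape_of x" "\<tau> 1 = tape_of []" "Tb 2 = (\<lambda>v. of_bool (query_word v x \<in> A))"
      using *(1) unfolding ask_scheme_def by blast
    show ?thesis unfolding x(4) by (rule exec_askp[OF x(2,3)]) (use x(1) *(2) in simp)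
  qed
  moreover have "wf_prog (d + 6) (askp d)" by (auto simp: askp_def copy_input_def rewind_def erase_def)
  ultimately show "\<exists>p K P. wf_prog K p \<and> (False \<longrightarrow> no_ask p) \<and>
       (\<forall>N A \<tau> Tb \<sigma>. ask_scheme N A \<tau> Tb \<longrightarrow> \<sigma> d \<le> N \<longrightarrow> (\<forall>r>d. \<sigma> r = 0) \<longrightarrow>
          exec A p (tapes \<tau> \<sigma>) (poly P N) (tapes \<tau> (\<sigma>(d := Tb 2 (\<sigma> d)))))"
    by (intro exI[of _ "askp d"] exI[of _ "d + 6"] exI[of _ "[:30, 19:]"]) blast
qed

lemma implements_ask: "definable {0, 2} f \<Longrightarrow> implements False ask_scheme f"
proof (rule implements_definable)
  show "implements_table False ask_scheme j" if "j \<in> {0, 2}" for j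
  proof (cases "j = 2")
    case False
    then show ?thesis using that by (intro implements_table_word) (auto simp: ask_scheme_def)
  qed (simp add: implements_table_ask)
next
  fix N N' A \<tau> Tb assume *: "ask_scheme N A \<tau> Tb" "N \<le> N'"
  obtain x where "length x \<le> N" "\<tau> 0 = tape_of x \<and> \<tau> 1 = tape_of [] \<and> Tb 0 = cell x \<and>
     Tb 2 = (\<lambda>v. of_bool (query_word v x \<in> A))" using *(1) unfolding ask_scheme_def by blast
  then show "ask_scheme N' A \<tau> Tb" unfolding ask_scheme_def using *(2) by (intro exI[of _ x]) linarith
qed

lemma implements_verify: "definable {0, 1} f \<Longrightarrow> implements True verify_scheme f"
proof (rule implements_definable)
  show "implements_table True verify_scheme j" if "j \<in> {0, 1}" for j
    by (rule implements_table_word) (use that in \<open>auto simp: verify_scheme_def\<close>)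
qed (auto simp: verify_scheme_def)

lemma implements_output: "definable {0} f \<Longrightarrow> implements True output_scheme f"
proof (rule implements_definable)
  show "implements_table True output_scheme j" if "j \<in> {0}" for j
    by (rule implements_table_word) (use that in \<open>auto simp: output_scheme_def\<close>)
qed (auto simp: output_scheme_def)

section \<open>Machines for NP, for oracle computations and for reductions\<close>

primrec init :: "nat \<Rightarrow> prog" where
  "init 0 = Skip"
| "init (Suc r) = init r ;; Step (r + 2) (Some 1) MStay"

text \<open>The machine has only the tapes below \<open>R + 2\<close>, which are blank. The family
  of tapes goes on beyond them, and those further tapes are taken to be counters from the start, so
  that the result has the form \<open>tapes\<close>.\<close>

lemma exec_init:
  "exec A (init R) (\<lambda>i. if i < 2 then \<tau> i else if i < R + 2 then tape_of [] else cnt 0) R (tapes \<tau> (\<lambda>_. 0))"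
proof -
  define F where "F r = (\<lambda>i. if i < 2 then \<tau> i else if r + 2 \<le> i \<and> i < R + 2 then tape_of [] else cnt 0)" for r
  have "exec A (init r) (F 0) r (F r)" if "r \<le> R" for r
    using that
  proof (induction r)
    case 0
    then show ?case by (simp add: exec_Skip)
  next
    case (Suc r)
    have "F (Suc r) = (F r)(r + 2 := tape_act (1, MStay) (F r (r + 2)))"
      using Suc.prems by (auto simp: F_def fun_eq_iff tape_act_def cnt_def tape_of_def)
    then have "exec A (Step (r + 2) (Some 1) MStay) (F r) 1 (F (Suc r))"
      by (intro exec_Step) auto
    then show ?case unfolding init.simps using Suc by (intro exec_Seq[of A "init r" "F 0" r "F r"]) auto
  qed
  moreover have "F 0 = (\<lambda>i. if i < 2 then \<tau> i else if i < R + 2 then tape_of [] else cnt 0)"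
    "F R = tapes \<tau> (\<lambda>_. 0)" by (auto simp: F_def tapes_def fun_eq_iff)
  ultimately show ?thesis by (metis order_refl)
qed

lemma wf_init: "wf_prog (R + 2) (init R)"
  by (induction R) (auto elim: wf_prog_mono)

lemma no_ask_init: "no_ask (init R)"
  by (induction R) auto

definition measure_input :: prog where
  "measure_input = While 0 0 (Step 0 None MRight ;; Inc 0) ;; rewind"

lemma exec_measure_input:
  assumes "\<tau> 0 = tape_of x"
  shows "exec A measure_input (tapes \<tau> (\<lambda>_. 0)) (7 * length x + 4) (tapes \<tau> ((\<lambda>_. 0)(0 := length x)))"
proof -
  let ?n = "length x"
  define T where "T k = \<tau>(0 := (fst (tape_of x), int (?n - k)))" for k
  define R where "R k = (\<lambda>_::nat. 0::nat)(0 := ?n - k)" for k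
  have "exec A (While 0 0 (Step 0 None MRight ;; Inc 0)) (tapes (T ?n) (R ?n)) (4 * ?n + 1) (tapes (T 0) (R 0))"
  proof (rule exec_loop[where c = 2 and st = "\<lambda>k. tapes (T k) (R k)"])
    fix k assume "k \<le> ?n"
    then show "tape_read (tapes (T k) (R k) 0) = 0 \<longleftrightarrow> k = 0"
      by (simp add: tapes_def T_def tape_read_def fst_tape_of cell_eq_0 del: of_nat_diff) arith
  next
    fix k assume k: "k < ?n"
    have "T k = (T (Suc k))(0 := (fst (T (Suc k) 0), move_pos MRight (snd (T (Suc k) 0))))"
      using k by (auto simp: T_def fun_eq_iff)
    then have 1: "exec A (Step 0 None MRight) (tapes (T (Suc k)) (R (Suc k))) 1 (tapes (T k) (R (Suc k)))"
      using exec_move[of 0 1 A MRight "T (Suc k)" "R (Suc k)"] by simp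
    have "R k = (R (Suc k))(0 := Suc (R (Suc k) 0))" using k by (auto simp: R_def fun_eq_iff)
    then have 2: "exec A (Inc 0) (tapes (T k) (R (Suc k))) 1 (tapes (T k) (R k))"
      using exec_Inc[of 1 A 0 "T k" "R (Suc k)"] by simp
    show "exec A (Step 0 None MRight ;; Inc 0) (tapes (T (Suc k)) (R (Suc k))) 2 (tapes (T k) (R k))"
      by (rule exec_Seq[OF 1 2]) simp
  qed simp
  moreover have "T ?n = \<tau>" "R ?n = (\<lambda>_. 0)" "T 0 = \<tau>(0 := wtape x)" "R 0 = (\<lambda>_. 0)(0 := ?n)"
    using assms by (auto simp: T_def R_def fun_eq_iff tape_of_def wtape_def)
  ultimately have 1: "exec A (While 0 0 (Step 0 None MRight ;; Inc 0)) (tapes \<tau> (\<lambda>_. 0)) (4 * ?n + 1)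
      (tapes (\<tau>(0 := wtape x)) ((\<lambda>_. 0)(0 := ?n)))" by simp
  show ?thesis unfolding measure_input_def
    by (rule exec_Seq[OF 1 exec_rewind[where \<tau> = \<tau>, OF assms order_refl]]) simp
qed

lemma exec_setup:
  assumes "\<tau> 0 = tape_of x"
  shows "exec A (init R ;; measure_input) (\<lambda>i. if i < 2 then \<tau> i else if i < R + 2 then tape_of [] else cnt 0)
    (R + 7 * length x + 4) (tapes \<tau> ((\<lambda>_. 0)(0 := length x)))"
  by (rule exec_Seq[OF exec_init exec_measure_input[where A = A and \<tau> = \<tau>, OF assms]]) simp

lemma wf_measure_input: "2 < K \<Longrightarrow> wf_prog K measure_input" "no_ask measure_input"
  by (auto simp: measure_input_def rewind_def)

definition decides :: "scheme \<Rightarrow> (tables \<Rightarrow> (nat \<Rightarrow> nat) \<Rightarrow> nat) \<Rightarrow> nat \<Rightarrow> machine \<Rightarrow> nat poly \<Rightarrow> bool" where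
  "decides S f K M Q \<longleftrightarrow> (\<forall>A x ws Tb. ws ! 0 = x \<longrightarrow> ws \<noteq> [] \<longrightarrow> length ws \<le> 2 \<longrightarrow>
     S (length x) A (\<lambda>i. tape_of (if i < length ws then ws ! i else [])) Tb \<longrightarrow>
     fst (run M A K ws (poly Q (length x))) = (if f Tb (\<lambda>_. length x) = 0 then rej M else acc M))"

text \<open>All variables are allocated to register 0, which holds the input length; this is where
  the constant environment comes from. The result is in register 1, that is on tape 3, and its being
  zero is what \<open>machine_of\<close> tests.\<close>

lemma decider:
  assumes "implements b S f"
  shows "\<exists>K M Q. oracle_tm K 3 M \<and> (b \<longrightarrow> tm K 3 M) \<and> decides S f K M Q"
proof -
  obtain p K0 P where p: "runs b S (\<lambda>_. 0) 1 f p K0 P"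
    using implements_prog[OF assms, of "\<lambda>_. 0" 1] by auto
  define R where "R = K0 + 2"
  let ?K = "R + 2"
  define prg where "prg = (init R ;; measure_input) ;; p"
  define M where "M = machine_of ?K prg 3"
  define Q where "Q = [:R + 5, 7:] + P"
  have wf: "wf_prog ?K prg"
    using wf_init[of R] wf_measure_input(1)[of ?K] runs_wf[OF p, of ?K] by (simp add: prg_def R_def)
  have "oracle_tm ?K 3 M" unfolding M_def by (rule oracle_tm_machine_of[OF wf]) (auto simp: R_def)
  moreover have "tm ?K 3 M" if b
      unfolding M_def by (rule tm_machine_of[OF wf])
        (use runs_no_ask[OF p that] no_ask_init wf_measure_input in \<open>auto simp: R_def prg_def\<close>)
  moreover have "decides S f ?K M Q"
    unfolding decides_def
  proof (intro allI impI)
    fix A :: lang and x :: "bool list" and ws Tb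
    assume ws: "ws ! 0 = x" "ws \<noteq> []" "length ws \<le> 2"
      and S: "S (length x) A (\<lambda>i. tape_of (if i < length ws then ws ! i else [])) Tb"
    let ?t = "\<lambda>i. tape_of (if i < length ws then ws ! i else [])"
    let ?s = "(\<lambda>_. 0)(0 := length x)"
    have t0: "?t 0 = tape_of x" using ws by auto
    have e1: "exec A (init R ;; measure_input) (\<lambda>i. if i < 2 then ?t i else if i < R + 2 then tape_of [] else cnt 0)
      (R + 7 * length x + 4) (tapes ?t ?s)" by (rule exec_setup[where \<tau> = ?t, OF t0])
    have e2: "exec A p (tapes ?t ?s) (poly P (length x)) (tapes ?t (?s(1 := f Tb (\<lambda>_. length x))))"
      using runsD[OF p, OF S, of ?s] by simp
    have "exec A prg (\<lambda>i. if i < 2 then ?t i else if i < R + 2 then tape_of [] else cnt 0)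
      (R + 7 * length x + 4 + poly P (length x)) (tapes ?t (?s(1 := f Tb (\<lambda>_. length x))))"
      unfolding prg_def by (rule exec_Seq[OF e1 e2 order_refl])
    from run_machine_of[OF this wf, of 3 "poly Q (length x)" ws] ws(3)
    show "fst (run M A ?K ws (poly Q (length x))) = (if f Tb (\<lambda>_. length x) = 0 then rej M else acc M)"
      by (simp add: M_def Q_def R_def tapes_def)
  qed
  ultimately show ?thesis by blast
qed

definition verify_tables :: "bool list \<Rightarrow> bool list \<Rightarrow> tables" where
  "verify_tables x u j = (if j = 0 then cell x else cell u)"

definition ask_tables :: "lang \<Rightarrow> bool list \<Rightarrow> tables" where
  "ask_tables A x j = (if j = 0 then cell x else (\<lambda>v. of_bool (query_word v x \<in> A)))"

definition word_tables :: "bool list \<Rightarrow> tables" where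
  "word_tables x j = cell x"

theorem definable_NP:
  fixes r :: "nat poly"
  assumes "definable {0, 1} f"
    and "\<And>x. x \<in> L \<longleftrightarrow> (\<exists>u. length u \<le> poly r (length x) \<and> f (verify_tables x u) (\<lambda>_. length x) \<noteq> 0)"
  shows "L \<in> NP"
proof -
  obtain K M Q where M: "tm K 3 M" and run: "decides verify_scheme f K M Q"
    using decider[OF implements_verify[OF assms(1)]] by blast
  have *: "fst (run M {} K [x, u] (poly Q (length x))) =
      (if f (verify_tables x u) (\<lambda>_. length x) = 0 then rej M else acc M)" for x u
  proof -
    have "verify_scheme (length x) {} (\<lambda>i. tape_of (if i < length [x, u] then [x, u] ! i else [])) (verify_tables x u)"
      unfolding verify_scheme_def by (intro exI[of _ x] exI[of _ u]) (auto simp: verify_tables_def)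
    then show ?thesis using run[unfolded decides_def, rule_format, of "[x, u]" x] by simp
  qed
  have "acc M \<noteq> rej M" by (simp add: acc_def rej_def)
  then have "(\<forall>x u. length u \<le> poly r (length x) \<longrightarrow> fst (run M {} K [x, u] (poly Q (length x))) \<in> {acc M, rej M}) \<and>
     (\<forall>x. x \<in> L \<longleftrightarrow> (\<exists>u. length u \<le> poly r (length x) \<and> fst (run M {} K [x, u] (poly Q (length x))) = acc M))"
    unfolding * assms(2) by auto
  with M show ?thesis unfolding NP_def by blast
qed

theorem definable_P_oracle:
  assumes "definable {0, 2} f"
    and "\<And>x. x \<in> L \<longleftrightarrow> f (ask_tables A x) (\<lambda>_. length x) \<noteq> 0"
  shows "L \<in> P_oracle A"
proof -
  obtain K M Q where M: "oracle_tm K 3 M" and run: "decides ask_scheme f K M Q"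
    using decider[OF implements_ask[OF assms(1)]] by blast
  have "fst (run M A K [x] (poly Q (length x))) = (if x \<in> L then acc M else rej M)" for x
  proof -
    have "ask_scheme (length x) A (\<lambda>i. tape_of (if i < length [x] then [x] ! i else [])) (ask_tables A x)"
      unfolding ask_scheme_def by (intro exI[of _ x]) (auto simp: ask_tables_def)
    then show ?thesis using run[unfolded decides_def, rule_format, of "[x]" x] assms(2) by simp
  qed
  with M show ?thesis unfolding P_oracle_def by blast
qed

text \<open>The output is produced bit by bit from the left: register 1 counts the bits still
  missing, and register 2 holds the current position, the variable 0 of \<open>g\<close>.\<close>

theorem definable_poly_time_computable:
  assumes m: "definable {0} m" and g: "definable {0} g"
  shows "poly_time_computable (\<lambda>x. map (\<lambda>i. g (word_tables x) (case_nat i (\<lambda>_. length x)) \<noteq> 0)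
    [0..<m (word_tables x) (\<lambda>_. length x)])"
proof -
  note im = implements_output[OF m] and ig = implements_output[OF g]
  obtain p1 K1 P1 where 1: "runs True output_scheme (\<lambda>_. 0) 1 m p1 K1 P1"
    using implements_prog[OF im, of "\<lambda>_. 0" 1] by auto
  define \<rho> where "\<rho> = case_nat 2 (\<lambda>_. 0::nat)"
  have "\<forall>n. \<rho> n < 3" by (auto simp: \<rho>_def split: nat.split)
  from implements_prog[OF ig this] obtain p2 K2 P2 where 2: "runs True output_scheme \<rho> 3 g p2 K2 P2" by blast
  obtain Bm Bg where B: "bounds output_scheme m Bm" "bounds output_scheme g Bg"
    using implements_bounds[OF im] implements_bounds[OF ig] by blast
  define H where "H = [:0, 1:] + Bm"
  \<comment> \<open>Tape 5 is register 3 with the value of \<open>g\<close>. It must be cleared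
    because the next evaluation expects its free registers to be 0.\<close>
  define emit where "emit = Cond 5 1 (Step 1 (Some 1) MRight) (Step 1 (Some 2) MRight ;; Loop 3 (Dec 3))"
  define body where "body = Dec 1 ;; p2 ;; emit ;; Inc 2"
  define R where "R = K1 + K2 + 5"
  let ?K = "R + 2"
  define prg where "prg = (init R ;; measure_input) ;; p1 ;; Loop 1 body"
  define C where "C = pcompose P2 H + [:3:] * pcompose Bg H + [:6:]"
  define Q where "Q = [:R + 6, 7:] + P1 + Bm * (C + [:2:])"
  define M where "M = machine_of ?K prg 2"
  have wf: "wf_prog ?K prg"
    using wf_init[of R] wf_measure_input(1)[of ?K] runs_wf[OF 1, of ?K] runs_wf[OF 2, of ?K]
    by (simp add: prg_def R_def body_def emit_def)
  have tm: "tm ?K 3 M" unfolding M_def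
    by (rule tm_machine_of[OF wf])
      (use runs_no_ask[OF 1] runs_no_ask[OF 2] no_ask_init wf_measure_input in \<open>auto simp: R_def prg_def body_def emit_def\<close>)
  have "run M {} ?K [x] (poly Q (length x)) = (q, ts) \<Longrightarrow> q \<in> {acc M, rej M} \<and>
      tape_word (ts ! 1) = map (\<lambda>i. g (word_tables x) (case_nat i (\<lambda>_. length x)) \<noteq> 0) [0..<m (word_tables x) (\<lambda>_. length x)]"
    for x q ts
  proof -
    assume run: "run M {} ?K [x] (poly Q (length x)) = (q, ts)"
    define n where "n = length x"
    let ?t = "\<lambda>i. tape_of (if i < length [x] then [x] ! i else [])"
    let ?s = "(\<lambda>_::nat. 0::nat)(0 := n)"
    define Tb where "Tb = word_tables x"
    define l where "l = m Tb (\<lambda>_. n)"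
    define w where "w = map (\<lambda>i. g Tb (case_nat i (\<lambda>_. n)) \<noteq> 0) [0..<l]"
    have S: "output_scheme N {} (?t(1 := y)) Tb" for y N
      by (auto simp: output_scheme_def Tb_def word_tables_def)
    have S': "output_scheme N {} ?t Tb" for N
      by (auto simp: output_scheme_def Tb_def word_tables_def)
    have t0: "?t 0 = tape_of x" by simp
    have e1: "exec {} (init R ;; measure_input) (\<lambda>i. if i < 2 then ?t i else if i < R + 2 then tape_of [] else cnt 0)
      (R + 7 * n + 4) (tapes ?t ?s)" unfolding n_def by (rule exec_setup[where \<tau> = ?t, OF t0])
    have e2: "exec {} p1 (tapes ?t ?s) (poly P1 n) (tapes ?t (?s(1 := l)))"
      using runsD[OF 1, OF S', of ?s n] by (simp add: l_def)
    have l: "l \<le> poly Bm n" unfolding l_def by (rule boundsD[OF B(1), OF S']) simp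
    define T where "T k = ?t(1 := wtape (take (l - k) w))" for k
    define U where "U k = ?s(1 := k, 2 := l - k)" for k
    have "exec {} (Loop 1 body) (tapes (T l) (U l)) (l * (poly C n + 2) + 1) (tapes (T 0) (U 0))"
    proof (rule exec_Loop[where c = "poly C n"])
      fix k assume k: "k < l"
      define i where "i = l - Suc k"
      have i: "i < l" "l - k = Suc i" using k by (auto simp: i_def)
      define r where "r = (U (Suc k))(1 := k)"
      have 11: "exec {} (Dec 1) (tapes (T (Suc k)) (U (Suc k))) 1 (tapes (T (Suc k)) r)"
        unfolding r_def by (rule exec_Dec) (auto simp: U_def)
      have e: "r (\<rho> j) = case_nat i (\<lambda>_. n) j" for j
        by (auto simp: r_def U_def \<rho>_def i_def split: nat.split)
      have hb: "\<forall>j. case_nat i (\<lambda>_. n) j \<le> poly H n"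
        using i l by (auto simp: H_def split: nat.split)
      define v where "v = g Tb (case_nat i (\<lambda>_. n))"
      have v: "v \<le> poly Bg (poly H n)" unfolding v_def by (rule boundsD[OF B(2), OF S' hb])
      have "exec {} p2 (tapes (T (Suc k)) r) (poly P2 (poly H n)) (tapes (T (Suc k)) (r(3 := g Tb (\<lambda>j. r (\<rho> j)))))"
        unfolding T_def by (rule runsD[OF 2, OF S]) (use e hb in \<open>auto simp: r_def U_def\<close>)
      then have 12: "exec {} p2 (tapes (T (Suc k)) r) (poly P2 (poly H n)) (tapes (T (Suc k)) (r(3 := v)))"
        unfolding e v_def .
      have r3: "r 3 = 0" by (simp add: r_def U_def)
      have tk: "take (Suc i) w = take i w @ [v \<noteq> 0]"
        using i by (simp add: take_Suc_conv_app_nth w_def v_def)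
      have 13: "exec {} emit (tapes (T (Suc k)) (r(3 := v))) (3 * v + 4) (tapes (T k) r)"
      proof (cases "v = 0")
        case True
        have "T k = (T (Suc k))(1 := tape_act (1, MRight) (T (Suc k) 1))"
          using True tk by (simp add: T_def i_def[symmetric] i(2) wtape_append_False[simplified])
        then have "exec {} (Step 1 (Some 1) MRight) (tapes (T (Suc k)) r) 1 (tapes (T k) r)"
          using exec_write[of 1 1 "{}" 1 MRight "T (Suc k)" r] by simp
        moreover have "r(3 := v) = r" using r3 True by auto
        ultimately show ?thesis unfolding emit_def
          by (intro exec_CondT[of _ 5 1 "{}" _ 1]) (auto simp: tapes_def r3)
      next
        case False
        have "T k = (T (Suc k))(1 := tape_act (2, MRight) (T (Suc k) 1))"
          using False tk by (simp add: T_def i_def[symmetric] i(2) wtape_append_True[simplified])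
        then have a: "exec {} (Step 1 (Some 2) MRight) (tapes (T (Suc k)) (r(3 := v))) 1 (tapes (T k) (r(3 := v)))"
          using exec_write[of 1 1 "{}" 2 MRight "T (Suc k)" "r(3 := v)"] by simp
        have "exec {} (Loop 3 (Dec 3)) (tapes (T k) (r(3 := v))) (3 * v + 1) (tapes (T k) (r(3 := 0)))"
        proof (rule exec_Loop[where c = 1 and \<tau> = "\<lambda>_. T k" and \<sigma> = "\<lambda>y. r(3 := y)"])
          fix y show "exec {} (Dec 3) (tapes (T k) (r(3 := Suc y))) 1 (tapes (T k) (r(3 := y)))"
            using exec_Dec[of "r(3 := Suc y)" 3 y 1 "{}" "T k"] by simp
        qed auto
        moreover have "r(3 := 0) = r" using r3 by auto
        ultimately have "exec {} (Step 1 (Some 2) MRight ;; Loop 3 (Dec 3)) (tapes (T (Suc k)) (r(3 := v))) (3 * v + 2) (tapes (T k) r)"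
          using a by (intro exec_Seq[OF a, of _ "3 * v + 1"]) auto
        then show ?thesis unfolding emit_def
          by (rule exec_CondF[rotated]) (use False in \<open>auto simp: tapes_def\<close>)
      qed
      have "U k = r(2 := Suc (r 2))" using i by (auto simp: U_def r_def i_def fun_eq_iff)
      then have 14: "exec {} (Inc 2) (tapes (T k) r) 1 (tapes (T k) (U k))"
        using exec_Inc[of 1 "{}" 2 "T k" r] by simp
      show "exec {} body (tapes (T (Suc k)) (U (Suc k))) (poly C n) (tapes (T k) (U k))"
        unfolding body_def
        by (rule exec_Seq[OF 11 exec_Seq[OF 12 exec_Seq[OF 13 14 order_refl] order_refl]])
          (use v in \<open>simp add: C_def poly_pcompose\<close>)
    qed (auto simp: U_def)
    moreover have "T l = ?t" by (auto simp: T_def wtape_Nil)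
    moreover have "U l = ?s(1 := l)" by (auto simp: U_def)
    ultimately have e3: "exec {} (Loop 1 body) (tapes ?t (?s(1 := l))) (l * (poly C n + 2) + 1) (tapes (T 0) (U 0))"
      by simp
    have e: "exec {} prg (\<lambda>i. if i < 2 then ?t i else if i < R + 2 then tape_of [] else cnt 0)
      (R + 7 * n + 4 + (poly P1 n + (l * (poly C n + 2) + 1))) (tapes (T 0) (U 0))"
      unfolding prg_def by (rule exec_Seq[OF e1 exec_Seq[OF e2 e3 order_refl] order_refl])
    have "l * (poly C n + 2) \<le> poly Bm n * (poly C n + 2)" using l by (rule mult_le_mono1)
    then have "R + 7 * n + 4 + (poly P1 n + (l * (poly C n + 2) + 1)) < poly Q n"
      by (simp add: Q_def)
    from run_machine_of[OF e wf _ _ this, of 2 "[x]"]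
    have "run M {} ?K [x] (poly Q n) = (if tape_read (tapes (T 0) (U 0) 2) = 1 then rej M else acc M, map (tapes (T 0) (U 0)) [0..<?K])"
      by (simp add: M_def R_def)
    moreover have "map (tapes (T 0) (U 0)) [0..<?K] ! 1 = wtape w"
      by (simp add: tapes_def T_def w_def R_def del: upt_Suc)
    ultimately show ?thesis using run by (auto simp: n_def[symmetric] tape_word_wtape w_def l_def Tb_def)
  qed
  then show ?thesis unfolding poly_time_computable_def using tm by (intro exI[of _ ?K] exI[of _ 3] exI[of _ M] exI[of _ Q]) auto
qed

section \<open>Closure properties of definable functions\<close>

lemma d_rename: "definable T f \<Longrightarrow> definable T (\<lambda>Tb s. f Tb (\<lambda>n. s (\<rho> n)))"
proof (induction arbitrary: \<rho> rule: definable.induct)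
  case (d_sum' f g)
  have "definable T (\<lambda>Tb s. g Tb (\<lambda>n. s (case_nat 0 (\<lambda>m. Suc (\<rho> m)) n)))" by (rule d_sum'.IH(2))
  from definable.d_sum'[OF d_sum'.IH(1) this]
  have "definable T (\<lambda>Tb s. \<Sum>i<f Tb (\<lambda>n. s (\<rho> n)). g Tb (\<lambda>n. case_nat i s (case_nat 0 (\<lambda>m. Suc (\<rho> m)) n)))" .
  moreover have "(\<lambda>n. case_nat i s (case_nat 0 (\<lambda>m. Suc (\<rho> m)) n)) = case_nat i (\<lambda>n. s (\<rho> n))" for i :: nat and s
    by (auto simp: fun_eq_iff split: nat.split)
  ultimately show ?case by simp
qed (auto intro: definable.intros definable.d_one[unfolded One_nat_def])

text \<open>Below a sum the substituted terms are weakened by \<open>d_rename\<close> with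
  \<open>Suc\<close>, and the new variable is mapped to itself.\<close>

lemma d_subst:
  assumes "definable T f" "\<And>n. definable T (e n)"
  shows "definable T (\<lambda>Tb s. f Tb (\<lambda>n. e n Tb s))"
  using assms
proof (induction arbitrary: e rule: definable.induct)
  case (d_sum' f g)
  let ?e = "case_nat (\<lambda>Tb s. s 0) (\<lambda>m Tb s. e m Tb (\<lambda>n. s (Suc n)))"
  have "definable T (?e n)" for n
    using d_rename[OF d_sum'.prems, of _ Suc] by (cases n) (auto intro: definable.d_var)
  then have "definable T (\<lambda>Tb s. g Tb (\<lambda>n. ?e n Tb s))" by (rule d_sum'.IH(2))
  from definable.d_sum'[OF d_sum'.IH(1)[OF d_sum'.prems] this]
  have "definable T (\<lambda>Tb s. \<Sum>i<f Tb (\<lambda>n. e n Tb s). g Tb (\<lambda>n. ?e n Tb (case_nat i s)))" .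
  moreover have "(\<lambda>n. ?e n Tb (case_nat i s)) = case_nat i (\<lambda>n. e n Tb s)" for i Tb s
    by (auto simp: fun_eq_iff split: nat.split)
  ultimately show ?case by simp
qed (auto intro: definable.intros definable.d_one[unfolded One_nat_def])

text \<open>The body is a function of the outer environment and the index, which matches sums as
  they are written; in the premise the index has become variable 0 and the outer variables are
  shifted. The quantifier rules below have the same form.\<close>

lemma d_sum:
  assumes "definable T f" "definable T (\<lambda>Tb s. g Tb (\<lambda>n. s (Suc n)) (s 0))"
  shows "definable T (\<lambda>Tb s. \<Sum>i<f Tb s. g Tb s i)"
  using d_sum'[OF assms] by simp

lemma d_zero: "definable T (\<lambda>Tb s. 0)"
  using d_sub[OF d_one d_one] by simp

lemma d_const: "definable T (\<lambda>Tb s. c)"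
proof (induction c)
  case (Suc c)
  from d_add[OF this d_one] show ?case by simp
qed (rule d_zero)

lemma d_Suc:
  assumes "definable T f" shows "definable T (\<lambda>Tb s. Suc (f Tb s))"
  using d_add[OF assms d_one] by simp

lemma d_mult:
  assumes "definable T f" "definable T g"
  shows "definable T (\<lambda>Tb s. f Tb s * g Tb s)"
  using d_sum[OF assms(1), of "\<lambda>Tb s i. g Tb s"] d_rename[OF assms(2)] by simp

lemma d_power: "definable T f \<Longrightarrow> definable T (\<lambda>Tb s. f Tb s ^ c)"
proof (induction c)
  case 0
  show ?case unfolding power_0 by (rule d_one)
next
  case (Suc c)
  show ?case unfolding power_Suc by (rule d_mult[OF Suc.prems Suc.IH[OF Suc.prems]])
qed

lemma d_poly: "definable T f \<Longrightarrow> definable T (\<lambda>Tb s. poly p (f Tb s))"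
proof (induction p)
  case 0
  show ?case unfolding poly_0 by (rule d_zero)
next
  case (pCons a p)
  show ?case unfolding poly_pCons by (rule d_add[OF d_const d_mult[OF pCons.prems pCons.IH[OF pCons.prems]]])
qed

abbreviation dpred :: "nat set \<Rightarrow> (tables \<Rightarrow> (nat \<Rightarrow> nat) \<Rightarrow> bool) \<Rightarrow> bool" where
  "dpred T P \<equiv> definable T (\<lambda>Tb s. of_bool (P Tb s))"

lemma p_le:
  assumes "definable T f" "definable T g" shows "dpred T (\<lambda>Tb s. f Tb s \<le> g Tb s)"
proof -
  have "of_bool (a \<le> b) = (1::nat) - (a - b)" for a b :: nat by auto
  then show ?thesis using assms by (auto intro!: d_sub d_const)
qed

lemma p_less:
  assumes "definable T f" "definable T g" shows "dpred T (\<lambda>Tb s. f Tb s < g Tb s)"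
  using p_le[OF d_Suc[OF assms(1)] assms(2)] unfolding Suc_le_eq .

lemma p_not:
  assumes "dpred T P" shows "dpred T (\<lambda>Tb s. \<not> P Tb s)"
proof -
  have "of_bool (\<not> Q) = (1::nat) - of_bool Q" for Q by auto
  then show ?thesis using assms by (auto intro!: d_sub d_const)
qed

lemma p_conj:
  assumes "dpred T P" "dpred T Q" shows "dpred T (\<lambda>Tb s. P Tb s \<and> Q Tb s)"
  using d_mult[OF assms] by (simp add: of_bool_conj)

lemma p_disj:
  assumes "dpred T P" "dpred T Q" shows "dpred T (\<lambda>Tb s. P Tb s \<or> Q Tb s)"
  using p_not[OF p_conj[OF p_not[OF assms(1)] p_not[OF assms(2)]]] unfolding de_Morgan_conj not_not .

lemma p_imp:
  assumes "dpred T P" "dpred T Q" shows "dpred T (\<lambda>Tb s. P Tb s \<longrightarrow> Q Tb s)"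
  unfolding imp_conv_disj by (rule p_disj[OF p_not[OF assms(1)] assms(2)])

lemma p_iff:
  assumes "dpred T P" "dpred T Q" shows "dpred T (\<lambda>Tb s. P Tb s \<longleftrightarrow> Q Tb s)"
proof -
  have "(\<lambda>Tb s. of_bool (P Tb s = Q Tb s)) = (\<lambda>Tb s. of_bool ((P Tb s \<longrightarrow> Q Tb s) \<and> (Q Tb s \<longrightarrow> P Tb s)) :: nat)"
    by (auto simp: fun_eq_iff)
  then show ?thesis using p_conj[OF p_imp[OF assms] p_imp[OF assms(2,1)]] by (simp only:)
qed

lemma p_eq:
  assumes "definable T f" "definable T g" shows "dpred T (\<lambda>Tb s. f Tb s = g Tb s)"
proof -
  have "(\<lambda>Tb s. of_bool (f Tb s = g Tb s)) = (\<lambda>Tb s. of_bool (f Tb s \<le> g Tb s \<and> g Tb s \<le> f Tb s) :: nat)"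
    by (auto simp: fun_eq_iff)
  then show ?thesis using p_conj[OF p_le[OF assms] p_le[OF assms(2,1)]] by (simp only:)
qed

lemma p_ex:
  assumes "definable T f" "dpred T (\<lambda>Tb s. P Tb (\<lambda>n. s (Suc n)) (s 0))"
  shows "dpred T (\<lambda>Tb s. \<exists>i<f Tb s. P Tb s i)"
proof -
  have "dpred T (\<lambda>Tb s. 0 < (\<Sum>i<f Tb s. of_bool (P Tb s i) :: nat))"
    by (intro p_less d_zero d_sum[OF assms(1)] assms(2))
  moreover have "0 < (\<Sum>i<m. of_bool (Q i) :: nat) \<longleftrightarrow> (\<exists>i<m. Q i)" for m and Q :: "nat \<Rightarrow> bool"
    by (auto simp: zero_less_iff_neq_zero)
  ultimately show ?thesis by simp
qed

lemma p_all:
  assumes "definable T f" "dpred T (\<lambda>Tb s. P Tb (\<lambda>n. s (Suc n)) (s 0))"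
  shows "dpred T (\<lambda>Tb s. \<forall>i<f Tb s. P Tb s i)"
  using p_not[OF p_ex[OF assms(1) p_not[OF assms(2)]]] by simp

lemma p_ex_le:
  assumes "definable T f" "dpred T (\<lambda>Tb s. P Tb (\<lambda>n. s (Suc n)) (s 0))"
  shows "dpred T (\<lambda>Tb s. \<exists>i\<le>f Tb s. P Tb s i)"
  using p_ex[OF d_Suc[OF assms(1)] assms(2)] by (simp add: less_Suc_eq_le)

lemma p_all_le:
  assumes "definable T f" "dpred T (\<lambda>Tb s. P Tb (\<lambda>n. s (Suc n)) (s 0))"
  shows "dpred T (\<lambda>Tb s. \<forall>i\<le>f Tb s. P Tb s i)"
  using p_all[OF d_Suc[OF assms(1)] assms(2)] by (simp add: less_Suc_eq_le)

lemma d_if: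
  assumes "dpred T P" "definable T f" "definable T g"
  shows "definable T (\<lambda>Tb s. if P Tb s then f Tb s else g Tb s)"
proof -
  have "(if Q then a else b) = of_bool Q * a + of_bool (\<not> Q) * b" for Q and a b :: nat by auto
  then show ?thesis using assms by (auto intro!: d_add d_mult p_not)
qed

lemma p_if:
  assumes "dpred T P" "dpred T Q" "dpred T R"
  shows "dpred T (\<lambda>Tb s. if P Tb s then Q Tb s else R Tb s)"
proof -
  have "(\<lambda>Tb s. of_bool (if P Tb s then Q Tb s else R Tb s)) = (\<lambda>Tb s. of_bool (P Tb s \<and> Q Tb s \<or> \<not> P Tb s \<and> R Tb s) :: nat)"
    by (auto simp: fun_eq_iff)
  then show ?thesis using p_disj[OF p_conj[OF assms(1,2)] p_conj[OF p_not[OF assms(1)] assms(3)]] by (simp only:)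
qed

text \<open>By these rules a defined notion has to be unfolded only with variables as its arguments;
  terms are substituted afterwards.\<close>

lemma d_subst1:
  assumes "definable T (\<lambda>Tb s. F Tb (s 0))" "definable T a"
  shows "definable T (\<lambda>Tb s. F Tb (a Tb s))"
  using d_subst[OF assms(1), of "\<lambda>_. a"] assms(2) by simp

lemma d_subst2:
  assumes "definable T (\<lambda>Tb s. F Tb (s 0) (s (Suc 0)))" "definable T a" "definable T b"
  shows "definable T (\<lambda>Tb s. F Tb (a Tb s) (b Tb s))"
proof -
  have "definable T (case_nat a (\<lambda>_. b) n)" for n using assms by (cases n) auto
  from d_subst[OF assms(1), of "case_nat a (\<lambda>_. b)", OF this] show ?thesis by simp
qed

lemma d_subst3:
  assumes "definable T (\<lambda>Tb s. F Tb (s 0) (s (Suc 0)) (s (Suc (Suc 0))))" "definable T a" "definable T b" "definable T c"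
  shows "definable T (\<lambda>Tb s. F Tb (a Tb s) (b Tb s) (c Tb s))"
proof -
  define e where "e = case_nat a (case_nat b (\<lambda>_. c))"
  have "definable T (e n)" for n using assms by (auto simp: e_def split: nat.split)
  from d_subst[OF assms(1), of e, OF this] show ?thesis by (simp add: e_def)
qed

lemma d_subst4:
  assumes "definable T (\<lambda>Tb s. F Tb (s 0) (s (Suc 0)) (s (Suc (Suc 0))) (s (Suc (Suc (Suc 0)))))"
    "definable T a" "definable T b" "definable T c" "definable T d"
  shows "definable T (\<lambda>Tb s. F Tb (a Tb s) (b Tb s) (c Tb s) (d Tb s))"
proof -
  define e where "e = case_nat a (case_nat b (case_nat c (\<lambda>_. d)))"
  have "definable T (e n)" for n using assms by (auto simp: e_def split: nat.split)
  from d_subst[OF assms(1), of e, OF this] show ?thesis by (simp add: e_def)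
qed

text \<open>The quotient counts the positive multiples of \<open>b\<close> up to \<open>a\<close>.
  The conjunct \<open>0 < b\<close> yields the convention \<open>a div 0 = 0\<close>.\<close>

lemma div_eq_sum: "a div b = (\<Sum>i<a. of_bool (0 < b \<and> Suc i * b \<le> a))" for a b :: nat
proof (cases "b = 0")
  case False
  then have 1: "Suc i * b \<le> a \<longleftrightarrow> i < a div b" for i
    using less_eq_div_iff_mult_less_eq[of b "Suc i" a] by (simp add: Suc_le_eq)
  have "(\<Sum>i<a. of_bool (0 < b \<and> Suc i * b \<le> a) :: nat) = (\<Sum>i<a. if i < a div b then 1 else 0)"
    unfolding 1 using False by (intro sum.cong) auto
  also have "\<dots> = card ({..<a} \<inter> {i. i < a div b})" by (subst sum.If_cases) auto
  also have "{..<a} \<inter> {i. i < a div b} = {..<a div b}"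
    by (auto intro: less_le_trans[OF _ div_le_dividend])
  finally show ?thesis by simp
qed simp

lemma d_div:
  assumes "definable T f" "definable T g" shows "definable T (\<lambda>Tb s. f Tb s div g Tb s)"
  using assms
  by (rule d_subst2[rotated]) (unfold div_eq_sum, intro d_sum d_var p_conj p_less p_le d_zero d_mult d_Suc)

lemma d_mod: "definable T f \<Longrightarrow> definable T g \<Longrightarrow> definable T (\<lambda>Tb s. f Tb s mod g Tb s)"
  unfolding minus_div_mult_eq_mod[symmetric] by (intro d_sub d_mult d_div)

lemma p_dvd: "definable T f \<Longrightarrow> definable T g \<Longrightarrow> dpred T (\<lambda>Tb s. f Tb s dvd g Tb s)"
  unfolding dvd_eq_mod_eq_0 by (intro p_eq d_mod d_const)

lemma p_odd: "definable T f \<Longrightarrow> dpred T (\<lambda>Tb s. odd (f Tb s))"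
  by (intro p_not p_dvd d_const)

text \<open>An arbitrary \<open>F\<close> is hard-wired on finitely many arguments as a sum of
  constants. The transition tables of a fixed machine become definable in this way.\<close>

lemma d_finite: "definable T f \<Longrightarrow> definable T (\<lambda>Tb s. if f Tb s < K then F (f Tb s) else 0)"
proof (induction K)
  case (Suc K)
  have "(if n < Suc K then F n else 0) = (if n < K then F n else 0) + of_bool (n = K) * F K" for n
    by (cases n K rule: linorder_cases) auto
  then show ?case using Suc by (auto intro!: d_add d_mult p_eq d_const)
qed (simp add: d_zero)

section \<open>Broadcast schemes as schedules\<close>

text \<open>The tree of informing calls is a static description of a broadcast: lower bounds become
  inequalities along tree paths, and a scheme can be given by explicit formulas. The last condition
  says that a vertex makes at most one call per round.\<close>

definition schedule :: "'a set \<Rightarrow> 'a set set \<Rightarrow> 'a \<Rightarrow> nat \<Rightarrow> ('a \<Rightarrow> nat) \<Rightarrow> ('a \<Rightarrow> 'a) \<Rightarrow> bool" where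
  "schedule V E r D ti par \<longleftrightarrow> ti r = 0 \<and> (\<forall>v\<in>V. ti v \<le> D) \<and>
     (\<forall>v\<in>V. v \<noteq> r \<longrightarrow> par v \<in> V \<and> {par v, v} \<in> E \<and> ti (par v) < ti v) \<and>
     (\<forall>v\<in>V. \<forall>w\<in>V. v \<noteq> r \<longrightarrow> w \<noteq> r \<longrightarrow> par v = par w \<longrightarrow> ti v = ti w \<longrightarrow> v = w)"

lemma schedule_imp_broadcast:
  assumes s: "schedule V E r D ti par" and r: "r \<in> V"
  shows "(broadcast_round E ^^ D) {r} V"
proof -
  have ti_r: "ti r = 0" using s by (simp add: schedule_def)
  have pos: "0 < ti v" if "v \<in> V" "v \<noteq> r" for v
  proof -
    have "ti (par v) < ti v" using s that by (simp add: schedule_def)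
    then show ?thesis by simp
  qed
  have "(broadcast_round E ^^ t) {r} {v \<in> V. ti v \<le> t}" for t
  proof (induction t)
    case 0
    have "{v \<in> V. ti v \<le> 0} = {r}" using pos ti_r r by fastforce
    then show ?case by simp
  next
    case (Suc t)
    define c where "c u = (if \<exists>v\<in>V. v \<noteq> r \<and> par v = u \<and> ti v = Suc t
      then Some (SOME v. v \<in> V \<and> v \<noteq> r \<and> par v = u \<and> ti v = Suc t) else None)" for u
    have cD: "w \<in> V \<and> w \<noteq> r \<and> par w = u \<and> ti w = Suc t" if "c u = Some w" for u w
    proof -
      have ex: "\<exists>v. v \<in> V \<and> v \<noteq> r \<and> par v = u \<and> ti v = Suc t"
        using that unfolding c_def by (auto split: if_splits)
      have "w = (SOME v. v \<in> V \<and> v \<noteq> r \<and> par v = u \<and> ti v = Suc t)"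
        using that unfolding c_def by (auto split: if_splits)
      with someI_ex[OF ex] show ?thesis by simp
    qed
    have cI: "c (par w) = Some w" if w: "w \<in> V" "w \<noteq> r" "ti w = Suc t" for w
    proof -
      have "c (par w) \<noteq> None" using w by (auto simp: c_def)
      then obtain w' where w': "c (par w) = Some w'" by auto
      from cD[OF this] w have "w' = w" using s unfolding schedule_def by metis
      with w' show ?thesis by simp
    qed
    have "broadcast_round E {v \<in> V. ti v \<le> t} {v \<in> V. ti v \<le> Suc t}"
      unfolding broadcast_round_def
    proof (intro exI[of _ c] conjI ballI allI impI)
      fix u w assume "c u = Some w"
      then show "{u, w} \<in> E" using cD s unfolding schedule_def by metis
    next
      have "w \<in> {v \<in> V. ti v \<le> t} \<union> {w. \<exists>u\<in>{v \<in> V. ti v \<le> t}. c u = Some w}"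
        if w: "w \<in> V" "ti w \<le> Suc t" for w
      proof (cases "ti w \<le> t")
        case False
        then have t: "ti w = Suc t" using w by simp
        then have nr: "w \<noteq> r" using ti_r by auto
        have "par w \<in> V \<and> ti (par w) < ti w" using s w(1) nr by (simp add: schedule_def)
        then show ?thesis using cI[OF w(1) nr t] t by auto
      qed (use w in auto)
      then show "{v \<in> V. ti v \<le> Suc t} = {v \<in> V. ti v \<le> t} \<union> {w. \<exists>u\<in>{v \<in> V. ti v \<le> t}. c u = Some w}"
        using cD by fastforce
    qed
    with Suc show ?case by auto
  qed
  moreover have "{v \<in> V. ti v \<le> D} = V" using s by (auto simp: schedule_def)
  ultimately show ?thesis by metis
qed

lemma broadcast_rounds:
  assumes "(broadcast_round E ^^ D) I J"
  obtains f c where "f 0 = I" "f D = J"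
    "\<And>i u w. i < D \<Longrightarrow> u \<in> f i \<Longrightarrow> c i u = Some w \<Longrightarrow> {u, w} \<in> E"
    "\<And>i. i < D \<Longrightarrow> f (Suc i) = f i \<union> {w. \<exists>u\<in>f i. c i u = Some w}"
proof -
  obtain f where f: "f 0 = I" "f D = J" "\<forall>i<D. broadcast_round E (f i) (f (Suc i))"
    using assms unfolding relpowp_fun_conv by blast
  define Q where "Q i c \<longleftrightarrow> (\<forall>u\<in>f i. \<forall>w. c u = Some w \<longrightarrow> {u, w} \<in> E) \<and> f (Suc i) = f i \<union> {w. \<exists>u\<in>f i. c u = Some w}" for i c
  have "\<forall>i. \<exists>c. i < D \<longrightarrow> Q i c" using f(3) unfolding broadcast_round_def Q_def by blast
  then obtain c where "\<forall>i. i < D \<longrightarrow> Q i (c i)" by metis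
  then show thesis using f(1,2) by (intro that[of f c]) (auto simp: Q_def)
qed

lemma rounds_mono:
  assumes "\<And>i. i < D \<Longrightarrow> f (Suc i) = f i \<union> g i" "i \<le> j" "j \<le> D"
  shows "f i \<subseteq> f j"
  using assms(2,3)
proof (induction j)
  case (Suc j)
  show ?case
  proof (cases "i = Suc j")
    case False
    then have "f i \<subseteq> f j" using Suc by simp
    then show ?thesis using assms(1)[of j] Suc.prems by auto
  qed simp
qed simp

lemma broadcast_imp_schedule:
  assumes "(broadcast_round E ^^ D) {r} V"
  obtains ti par where "schedule V E r D ti par"
proof -
  obtain f c where f: "f 0 = {r}" "f D = V"
    and fE: "\<And>i u w. i < D \<Longrightarrow> u \<in> f i \<Longrightarrow> c i u = Some w \<Longrightarrow> {u, w} \<in> E"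
    and fS: "\<And>i. i < D \<Longrightarrow> f (Suc i) = f i \<union> {w. \<exists>u\<in>f i. c i u = Some w}"
    using broadcast_rounds[OF assms] by blast
  have fm: "f i \<subseteq> f j" if "i \<le> j" "j \<le> D" for i j
    using rounds_mono[of D f "\<lambda>i. {w. \<exists>u\<in>f i. c i u = Some w}" i j] fS that by blast
  define ti where "ti v = (LEAST t. v \<in> f t)" for v
  have ti: "v \<in> f (ti v)" "ti v \<le> D" if "v \<in> V" for v
    unfolding ti_def using that f(2) LeastI[of "\<lambda>t. v \<in> f t" D] Least_le[of "\<lambda>t. v \<in> f t" D] by auto
  have ti_le: "ti v \<le> t" if "v \<in> f t" for v t unfolding ti_def using that by (rule Least_le)
  have ti_r: "ti r = 0" using ti_le[of r 0] f(1) by simp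
  define Q where "Q v u \<longleftrightarrow> u \<in> f (ti v - 1) \<and> c (ti v - 1) u = Some v" for v u
  define par where "par v = (SOME u. Q v u)" for v
  have par: "Q v (par v)" "0 < ti v" if "v \<in> V" "v \<noteq> r" for v
  proof -
    show 1: "0 < ti v"
    proof (rule ccontr)
      assume "\<not> 0 < ti v"
      then have "v \<in> f 0" using ti(1)[OF that(1)] by simp
      then show False using f(1) that by simp
    qed
    have "v \<in> f (Suc (ti v - 1))" "v \<notin> f (ti v - 1)" "ti v - 1 < D"
      using 1 ti[OF that(1)] ti_le[of v "ti v - 1"] by auto
    then have "\<exists>u. Q v u" using fS[of "ti v - 1"] unfolding Q_def by blast
    then show "Q v (par v)" unfolding par_def by (rule someI_ex)
  qed
  have "schedule V E r D ti par"
    unfolding schedule_def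
  proof (intro conjI ballI impI)
    fix v assume v: "v \<in> V" "v \<noteq> r"
    have p: "par v \<in> f (ti v - 1)" "c (ti v - 1) (par v) = Some v" "ti v - 1 < D" "0 < ti v"
      using par[OF v] ti(2)[OF v(1)] unfolding Q_def by auto
    show "par v \<in> V" using p fm[of "ti v - 1" D] f(2) by auto
    show "{par v, v} \<in> E" using fE p by blast
    show "ti (par v) < ti v" using ti_le[OF p(1)] p(4) by simp
  next
    fix v w assume "v \<in> V" "w \<in> V" "v \<noteq> r" "w \<noteq> r" "par v = par w" "ti v = ti w"
    then show "v = w" using par[of v] par[of w] unfolding Q_def by simp
  qed (use ti ti_r in auto)
  then show thesis by (rule that)
qed

lemma schedule_mono:
  assumes s: "schedule V E r D ti par" and D: "D \<le> D'"
  shows "schedule V E r D' ti par"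
proof -
  have "ti v \<le> D'" if "v \<in> V" for v
  proof -
    have "ti v \<le> D" using s that by (simp add: schedule_def)
    then show ?thesis using D by simp
  qed
  then show ?thesis using s by (simp add: schedule_def)
qed

lemma broadcast_mono:
  assumes "(broadcast_round E ^^ D) {r} V" "D \<le> D'" "r \<in> V"
  shows "(broadcast_round E ^^ D') {r} V"
proof -
  obtain ti par where "schedule V E r D ti par" using broadcast_imp_schedule[OF assms(1)] .
  from schedule_imp_broadcast[OF schedule_mono[OF this assms(2)] assms(3)] show ?thesis .
qed

lemma broadcast_time_le:
  assumes "r \<in> V"
  shows "broadcast_time V E r \<le> enat D \<longleftrightarrow> (broadcast_round E ^^ D) {r} V"
proof
  assume "(broadcast_round E ^^ D) {r} V"
  then show "broadcast_time V E r \<le> enat D" unfolding broadcast_time_def by (intro INF_lower) auto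
next
  assume le: "broadcast_time V E r \<le> enat D"
  show "(broadcast_round E ^^ D) {r} V"
  proof (rule ccontr)
    assume n: "\<not> (broadcast_round E ^^ D) {r} V"
    have ge: "enat (Suc D) \<le> broadcast_time V E r"
      unfolding broadcast_time_def
    proof (rule INF_greatest)
      fix t assume "t \<in> {t. (broadcast_round E ^^ t) {r} V}"
      then have "\<not> t \<le> D" using broadcast_mono[of t E r V D] n assms by auto
      then show "enat (Suc D) \<le> enat t" by simp
    qed
    show False using order_trans[OF ge le] by simp
  qed
qed

text \<open>Once the optimal time is known, the minimum of extended naturals disappears and the
  center is described by one broadcast predicate. Membership and hardness both use it in this
  form.\<close>

lemma broadcast_center_eq:
  assumes "\<And>v t. v \<in> V \<Longrightarrow> t < D \<Longrightarrow> \<not> (broadcast_round E ^^ t) {v} V"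
    and "v0 \<in> V" "(broadcast_round E ^^ D) {v0} V"
  shows "broadcast_center V E = {v \<in> V. (broadcast_round E ^^ D) {v} V}"
proof -
  have ge: "enat D \<le> broadcast_time V E v" if "v \<in> V" for v
  proof (rule ccontr)
    assume "\<not> enat D \<le> broadcast_time V E v"
    then obtain t where t: "broadcast_time V E v = enat t" "t < D"
      by (cases "broadcast_time V E v") auto
    then show False using broadcast_time_le[OF that, of E t] assms(1)[OF that t(2)] by simp
  qed
  have "(INF u\<in>V. broadcast_time V E u) = enat D"
  proof (rule antisym)
    have "(INF u\<in>V. broadcast_time V E u) \<le> broadcast_time V E v0" using assms(2) by (rule INF_lower)
    also have "\<dots> \<le> enat D" using assms broadcast_time_le by metis
    finally show "(INF u\<in>V. broadcast_time V E u) \<le> enat D" .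
  qed (use ge in \<open>auto intro: INF_greatest\<close>)
  then show ?thesis unfolding broadcast_center_def
    using ge broadcast_time_le by (metis (no_types, lifting) antisym order_refl)
qed

lemma broadcast_center_unreachable:
  assumes "\<And>v t. v \<in> V \<Longrightarrow> \<not> (broadcast_round E ^^ t) {v} V"
  shows "broadcast_center V E = V"
proof -
  have b: "broadcast_time V E v = \<infinity>" if "v \<in> V" for v
    using broadcast_time_le[OF that] assms[OF that] by (metis enat.exhaust order_refl)
  show ?thesis
  proof (cases "V = {}")
    case False
    then have "(INF u\<in>V. broadcast_time V E u) = \<infinity>" using b by simp
    then show ?thesis using b by (auto simp: broadcast_center_def)
  qed (simp add: broadcast_center_def)
qed

text \<open>One call per round suffices: among the uninformed vertices, one with the smallest time
  in the given schedule has an informed parent. So the times up to the number of vertices decide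
  whether a broadcast is possible at all.\<close>

lemma broadcast_card:
  assumes b: "(broadcast_round E ^^ t) {r} V" and r: "r \<in> V" and fin: "finite V"
  shows "(broadcast_round E ^^ card V) {r} V"
proof -
  obtain ti par where s: "schedule V E r t ti par" using broadcast_imp_schedule[OF b] .
  have "\<exists>I. (broadcast_round E ^^ k) {r} I \<and> r \<in> I \<and> I \<subseteq> V \<and> (I = V \<or> k < card I)" for k
  proof (induction k)
    case 0
    show ?case using r by (intro exI[of _ "{r}"]) auto
  next
    case (Suc k)
    then obtain I where I: "(broadcast_round E ^^ k) {r} I" "r \<in> I" "I \<subseteq> V" "I = V \<or> k < card I" by blast
    show ?case
    proof (cases "I = V")
      case True
      have "broadcast_round E I I" unfolding broadcast_round_def by (intro exI[of _ "\<lambda>_. None"]) auto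
      then show ?thesis using I True by (intro exI[of _ I]) auto
    next
      case False
      then obtain w where w: "w \<in> V - I" "\<And>y. y \<in> V - I \<Longrightarrow> ti w \<le> ti y"
        using ex_has_least_nat[of "\<lambda>y. y \<in> V - I" _ ti] I(3) by blast
      have "w \<noteq> r" using w I by auto
      then have p: "par w \<in> V" "{par w, w} \<in> E" "ti (par w) < ti w" using s w by (auto simp: schedule_def)
      then have "par w \<in> I" using w(2)[of "par w"] by auto
      then have "broadcast_round E I (insert w I)"
        unfolding broadcast_round_def using p by (intro exI[of _ "\<lambda>u. if u = par w then Some w else None"]) auto
      moreover have "Suc k < card (insert w I)"
        using I False w finite_subset[OF I(3) fin] by auto
      ultimately show ?thesis using I w by (intro exI[of _ "insert w I"]) auto
    qed
  qed
  then obtain I where I: "(broadcast_round E ^^ card V) {r} I" "I \<subseteq> V" "I = V \<or> card V < card I" by blast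
  then have "I = V" using card_mono[OF fin I(2)] by auto
  with I show ?thesis by simp
qed

section \<open>Membership\<close>

text \<open>\<open>C p q s\<close>: in the \<open>s\<close>-th round \<open>p\<close> calls \<open>q\<close>.\<close>

definition informed :: "nat \<Rightarrow> (nat \<Rightarrow> nat \<Rightarrow> nat \<Rightarrow> bool) \<Rightarrow> nat \<Rightarrow> nat \<Rightarrow> nat \<Rightarrow> bool" where
  "informed n C y q s \<longleftrightarrow> q = y \<or> (\<exists>p<n. \<exists>i<s. C p q i)"

definition good_calls :: "nat \<Rightarrow> (nat \<Rightarrow> nat \<Rightarrow> bool) \<Rightarrow> nat \<Rightarrow> (nat \<Rightarrow> nat \<Rightarrow> nat \<Rightarrow> bool) \<Rightarrow> nat \<Rightarrow> bool" where
  "good_calls n e t C y \<longleftrightarrow>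
     (\<forall>p<n. \<forall>q<n. \<forall>s<t. C p q s \<longrightarrow> e p q \<and> informed n C y p s \<and> (\<forall>q'<n. C p q' s \<longrightarrow> q' = q)) \<and>
     (\<forall>q<n. informed n C y q t)"

text \<open>A certificate encodes only calls with indices in range; the calls of an actual broadcast
  may be changed outside.\<close>

lemma good_calls_cong:
  assumes "\<And>p q s. p < n \<Longrightarrow> q < n \<Longrightarrow> s < t \<Longrightarrow> C p q s = C' p q s"
  shows "good_calls n e t C y = good_calls n e t C' y"
proof -
  have "informed n C y q s = informed n C' y q s" if "q < n" "s \<le> t" for q s
    using assms that unfolding informed_def by (meson less_le_trans)
  then show ?thesis using assms unfolding good_calls_def by (simp cong: imp_cong conj_cong)
qed

lemma good_calls_imp_broadcast:
  assumes e: "\<And>i j. i < n \<Longrightarrow> j < n \<Longrightarrow> e i j \<Longrightarrow> {i, j} \<in> E" and g: "good_calls n e t C y" and y: "y < n"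
  shows "(broadcast_round E ^^ t) {y} {0..<n}"
proof -
  define I where "I s = {q. q < n \<and> informed n C y q s}" for s
  have "(broadcast_round E ^^ s) {y} (I s)" if "s \<le> t" for s
    using that
  proof (induction s)
    case 0
    have "I 0 = {y}" using y by (auto simp: I_def informed_def)
    then show ?case by simp
  next
    case (Suc s)
    then have s: "s < t" by simp
    define c where "c p = (if \<exists>q<n. C p q s then Some (SOME q. q < n \<and> C p q s) else None)" for p
    have uniq: "e p q \<and> p \<in> I s \<and> (\<forall>q'<n. C p q' s \<longrightarrow> q' = q)" if "p < n" "q < n" "C p q s" for p q
      using g s that unfolding good_calls_def I_def by blast
    have cD: "q < n \<and> C p q s" if "c p = Some q" for p q
    proof -
      have ex: "\<exists>q<n. C p q s" "q = (SOME q. q < n \<and> C p q s)" using that unfolding c_def by (auto split: if_splits)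
      from someI_ex[OF ex(1)] ex(2) show ?thesis by simp
    qed
    have cI: "c p = Some q" if "p < n" "q < n" "C p q s" for p q
    proof -
      have "c p \<noteq> None" using that by (auto simp: c_def)
      then obtain q' where "c p = Some q'" by auto
      with cD[OF this] uniq[OF that] show ?thesis by auto
    qed
    have "broadcast_round E (I s) (I (Suc s))"
      unfolding broadcast_round_def
    proof (intro exI[of _ c] conjI ballI allI impI)
      fix p q assume "p \<in> I s" "c p = Some q"
      then show "{p, q} \<in> E" using e uniq cD by (auto simp: I_def)
    next
      have 1: "q \<in> I (Suc s) \<longleftrightarrow> q \<in> I s \<or> (q < n \<and> (\<exists>p<n. C p q s))" for q
        unfolding I_def informed_def by (auto simp: less_Suc_eq)
      have 2: "(\<exists>p\<in>I s. c p = Some q) \<longleftrightarrow> q < n \<and> (\<exists>p<n. C p q s)" for q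
        using uniq cD cI unfolding I_def by (metis (mono_tags, lifting) mem_Collect_eq)
      show "I (Suc s) = I s \<union> {w. \<exists>u\<in>I s. c u = Some w}" using 1 2 by blast
    qed
    then show ?case using Suc by auto
  qed
  moreover have "I t = {0..<n}" using g by (auto simp: I_def good_calls_def)
  ultimately show ?thesis by (metis order_refl)
qed

lemma broadcast_imp_good_calls:
  assumes e: "\<And>i j. i < n \<Longrightarrow> j < n \<Longrightarrow> {i, j} \<in> E \<Longrightarrow> e i j"
    and b: "(broadcast_round E ^^ t) {y} {0..<n}"
  obtains C where "good_calls n e t C y"
proof -
  obtain f c where f: "f 0 = {y}" "f t = {0..<n}"
    and fE: "\<And>i u w. i < t \<Longrightarrow> u \<in> f i \<Longrightarrow> c i u = Some w \<Longrightarrow> {u, w} \<in> E"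
    and fS: "\<And>i. i < t \<Longrightarrow> f (Suc i) = f i \<union> {w. \<exists>u\<in>f i. c i u = Some w}"
    using broadcast_rounds[OF b] by blast
  have fn: "f i \<subseteq> {0..<n}" if "i \<le> t" for i 
    using rounds_mono[of t f "\<lambda>i. {w. \<exists>u\<in>f i. c i u = Some w}" i t] fS that f(2) by blast
  define C where "C p q s \<longleftrightarrow> p \<in> f s \<and> c s p = Some q" for p q s
  have inf: "informed n C y q s \<longleftrightarrow> q \<in> f s" if "s \<le> t" for q s
    using that
  proof (induction s)
    case (Suc s)
    have "informed n C y q (Suc s) \<longleftrightarrow> informed n C y q s \<or> (\<exists>p<n. C p q s)"
      unfolding informed_def by (auto simp: less_Suc_eq)
    also have "\<dots> \<longleftrightarrow> q \<in> f (Suc s)"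
      using Suc fS[of s] fn[of s] unfolding C_def by fastforce
    finally show ?case .
  qed (auto simp: informed_def f)
  have "good_calls n e t C y"
    unfolding good_calls_def
  proof (intro conjI allI impI)
    fix p q s assume *: "p < n" "q < n" "s < t" "C p q s"
    show "e p q" using * fE[of s p q] e by (auto simp: C_def)
    show "informed n C y p s" using * inf by (auto simp: C_def)
    show "q' = q" if "C p q' s" for q' using * that by (simp add: C_def)
  qed (use inf f in auto)
  then show thesis by (rule that)
qed

section \<open>Decoding instances by definable functions\<close>

lemma length_concat_blocks: "length (concat (map (\<lambda>i. map (f i) [0..<n]) [0..<m])) = m * n"
  by (induction m) auto

lemma concat_blocks: "concat (map (\<lambda>i. map (f i) [0..<n]) [0..<m]) = map (\<lambda>k. f (k div n) (k mod n)) [0..<m * n]"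
proof (induction m)
  case (Suc m)
  have "[0..<Suc m * n] = [0..<m * n] @ map (\<lambda>j. m * n + j) [0..<n]"
    using upt_add_eq_append[of 0 "m * n" n] by (simp add: add.commute map_add_upt)
  then show ?case using Suc by (auto intro!: map_cong)
qed simp

lemma nat_bits_0 [simp]: "nat_bits 0 = []"
  by (subst nat_bits.simps) simp

lemma nat_bits_pos: "0 < m \<Longrightarrow> nat_bits m = odd m # nat_bits (m div 2)"
  by (subst nat_bits.simps) simp

lemma length_nat_bits: "i < length (nat_bits m) \<longleftrightarrow> 2 ^ i \<le> m"
proof (induction m arbitrary: i rule: less_induct)
  case (less m)
  show ?case
  proof (cases "m = 0")
    case False
    then have IH: "i < length (nat_bits (m div 2)) \<longleftrightarrow> 2 ^ i \<le> m div 2" for i using less by simp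
    have "2 ^ j \<le> m div 2 \<longleftrightarrow> 2 * 2 ^ j \<le> m" for j :: nat
      using less_eq_div_iff_mult_less_eq[of 2 "2 ^ j" m] by (simp add: mult.commute)
    then show ?thesis using False IH by (cases i) (simp_all add: nat_bits_pos Suc_le_eq)
  qed simp
qed

lemma nth_nat_bits: "i < length (nat_bits m) \<Longrightarrow> nat_bits m ! i = odd (m div 2 ^ i)"
proof (induction m arbitrary: i rule: less_induct)
  case (less m)
  show ?case
  proof (cases "m = 0")
    case False
    then show ?thesis using less by (cases i) (auto simp: nat_bits_pos div_mult2_eq)
  qed (use less in simp)
qed

lemma length_encode: "length (encode_instance n E m) = n + 1 + n * n + length (nat_bits m)"
  by (simp add: encode_instance_def length_concat_blocks)

lemma cell_append: "cell (x @ y) i = (if i < length x then cell x i else cell y (i - length x))"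
  by (auto simp: cell_def nth_append)

lemma cell_append_add: "cell (x @ y) (length x + i) = cell y i"
  by (simp add: cell_append)

lemma cell_encode:
  defines "X \<equiv> \<lambda>n E m. cell (encode_instance n E m)"
  shows "i < n \<Longrightarrow> X n E m i = 2" "X n E m n = 1"
    "i < n \<Longrightarrow> j < n \<Longrightarrow> X n E m (n + 1 + (i * n + j)) = (if {i, j} \<in> E then 2 else 1)"
    "X n E m (n + 1 + n * n + i) = cell (nat_bits m) i"
proof -
  let ?P = "replicate n True @ [False]" and ?B = "map (\<lambda>k. {k div n, k mod n} \<in> E) [0..<n * n]"
  have enc: "encode_instance n E m = ?P @ ?B @ nat_bits m"
    by (simp add: encode_instance_def concat_blocks)
  show "X n E m i = 2" if "i < n" using that unfolding X_def enc by (simp add: cell_append) (simp add: cell_def)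
  show "X n E m n = 1" unfolding X_def enc by (simp add: cell_append) (simp add: cell_def)
  have 1: "X n E m (n + 1 + k) = cell (?B @ nat_bits m) k" for k
    using cell_append_add[of ?P "?B @ nat_bits m" k] unfolding X_def enc by simp
  show "X n E m (n + 1 + n * n + i) = cell (nat_bits m) i"
    using cell_append_add[of ?B "nat_bits m" i] 1[of "n * n + i"] by (simp add: add.assoc)
  assume ij: "i < n" "j < n"
  have "i * n + j < Suc i * n" using ij by simp
  also have "\<dots> \<le> n * n" using ij by (intro mult_le_mono) auto
  finally have "cell (?B @ nat_bits m) (i * n + j) = (if {i, j} \<in> E then 2 else 1)"
    using ij by (simp add: cell_append) (simp add: cell_def)
  then show "X n E m (n + 1 + (i * n + j)) = (if {i, j} \<in> E then 2 else 1)" unfolding 1 .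
qed

lemma cell_inj:
  assumes "length x = length y" "\<And>i. i < length x \<Longrightarrow> cell x i = cell y i"
  shows "x = y"
proof (rule nth_equalityI)
  fix i assume "i < length x"
  then show "x ! i = y ! i" using assms(2)[of i] assms(1) by (auto simp: cell_def split: if_splits)
qed (rule assms(1))

text \<open>Decodes a unary number that starts in cell \<open>s\<close>; \<open>l\<close> limits the
  search.\<close>

definition leading :: "(nat \<Rightarrow> nat) \<Rightarrow> nat \<Rightarrow> nat \<Rightarrow> nat" where
  "leading X s l = (\<Sum>i<l. of_bool (\<forall>j\<le>i. X (s + j) = 2))"

lemma leading_eq:
  assumes "\<And>j. j < n \<Longrightarrow> X (s + j) = 2" "X (s + n) \<noteq> 2" "n \<le> l"
  shows "leading X s l = n"
proof -
  have "(\<forall>j\<le>i. X (s + j) = 2) \<longleftrightarrow> i < n" for i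
    using assms by (meson leI le_less_trans)
  then have "leading X s l = (\<Sum>i<l. if i < n then 1 else 0)" unfolding leading_def by (intro sum.cong) auto
  also have "\<dots> = card ({..<l} \<inter> {i. i < n})" by (subst sum.If_cases) auto
  also have "{..<l} \<inter> {i. i < n} = {..<n}" using assms(3) by auto
  finally show ?thesis by simp
qed

text \<open>The bits of a number \<open>m\<close> are expressed by the powers of two up to \<open>m\<close>: the function \<open>2 ^ i\<close> is
  not polynomially bounded and hence not definable.\<close>

definition pow2 :: "nat \<Rightarrow> bool" where
  "pow2 y \<longleftrightarrow> 0 < y \<and> (\<forall>d\<le>y. d dvd y \<longrightarrow> odd d \<longrightarrow> d = 1)"

lemma pow2_iff: "pow2 y \<longleftrightarrow> (\<exists>k. y = 2 ^ k)"
proof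
  show "pow2 y \<Longrightarrow> \<exists>k. y = 2 ^ k"
  proof (induction y rule: less_induct)
    case (less y)
    show ?case
    proof (cases "even y")
      case True
      then obtain z where z: "y = 2 * z" by (elim evenE)
      have "pow2 z" "z < y" using less.prems z by (auto simp: pow2_def)
      then obtain k where "z = 2 ^ k" using less.IH by blast
      then show ?thesis using z by (intro exI[of _ "Suc k"]) simp
    next
      case False
      then have "y = 1" using less.prems by (auto simp: pow2_def)
      then show ?thesis by (intro exI[of _ 0]) simp
    qed
  qed
  show "\<exists>k. y = 2 ^ k \<Longrightarrow> pow2 y"
  proof (elim exE)
    fix k assume y: "y = 2 ^ k"
    have "d = 1" if "d dvd y" "odd d" for d
    proof -
      have "coprime d (2 ^ k)" using that by (simp add: coprime_commute)
      then show ?thesis using that y by (metis coprime_absorb_left nat_dvd_1_iff_1)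
    qed
    then show "pow2 y" using y by (auto simp: pow2_def)
  qed
qed

text \<open>On powers of two this is the binary logarithm, and at \<open>Suc m\<close> it is the bit
  length of \<open>m\<close>.\<close>

definition pow2_count :: "nat \<Rightarrow> nat" where
  "pow2_count y = (\<Sum>z<y. of_bool (pow2 z))"

lemma pow2_count_eq:
  assumes "\<And>k. 2 ^ k < y \<longleftrightarrow> k < n"
  shows "pow2_count y = n"
proof -
  have "pow2_count y = (\<Sum>z<y. if pow2 z then 1 else 0)" unfolding pow2_count_def by (intro sum.cong) auto
  also have "\<dots> = card ({..<y} \<inter> {z. pow2 z})" by (subst sum.If_cases) auto
  also have "{..<y} \<inter> {z. pow2 z} = (\<lambda>k. 2 ^ k) ` {..<n}" using assms by (auto simp: pow2_iff)
  also have "card \<dots> = n" by (subst card_image) (auto simp: inj_on_def)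
  finally show ?thesis .
qed

lemma pow2_count_power: "pow2_count (2 ^ k) = k"
  by (rule pow2_count_eq) simp

lemma pow2_count_Suc: "pow2_count (Suc m) = length (nat_bits m)"
  by (rule pow2_count_eq) (simp add: length_nat_bits less_Suc_eq_le)

text \<open>The witness \<open>y\<close> is the power of two with exponent \<open>i\<close>. The
  search can stop at \<open>m\<close>, because every position below the bit length of
  \<open>m\<close> has its power there.\<close>

definition bit_of :: "nat \<Rightarrow> nat \<Rightarrow> bool" where
  "bit_of m i \<longleftrightarrow> (\<exists>y<Suc m. pow2 y \<and> pow2_count y = i \<and> odd (m div y))"

lemma bit_of_iff: "i < length (nat_bits m) \<Longrightarrow> bit_of m i \<longleftrightarrow> nat_bits m ! i"
  unfolding bit_of_def nth_nat_bits
  by (auto simp: pow2_iff pow2_count_power length_nat_bits less_Suc_eq_le)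

lemma d_leading: "0 \<in> T \<Longrightarrow> definable T a \<Longrightarrow> definable T b \<Longrightarrow> definable T (\<lambda>Tb s. leading (Tb 0) (a Tb s) (b Tb s))"
  by (rule d_subst2) (unfold leading_def, intro d_sum d_var p_all_le p_eq d_tab d_add d_const)

lemma p_pow2: "definable T a \<Longrightarrow> dpred T (\<lambda>Tb s. pow2 (a Tb s))"
  by (rule d_subst1[rotated], assumption)
    (unfold pow2_def, intro p_conj p_less d_const d_var p_all_le p_imp p_dvd p_odd p_eq)

lemma d_pow2_count: "definable T a \<Longrightarrow> definable T (\<lambda>Tb s. pow2_count (a Tb s))"
  by (rule d_subst1[rotated], assumption) (unfold pow2_count_def, intro d_sum d_var p_pow2)

lemma p_bit_of: "definable T a \<Longrightarrow> definable T b \<Longrightarrow> dpred T (\<lambda>Tb s. bit_of (a Tb s) (b Tb s))"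
  by (rule d_subst2[rotated], assumption, assumption)
    (unfold bit_of_def, intro p_ex d_Suc d_var p_conj p_pow2 p_eq d_pow2_count p_odd d_div)

text \<open>The query \<open>v = t * (n + 2) + c\<close> asks whether at least \<open>c\<close> of the \<open>n\<close> vertices inform the graph within
  \<open>t\<close> rounds. The certificate contains the calls for each originator \<open>y\<close>.\<close>

definition good_code :: "(nat \<Rightarrow> nat) \<Rightarrow> (nat \<Rightarrow> nat) \<Rightarrow> nat \<Rightarrow> nat \<Rightarrow> nat \<Rightarrow> nat \<Rightarrow> bool" where
  "good_code W U n v t y \<longleftrightarrow> good_calls n (\<lambda>i j. W (v + 1 + (n + 1 + (i * n + j))) = 2) t
     (\<lambda>p q s. U (((y * n + p) * n + q) * n + s) = 2) y"

definition verify_calls :: "(nat \<Rightarrow> nat) \<Rightarrow> (nat \<Rightarrow> nat) \<Rightarrow> nat \<Rightarrow> bool" where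
  "verify_calls W U l \<longleftrightarrow> (let v = leading W 0 l; n = leading W (v + 1) l in
     v div (n + 2) \<le> n \<and> v mod (n + 2) \<le> (\<Sum>y<n. of_bool (good_code W U n v (v div (n + 2)) y)))"

lemma p_good_code:
  assumes "definable {0, 1} a" "definable {0, 1} b" "definable {0, 1} c" "definable {0, 1} d"
  shows "dpred {0, 1} (\<lambda>Tb s. good_code (Tb 0) (Tb 1) (a Tb s) (b Tb s) (c Tb s) (d Tb s))"
proof (rule d_subst4[OF _ assms])
  have t: "0 \<in> {0, 1::nat}" "1 \<in> {0, 1::nat}" by simp_all
  show "dpred {0, 1} (\<lambda>Tb s. good_code (Tb 0) (Tb 1) (s 0) (s (Suc 0)) (s (Suc (Suc 0))) (s (Suc (Suc (Suc 0)))))"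
    unfolding good_code_def good_calls_def informed_def
    by (intro p_conj p_all p_imp p_eq d_tab[OF t(1)] d_tab[OF t(2)] d_add d_mult d_var d_const p_disj p_ex)
qed

lemma p_verify_calls: "dpred {0, 1} (\<lambda>Tb s. verify_calls (Tb 0) (Tb 1) (s 0))"
  unfolding verify_calls_def Let_def
  by (intro p_conj p_le d_div d_mod d_add d_const d_leading d_var d_sum p_good_code insertI1)

text \<open>The exponent 4 pays for one bit per originator, caller, callee and round, each of which
  is less than \<open>n\<close>.\<close>

definition ask_lang :: lang where
  "ask_lang = {w. \<exists>u. length u \<le> length w ^ 4 \<and> verify_calls (cell w) (cell u) (length w)}"

lemma ask_lang_NP: "ask_lang \<in> NP"
proof (rule definable_NP[OF p_verify_calls, of _ "monom 1 4"])
  fix x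
  show "x \<in> ask_lang \<longleftrightarrow> (\<exists>u. length u \<le> poly (monom 1 4) (length x) \<and>
      of_bool (verify_calls (verify_tables x u 0) (verify_tables x u 1) (length x)) \<noteq> (0::nat))"
    by (simp add: ask_lang_def poly_monom verify_tables_def)
qed

lemma cell_query:
  "i < v \<Longrightarrow> cell (query_word v x) i = 2" "cell (query_word v x) v = 1"
  "cell (query_word v x) (v + 1 + i) = cell x i"
proof -
  have q: "query_word v x = (replicate v True @ [False]) @ x" by (simp add: query_word_def)
  show "i < v \<Longrightarrow> cell (query_word v x) i = 2" "cell (query_word v x) v = 1"
    unfolding q by (auto simp: cell_def nth_append)
  show "cell (query_word v x) (v + 1 + i) = cell x i"
    using cell_append_add[of "replicate v True @ [False]" x i] unfolding q by simp
qed

definition reach_count :: "nat \<Rightarrow> nat set set \<Rightarrow> nat \<Rightarrow> nat" where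
  "reach_count n E t = card {y \<in> {0..<n}. (broadcast_round E ^^ t) {y} {0..<n}}"

lemma leading_encode: "leading (cell (encode_instance n E m)) 0 (length (encode_instance n E m)) = n"
  by (rule leading_eq) (auto simp: cell_encode length_encode)

lemma sum_of_bool_card: "(\<Sum>y<n. of_bool (P y)) = card {y \<in> {0..<n}. P y}" for n :: nat
proof -
  have "(\<Sum>y<n. of_bool (P y)) = (\<Sum>y<n. if P y then 1 else 0)" by (intro sum.cong) auto
  also have "\<dots> = card ({..<n} \<inter> {y. P y})" by (subst sum.If_cases) auto
  also have "{..<n} \<inter> {y. P y} = {y \<in> {0..<n}. P y}" by auto
  finally show ?thesis .
qed

text \<open>The base \<open>n + 2\<close> is needed because thresholds up to \<open>n + 1\<close>
  are asked: a center with all \<open>n\<close> vertices is certified by the negative answer for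
  \<open>n + 1\<close>. The condition \<open>t \<le> n\<close> keeps the rounds of a certificate
  below \<open>n\<close>, so that they are digits in base \<open>n\<close>.\<close>

lemma ask_lang_iff:
  assumes "t \<le> n" "c < n + 2"
  shows "query_word (t * (n + 2) + c) (encode_instance n E m) \<in> ask_lang \<longleftrightarrow> c \<le> reach_count n E t"
proof -
  define v where "v = t * (n + 2) + c"
  define x where "x = encode_instance n E m"
  define w where "w = query_word v x"
  define e where "e i j \<longleftrightarrow> cell w (v + 1 + (n + 1 + (i * n + j))) = 2" for i j
  have lw: "length w = v + 1 + length x" by (simp add: w_def query_word_def)
  have e: "e i j \<longleftrightarrow> {i, j} \<in> E" if "i < n" "j < n" for i j
    unfolding e_def w_def cell_query x_def cell_encode(3)[OF that] by simp
  have 1: "leading (cell w) 0 (length w) = v"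
    by (rule leading_eq) (auto simp: w_def cell_query lw[unfolded w_def])
  have 2: "leading (cell w) (v + 1) (length w) = n"
  proof (rule leading_eq)
    show "cell w (v + 1 + j) = 2" if "j < n" for j unfolding w_def cell_query x_def by (rule cell_encode(1)[OF that])
    show "cell w (v + 1 + n) \<noteq> 2" unfolding w_def cell_query x_def by (simp add: cell_encode)
    show "n \<le> length w" unfolding lw x_def by (simp add: length_encode)
  qed
  have vdm: "v div (n + 2) = t" "v mod (n + 2) = c"
  proof -
    define k where "k = n + 2"
    have "c < k" "v = t * k + c" using assms(2) by (simp_all add: k_def v_def)
    then show "v div (n + 2) = t" "v mod (n + 2) = c" unfolding k_def[symmetric] by simp_all
  qed
  have ver: "verify_calls (cell w) (cell u) (length w) \<longleftrightarrow>
      c \<le> card {y \<in> {0..<n}. good_calls n e t (\<lambda>p q s. cell u (((y * n + p) * n + q) * n + s) = 2) y}" for u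
    using assms(1) unfolding verify_calls_def 1 2 Let_def vdm good_code_def e_def[symmetric] sum_of_bool_card by simp
  have "w \<in> ask_lang \<longleftrightarrow> c \<le> reach_count n E t"
  proof
    assume "w \<in> ask_lang"
    then obtain u where "c \<le> card {y \<in> {0..<n}. good_calls n e t (\<lambda>p q s. cell u (((y * n + p) * n + q) * n + s) = 2) y}"
      unfolding ask_lang_def mem_Collect_eq ver by blast
    also have "\<dots> \<le> reach_count n E t" unfolding reach_count_def
      using good_calls_imp_broadcast[of n e E t] e by (intro card_mono) auto
    finally show "c \<le> reach_count n E t" .
  next
    assume c: "c \<le> reach_count n E t"
    have "\<forall>y. \<exists>C. (broadcast_round E ^^ t) {y} {0..<n} \<longrightarrow> good_calls n e t C y"
      using broadcast_imp_good_calls[of n E e t] e by metis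
    then obtain C where C: "\<forall>y. (broadcast_round E ^^ t) {y} {0..<n} \<longrightarrow> good_calls n e t (C y) y" by metis
    define b where "b k = C (k div n div n div n) (k div n div n mod n) (k div n mod n) (k mod n)" for k
    define u where "u = map b [0..<n * n * n * n]"
    have cu: "cell u (((y * n + p) * n + q) * n + s) = 2 \<longleftrightarrow> C y p q s" if "y < n" "p < n" "q < n" "s < n" for y p q s
    proof -
      have lt: "a * n + i < k * n" if "a < k" "i < n" for a i k
      proof -
        have "a * n + i < Suc a * n" using that by simp
        also have "\<dots> \<le> k * n" using that by (intro mult_le_mono) auto
        finally show ?thesis .
      qed
      have "((y * n + p) * n + q) * n + s < n * n * n * n" using that by (intro lt) auto
      then have "cell u (((y * n + p) * n + q) * n + s) = (if b (((y * n + p) * n + q) * n + s) then 2 else 1)"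
        by (simp add: cell_def u_def)
      moreover have "b (((y * n + p) * n + q) * n + s) = C y p q s" using that by (simp add: b_def)
      ultimately show ?thesis by simp
    qed
    have "good_calls n e t (\<lambda>p q s. cell u (((y * n + p) * n + q) * n + s) = 2) y"
      if "y < n" "(broadcast_round E ^^ t) {y} {0..<n}" for y
    proof -
      have "good_calls n e t (\<lambda>p q s. cell u (((y * n + p) * n + q) * n + s) = 2) y = good_calls n e t (C y) y"
        by (rule good_calls_cong) (use cu that(1) assms(1) in auto)
      then show ?thesis using C that by blast
    qed
    then have "reach_count n E t \<le> card {y \<in> {0..<n}. good_calls n e t (\<lambda>p q s. cell u (((y * n + p) * n + q) * n + s) = 2) y}"
      unfolding reach_count_def by (intro card_mono) auto
    with c have "verify_calls (cell w) (cell u) (length w)" unfolding ver by simp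
    moreover have "length u \<le> length w ^ 4"
    proof -
      have "length u = n ^ 4" by (simp add: u_def eval_nat_numeral)
      also have "\<dots> \<le> length w ^ 4" unfolding lw x_def length_encode by (intro power_mono) auto
      finally show ?thesis .
    qed
    ultimately show "w \<in> ask_lang" unfolding ask_lang_def by blast
  qed
  then show ?thesis by (simp add: w_def v_def x_def)
qed

text \<open>In a disconnected graph all broadcast times are infinite, so the center has \<open>n\<close> vertices.\<close>

definition size_test :: "(nat \<Rightarrow> nat) \<Rightarrow> nat \<Rightarrow> nat \<Rightarrow> bool" where
  "size_test Q n m \<longleftrightarrow>
     (\<exists>t\<le>n. Q (t * (n + 2) + 1) = 1 \<and> (\<forall>i<t. Q (i * (n + 2) + 1) = 0) \<and>
        Q (t * (n + 2) + m) = 1 \<and> Q (t * (n + 2) + (m + 1)) = 0) \<or>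
     (\<forall>t\<le>n. Q (t * (n + 2) + 1) = 0) \<and> m = n"

text \<open>Checks a candidate \<open>m\<close> instead of decoding the binary number. The matrix
  has to be symmetric with a false diagonal, so that it comes from a set of two-element
  edges.\<close>

definition instance_test :: "(nat \<Rightarrow> nat) \<Rightarrow> nat \<Rightarrow> nat \<Rightarrow> nat \<Rightarrow> bool" where
  "instance_test X l n m \<longleftrightarrow> l = n + 1 + n * n + pow2_count (Suc m) \<and> X n = 1 \<and>
     (\<forall>i<n. \<forall>j<n. X (n + 1 + (i * n + j)) = X (n + 1 + (j * n + i))) \<and>
     (\<forall>i<n. X (n + 1 + (i * n + i)) = 1) \<and>
     (\<forall>i<pow2_count (Suc m). X (n + 1 + n * n + i) = 2 \<longleftrightarrow> bit_of m i)"

text \<open>The number in the instance may be exponentially large in the input length, but a center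
  has at most \<open>n\<close> vertices, so candidates up to \<open>n\<close> suffice.\<close>

definition bc_test :: "(nat \<Rightarrow> nat) \<Rightarrow> (nat \<Rightarrow> nat) \<Rightarrow> nat \<Rightarrow> bool" where
  "bc_test X Q l \<longleftrightarrow> (\<exists>m\<le>leading X 0 l. instance_test X l (leading X 0 l) m \<and> size_test Q (leading X 0 l) m)"

lemma p_bc_test: "dpred {0, 2} (\<lambda>Tb s. bc_test (Tb 0) (Tb 2) (s 0))"
proof -
  have t: "0 \<in> {0, 2::nat}" "2 \<in> {0, 2::nat}" by simp_all
  have 1: "dpred {0, 2} (\<lambda>Tb s. instance_test (Tb 0) (s 0) (s (Suc 0)) (s (Suc (Suc 0))))"
    unfolding instance_test_def
    by (intro p_conj p_all p_iff p_eq d_tab[OF t(1)] d_add d_mult d_var d_const d_pow2_count d_Suc p_bit_of)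
  have 2: "dpred {0, 2} (\<lambda>Tb s. size_test (Tb 2) (s 0) (s (Suc 0)))"
    unfolding size_test_def
    by (intro p_conj p_disj p_all p_all_le p_ex_le p_eq d_tab[OF t(2)] d_add d_mult d_var d_const)
  show ?thesis unfolding bc_test_def
    by (intro p_ex_le p_conj d_leading d_var d_const t(1) d_subst2[OF 2] d_subst3[OF 1])
qed

lemma leading_cells: "j < leading X s l \<Longrightarrow> X (s + j) = 2"
proof (rule ccontr)
  assume j: "j < leading X s l" and X: "X (s + j) \<noteq> 2"
  have "leading X s l = card {i \<in> {0..<l}. \<forall>j\<le>i. X (s + j) = 2}"
    unfolding leading_def sum_of_bool_card ..
  also have "\<dots> \<le> card {0..<j}"
  proof -
    have "i < j" if "\<forall>k\<le>i. X (s + k) = 2" for i using that X by (meson leI)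
    then show ?thesis by (intro card_mono) auto
  qed
  finally show False using j by simp
qed

lemma size_test_iff:
  assumes "ugraph {0..<n} E" "m \<le> n"
    and Q: "\<And>t c. t \<le> n \<Longrightarrow> c < n + 2 \<Longrightarrow> Q (t * (n + 2) + c) = of_bool (c \<le> reach_count n E t)"
  shows "size_test Q n m \<longleftrightarrow> card (broadcast_center {0..<n} E) = m"
proof -
  let ?N = "reach_count n E"
  let ?R = "\<lambda>t v. (broadcast_round E ^^ t) {v} {0..<n}"
  have Q1: "Q (t * (n + 2) + 1) = of_bool (1 \<le> ?N t)" if "t \<le> n" for t using Q[OF that, of 1] by simp
  have pos: "1 \<le> ?N t \<longleftrightarrow> (\<exists>v\<in>{0..<n}. ?R t v)" for t
    unfolding reach_count_def by (auto simp: Suc_le_eq card_gt_0_iff)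
  show ?thesis
  proof (cases "\<exists>t\<le>n. 1 \<le> ?N t")
    case True
    define t where "t = (LEAST t. 1 \<le> ?N t)"
    have t: "1 \<le> ?N t" "t \<le> n" unfolding t_def using True LeastI_ex[of "\<lambda>t. 1 \<le> ?N t"] Least_le[of "\<lambda>t. 1 \<le> ?N t"]
      by (blast, meson le_trans)
    have less: "\<not> 1 \<le> ?N i" if "i < t" for i using not_less_Least that unfolding t_def by blast
    obtain v0 where v0: "v0 \<in> {0..<n}" "?R t v0" using t(1) pos by blast
    have "broadcast_center {0..<n} E = {v \<in> {0..<n}. ?R t v}"
      by (rule broadcast_center_eq[OF _ v0]) (use less pos in blast)
    then have card: "card (broadcast_center {0..<n} E) = ?N t" by (simp add: reach_count_def)
    have "size_test Q n m \<longleftrightarrow> Q (t * (n + 2) + m) = 1 \<and> Q (t * (n + 2) + (m + 1)) = 0"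
    proof -
      have "i = t" if "i \<le> n" "Q (i * (n + 2) + 1) = 1" "\<forall>k<i. Q (k * (n + 2) + 1) = 0" for i
      proof (rule linorder_cases[of i t])
        assume "i < t" then show ?thesis using Q1[OF that(1)] that(2) less by simp
      next
        assume "t < i" then show ?thesis using Q1[OF t(2)] that(3) t(1) by fastforce
      qed
      moreover have "Q (t * (n + 2) + 1) = 1" using Q1[OF t(2)] t(1) by simp
      moreover have "\<forall>i<t. Q (i * (n + 2) + 1) = 0" using Q1 t(2) less by simp
      ultimately show ?thesis unfolding size_test_def using t(2) by (metis zero_neq_one)
    qed
    also have "\<dots> \<longleftrightarrow> ?N t = m" using Q[OF t(2), of m] Q[OF t(2), of "m + 1"] assms(2) by auto
    finally show ?thesis using card by simp
  next
    case False
    \<comment> \<open>By \<open>broadcast_card\<close> a broadcast in any number of rounds yields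
      one in \<open>n\<close> rounds, so the negative answers for \<open>t \<le> n\<close> rule out
      all times.\<close>
    have "\<not> ?R t v" if "v \<in> {0..<n}" for v t
    proof
      assume "?R t v"
      from broadcast_card[OF this that] have "?R n v" by simp
      then have "1 \<le> ?N n" using pos that by blast
      then show False using False by blast
    qed
    then have "broadcast_center {0..<n} E = {0..<n}" by (rule broadcast_center_unreachable)
    moreover have "\<forall>t\<le>n. Q (t * (n + 2) + 1) = 0" using Q1 False by simp
    ultimately show ?thesis unfolding size_test_def by auto
  qed
qed

lemma center_card_le: "card (broadcast_center {0..<n::nat} E) \<le> n"
proof -
  have "card (broadcast_center {0..<n} E) \<le> card {0..<n}"
    by (rule card_mono) (auto simp: broadcast_center_def)
  then show ?thesis by simp
qed

lemma instance_test_encode: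
  assumes "ugraph {0..<n} E"
  shows "instance_test (cell (encode_instance n E m)) (length (encode_instance n E m)) n m"
  unfolding instance_test_def
proof (intro conjI allI impI)
  fix i assume i: "i < n"
  have "{i, i} \<notin> E" using assms by (force simp: ugraph_def)
  then show "cell (encode_instance n E m) (n + 1 + (i * n + i)) = 1" using cell_encode(3)[OF i i] by simp
  fix j assume j: "j < n"
  show "cell (encode_instance n E m) (n + 1 + (i * n + j)) = cell (encode_instance n E m) (n + 1 + (j * n + i))"
    unfolding cell_encode(3)[OF i j] cell_encode(3)[OF j i] by (simp add: insert_commute)
next
  fix i assume "i < pow2_count (Suc m)"
  then show "cell (encode_instance n E m) (n + 1 + n * n + i) = 2 \<longleftrightarrow> bit_of m i"
    unfolding cell_encode(4) by (simp add: pow2_count_Suc bit_of_iff cell_def)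
qed (simp_all add: cell_encode length_encode pow2_count_Suc)

lemma instance_test_decode:
  assumes t: "instance_test (cell x) (length x) n m" and n: "leading (cell x) 0 (length x) = n"
  obtains E where "ugraph {0..<n} E" "x = encode_instance n E m"
proof -
  let ?X = "cell x"
  let ?a = "\<lambda>i j. n + 1 + (i * n + j)"
  define E where "E = {{i, j} | i j. i < n \<and> j < n \<and> ?X (?a i j) = 2}"
  have sym: "?X (?a i j) = ?X (?a j i)" if "i < n" "j < n" for i j
    using t that unfolding instance_test_def by blast
  have diag: "?X (?a i i) = 1" if "i < n" for i
    using t that unfolding instance_test_def by blast
  have len: "length x = n + 1 + n * n + length (nat_bits m)"
    using t unfolding instance_test_def pow2_count_Suc by blast
  have E: "{i, j} \<in> E \<longleftrightarrow> ?X (?a i j) = 2" if "i < n" "j < n" for i j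
  proof
    assume "{i, j} \<in> E"
    then obtain i' j' where *: "{i, j} = {i', j'}" "i' < n" "j' < n" "?X (?a i' j') = 2" unfolding E_def by blast
    then have "i = i' \<and> j = j' \<or> i = j' \<and> j = i'" by (simp add: doubleton_eq_iff)
    then show "?X (?a i j) = 2" using * sym by auto
  qed (use that in \<open>auto simp: E_def\<close>)
  have "ugraph {0..<n} E"
    unfolding ugraph_def
  proof (intro conjI ballI)
    fix e assume "e \<in> E"
    then obtain i j where *: "e = {i, j}" "i < n" "j < n" "?X (?a i j) = 2" unfolding E_def by blast
    then have "i \<noteq> j" using diag[of i] by auto
    then show "e \<subseteq> {0..<n}" "card e = 2" using * by auto
  qed simp
  moreover have "x = encode_instance n E m"
  proof (rule cell_inj)
    show "length x = length (encode_instance n E m)" by (simp add: len length_encode)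
    fix k assume k: "k < length x"
    then have b: "?X k = 1 \<or> ?X k = 2" by (simp add: cell_def)
    consider "k < n" | "k = n" | "n < k" "k < n + 1 + n * n" | "n + 1 + n * n \<le> k" by linarith
    then show "?X k = cell (encode_instance n E m) k"
    proof cases
      case 1
      then show ?thesis using leading_cells[of k ?X 0 "length x"] n cell_encode(1) by simp
    next
      case 2
      then show ?thesis using t cell_encode(2) unfolding instance_test_def by simp
    next
      case 3
      define i j where "i = (k - n - 1) div n" and "j = (k - n - 1) mod n"
      have kn: "k - n - 1 < n * n" "0 < n" using 3 by (auto intro: ccontr)
      have ij: "i < n" "j < n" using kn by (auto simp: i_def j_def less_mult_imp_div_less)
      have "k = ?a i j" using 3 by (simp add: i_def j_def)
      then show ?thesis using E[OF ij] cell_encode(3)[OF ij] b by auto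
    next
      case 4
      then obtain i where i: "k = n + 1 + n * n + i" using le_Suc_ex by blast
      then have il: "i < length (nat_bits m)" using k len by simp
      then have "?X k = 2 \<longleftrightarrow> nat_bits m ! i"
        using t bit_of_iff[OF il] unfolding instance_test_def pow2_count_Suc i by blast
      then show ?thesis using b il unfolding i cell_encode(4) by (auto simp: cell_def[of "nat_bits m"])
    qed
  qed
  ultimately show thesis by (rule that)
qed

lemma bc_test_iff:
  "x \<in> BC_Size \<longleftrightarrow> bc_test (cell x) (\<lambda>v. of_bool (query_word v x \<in> ask_lang)) (length x)"
proof
  assume "x \<in> BC_Size"
  then obtain n E m where x: "x = encode_instance n E m" and g: "ugraph {0..<n} E"
    and m: "card (broadcast_center {0..<n} E) = m" unfolding BC_Size_def by blast
  have "m \<le> n" using center_card_le[of n E] m by simp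
  moreover have "size_test (\<lambda>v. of_bool (query_word v x \<in> ask_lang)) n m"
    using m unfolding x by (subst size_test_iff[OF g \<open>m \<le> n\<close>]) (use ask_lang_iff in auto)
  ultimately show "bc_test (cell x) (\<lambda>v. of_bool (query_word v x \<in> ask_lang)) (length x)"
    unfolding bc_test_def x leading_encode using instance_test_encode[OF g] by blast
next
  assume "bc_test (cell x) (\<lambda>v. of_bool (query_word v x \<in> ask_lang)) (length x)"
  then obtain m where m: "m \<le> leading (cell x) 0 (length x)"
    "instance_test (cell x) (length x) (leading (cell x) 0 (length x)) m"
    "size_test (\<lambda>v. of_bool (query_word v x \<in> ask_lang)) (leading (cell x) 0 (length x)) m"
    unfolding bc_test_def by blast
  define n where "n = leading (cell x) 0 (length x)"
  obtain E where E: "ugraph {0..<n} E" "x = encode_instance n E m"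
    using instance_test_decode[OF m(2)] n_def by blast
  have "card (broadcast_center {0..<n} E) = m"
    using m(3)[folded n_def] unfolding E(2)
    by (subst (asm) size_test_iff[OF E(1) m(1)[folded n_def]]) (use ask_lang_iff in auto)
  then show "x \<in> BC_Size" unfolding BC_Size_def using E by blast
qed

theorem BC_Size_Delta2P: "BC_Size \<in> Delta2P"
proof -
  have "BC_Size \<in> P_oracle ask_lang"
    by (rule definable_P_oracle[OF p_bc_test]) (simp add: bc_test_iff ask_tables_def)
  then show ?thesis unfolding Delta2P_def using ask_lang_NP by blast
qed

section \<open>The gadget\<close>

datatype vert = R | T nat | S nat | El nat | Cl nat | Tl nat nat | Pa nat nat nat

text \<open>The root \<open>R\<close> is adjacent to all elements. The elements 0 to 3 are the special ones; the element
  \<open>4 + 2 * i + b\<close> is the literal that gives the value \<open>b\<close> to the variable \<open>i < B\<close>. A path of \<open>B + 1\<close>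
  vertices \<open>Pa e c k\<close> starts from every clause \<open>c\<close> for every element \<open>e\<close> and leads to \<open>e\<close> if \<open>e\<close> occurs
  in \<open>c\<close>. Clause 0 consists of the special elements, clause \<open>i + 1\<close> of the two literals of the variable
  \<open>i < B\<close>, and clause \<open>B + 1 + j\<close> is the clause \<open>j\<close> of the formula. The tails \<open>T\<close>, \<open>S\<close> and \<open>Tl c\<close> act as deadlines for \<open>R\<close>, clause 0
  and clause \<open>c\<close>.\<close>

locale gadget =
  fixes B nF m :: nat and hits lit :: "nat \<Rightarrow> nat \<Rightarrow> bool"
  assumes size: "m + nF + 1 \<le> B"
    and lit_bound: "\<And>j i b. b < 2 \<Longrightarrow> lit j (2 * i + b) \<Longrightarrow> i < m"
begin

definition inc :: "nat \<Rightarrow> nat \<Rightarrow> bool" where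
  "inc e c \<longleftrightarrow> (if c = 0 then e < 4 else if c \<le> B then e = 2 * c + 2 \<or> e = 2 * c + 3
     else if e < 4 then hits e (c - B - 1) else lit (c - B - 1) (e - 4))"

fun vtx :: "vert \<Rightarrow> bool" where
  "vtx R \<longleftrightarrow> True"
| "vtx (T k) \<longleftrightarrow> k < 5 * B + 9"
| "vtx (S k) \<longleftrightarrow> k < 4 * B + 7"
| "vtx (El e) \<longleftrightarrow> e < 2 * B + 4"
| "vtx (Cl c) \<longleftrightarrow> c < B + 1 + nF"
| "vtx (Tl c k) \<longleftrightarrow> c < B + 1 + nF \<and> k < 3 * B + 6"
| "vtx (Pa e c k) \<longleftrightarrow> e < 2 * B + 4 \<and> c < B + 1 + nF \<and> k < B + 1"

fun arc :: "vert \<Rightarrow> vert \<Rightarrow> bool" where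
  "arc R (T k) \<longleftrightarrow> k = 0"
| "arc R (El e) \<longleftrightarrow> True"
| "arc (T k) (T k') \<longleftrightarrow> k' = Suc k"
| "arc (S k) (S k') \<longleftrightarrow> k' = Suc k"
| "arc (Cl c) (S k) \<longleftrightarrow> c = 0 \<and> k = 0"
| "arc (Cl c) (Tl c' k) \<longleftrightarrow> c' = c \<and> k = 0"
| "arc (Cl c) (Pa e c' k) \<longleftrightarrow> c' = c \<and> k = 0"
| "arc (Tl c k) (Tl c' k') \<longleftrightarrow> c' = c \<and> k' = Suc k"
| "arc (Pa e c k) (Pa e' c' k') \<longleftrightarrow> e' = e \<and> c' = c \<and> k' = Suc k"
| "arc (Pa e c k) (El e') \<longleftrightarrow> e' = e \<and> k = B \<and> inc e c"
| "arc _ _ \<longleftrightarrow> False"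

definition V :: "vert set" where "V = {v. vtx v}"

definition E :: "vert set set" where "E = {{u, v} | u v. vtx u \<and> vtx v \<and> arc u v}"

definition nbr :: "vert \<Rightarrow> vert \<Rightarrow> bool" where
  "nbr u v \<longleftrightarrow> vtx u \<and> vtx v \<and> (arc u v \<or> arc v u)"

lemma E_iff: "{u, v} \<in> E \<longleftrightarrow> nbr u v"
  unfolding E_def nbr_def by (auto simp: doubleton_eq_iff)

text \<open>This is the last time that occurs in the scheme below: a clause is informed by round
  \<open>2 * B + 4\<close>, calls its path to the element \<open>2 * B + 3\<close> another
  \<open>3 + (2 * B + 3)\<close> rounds later, and \<open>B\<close> more rounds reach the end of
  this path. The lengths of the tails are adjusted to it.\<close>

definition D :: nat where "D = 5 * B + 10"

definition sat :: "nat \<Rightarrow> bool" where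
  "sat u \<longleftrightarrow> (\<exists>a :: nat \<Rightarrow> bool. \<forall>j<nF. hits u j \<or> (\<exists>i<B. lit j (2 * i + of_bool (a i))))"

lemma in_V: "v \<in> V \<longleftrightarrow> vtx v"
  by (simp add: V_def)

lemma finite_V: "finite V"
proof -
  have "V \<subseteq> {R} \<union> T ` {..<5 * B + 9} \<union> S ` {..<4 * B + 7} \<union> El ` {..<2 * B + 4} \<union> Cl ` {..<B + 1 + nF} \<union>
      (\<lambda>(c, k). Tl c k) ` ({..<B + 1 + nF} \<times> {..<3 * B + 6}) \<union>
      (\<lambda>(e, c, k). Pa e c k) ` ({..<2 * B + 4} \<times> {..<B + 1 + nF} \<times> {..<B + 1})"
  proof
    fix v assume "v \<in> V"
    then show "v \<in> {R} \<union> T ` {..<5 * B + 9} \<union> S ` {..<4 * B + 7} \<union> El ` {..<2 * B + 4} \<union> Cl ` {..<B + 1 + nF} \<union>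
      (\<lambda>(c, k). Tl c k) ` ({..<B + 1 + nF} \<times> {..<3 * B + 6}) \<union>
      (\<lambda>(e, c, k). Pa e c k) ` ({..<2 * B + 4} \<times> {..<B + 1 + nF} \<times> {..<B + 1})"
      by (cases v) (auto simp: V_def image_iff)
  qed
  then show ?thesis by (rule finite_subset) auto
qed

lemma E_ugraph: "ugraph V E"
proof -
  have "\<not> arc u u" for u by (cases u) auto
  then show ?thesis unfolding ugraph_def E_def using finite_V by (auto simp: V_def card_insert_if)
qed

subsection \<open>Necessary conditions\<close>

context
  fixes v0 :: vert and t :: nat and ti :: "vert \<Rightarrow> nat" and par :: "vert \<Rightarrow> vert"
  assumes sched: "schedule V E v0 t ti par" and v0: "vtx v0"
begin

lemma ti_le: "vtx v \<Longrightarrow> ti v \<le> t"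
  using sched by (simp add: schedule_def in_V)

lemma par: "vtx v \<Longrightarrow> v \<noteq> v0 \<Longrightarrow> nbr (par v) v" "vtx v \<Longrightarrow> v \<noteq> v0 \<Longrightarrow> ti (par v) < ti v"
  using sched by (simp_all add: schedule_def in_V E_iff)

lemma par_inj: "vtx v \<Longrightarrow> vtx w \<Longrightarrow> v \<noteq> v0 \<Longrightarrow> w \<noteq> v0 \<Longrightarrow> par v = par w \<Longrightarrow> ti v = ti w \<Longrightarrow> v = w"
  using sched unfolding schedule_def in_V[symmetric] by blast

text \<open>Information crosses at most one edge per round, and \<open>\<phi>\<close> changes by at
  most 1 along an edge. Applied to the end of a tail, where \<open>\<phi>\<close> vanishes, this
  bounds the time from below without computing any distances in the graph.\<close>

lemma potential:
  assumes lip: "\<And>u v. vtx u \<Longrightarrow> vtx v \<Longrightarrow> arc u v \<Longrightarrow> \<phi> u \<le> \<phi> v + 1 \<and> \<phi> v \<le> \<phi> u + (1::nat)"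
    and v: "vtx v"
  shows "\<phi> v0 \<le> \<phi> v + ti v"
  using v
proof (induction "ti v" arbitrary: v rule: less_induct)
  case less
  show ?case
  proof (cases "v = v0")
    case False
    have p: "nbr (par v) v" "ti (par v) < ti v" using par[OF less.prems False] by auto
    then have "\<phi> v0 \<le> \<phi> (par v) + ti (par v)" using less.hyps[OF p(2)] by (simp add: nbr_def)
    moreover have "\<phi> (par v) \<le> \<phi> v + 1" using lip p(1) by (auto simp: nbr_def)
    ultimately show ?thesis using p(2) by linarith
  qed simp
qed

text \<open>Truncated distances to the ends of the tails \<open>T\<close> and \<open>S\<close>.\<close>

fun \<phi>1 :: "vert \<Rightarrow> nat" where
  "\<phi>1 (T k) = 5 * B + 8 - k"
| "\<phi>1 R = 5 * B + 9"
| "\<phi>1 (El e) = 5 * B + 10"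
| "\<phi>1 _ = 5 * B + 11"

fun \<phi>2 :: "vert \<Rightarrow> nat" where
  "\<phi>2 (T k) = 5 * B + 11"
| "\<phi>2 R = 5 * B + 10"
| "\<phi>2 (El e) = (if e < 4 then 5 * B + 9 else 5 * B + 11)"
| "\<phi>2 (S k) = 4 * B + 6 - k"
| "\<phi>2 (Cl c) = (if c = 0 then 4 * B + 7 else 5 * B + 10)"
| "\<phi>2 (Tl c k) = (if c = 0 then 4 * B + 8 else 5 * B + 10)"
| "\<phi>2 (Pa e c k) = (if c = 0 then 4 * B + 8 + k else 5 * B + 10)"

lemma phi1: "\<phi>1 v0 \<le> t"
proof -
  have "\<phi>1 u \<le> \<phi>1 v + 1 \<and> \<phi>1 v \<le> \<phi>1 u + 1" if "vtx u" "vtx v" "arc u v" for u v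
    using that by (cases u; cases v) auto
  from potential[of \<phi>1 "T (5 * B + 8)", OF this] ti_le[of "T (5 * B + 8)"] show ?thesis by simp
qed

lemma phi2: "\<phi>2 v0 \<le> t"
proof -
  have "\<phi>2 u \<le> \<phi>2 v + 1 \<and> \<phi>2 v \<le> \<phi>2 u + 1" if "vtx u" "vtx v" "arc u v" for u v
    using that by (cases u; cases v) (auto simp: inc_def)
  from potential[of \<phi>2 "S (4 * B + 6)", OF this] ti_le[of "S (4 * B + 6)"] show ?thesis by simp
qed

lemma t_ge: "D \<le> t"
  using phi1 phi2 by (cases v0) (auto simp: D_def split: if_splits)

text \<open>The value \<open>5 * B + 11\<close> exceeds the deadline: \<open>\<phi>1\<close> takes
  it on the clauses, their paths and tails and on \<open>S\<close>, and \<open>\<phi>2\<close> takes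
  it on \<open>T\<close> and on the literals.\<close>

lemma v0_cases: "t = D \<Longrightarrow> v0 = R \<or> (\<exists>u<4. v0 = El u)"
  using phi1 phi2 by (cases v0) (auto simp: D_def split: if_splits)

text \<open>A tail is a dead end, so it is informed from its inner end \<open>a\<close>. The
  induction runs from the outer end inwards: a vertex called by its outer neighbor would have to be
  earlier and later than that neighbor, whose parent is already known.\<close>

lemma pendant:
  assumes q: "\<And>k. k < L \<Longrightarrow> vtx (q k) \<and> q k \<noteq> v0"
    and nb: "\<And>k u. k < L \<Longrightarrow> nbr u (q k) \<Longrightarrow> (Suc k < L \<and> u = q (Suc k)) \<or> u = (if k = 0 then a else q (k - 1))"
    and k: "k < L"
  shows "par (q k) = (if k = 0 then a else q (k - 1)) \<and> ti (q 0) + k \<le> ti (q k)"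
proof -
  have pk: "par (q k) = (if k = 0 then a else q (k - 1))" if "k < L" for k
    using that
  proof (induction "L - k" arbitrary: k rule: less_induct)
    case less
    have p: "nbr (par (q k)) (q k)" "ti (par (q k)) < ti (q k)" using par q less.prems by auto
    show ?case
    proof (rule ccontr)
      assume n: "par (q k) \<noteq> (if k = 0 then a else q (k - 1))"
      then have s: "Suc k < L" "par (q k) = q (Suc k)" using nb[OF less.prems p(1)] by auto
      have "par (q (Suc k)) = q k" using less.hyps[of "Suc k"] s less.prems by simp
      moreover have "ti (par (q (Suc k))) < ti (q (Suc k))" using par q s by auto
      ultimately show False using p(2) s by simp
    qed
  qed
  have "ti (q 0) + k \<le> ti (q k)" if "k < L" for k
    using that
  proof (induction k)
    case (Suc k)
    have "ti (par (q (Suc k))) < ti (q (Suc k))" using par q Suc.prems by auto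
    then show ?case using Suc pk[OF Suc.prems] by simp
  qed simp
  with pk k show ?thesis by blast
qed

text \<open>If the end \<open>q 0\<close> of a path was called by its neighbor, the signal passed
  through the whole path: \<open>q k\<close> precedes the vertex \<open>q (k - 1)\<close> that it
  called, so its own parent can only be the next vertex.\<close>

lemma chain:
  assumes q: "\<And>k. 0 < k \<Longrightarrow> k < L \<Longrightarrow> vtx (q k) \<and> q k \<noteq> v0"
    and nb: "\<And>k u. 0 < k \<Longrightarrow> k < L \<Longrightarrow> nbr u (q k) \<Longrightarrow> u = q (k - 1) \<or> u = q (Suc k)"
    and q0: "vtx (q 0)" "q 0 \<noteq> v0" "par (q 0) = q 1"
    and k: "k < L"
  shows "par (q k) = q (Suc k) \<and> ti (q (Suc k)) + Suc k \<le> ti (q 0)"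
  using k
proof (induction k)
  case 0
  then show ?case using q0 par(2)[OF q0(1,2)] by simp
next
  case (Suc k)
  then have IH: "par (q k) = q (Suc k)" "ti (q (Suc k)) + Suc k \<le> ti (q 0)" by auto
  have v: "vtx (q k)" "q k \<noteq> v0" using q0 q[of k] Suc.prems by (cases k; simp)+
  have v': "vtx (q (Suc k))" "q (Suc k) \<noteq> v0" using q Suc.prems by auto
  have l: "ti (q (Suc k)) < ti (q k)" using par(2)[OF v] IH by simp
  have p: "nbr (par (q (Suc k))) (q (Suc k))" "ti (par (q (Suc k))) < ti (q (Suc k))" using par[OF v'] by auto
  then have "par (q (Suc k)) \<noteq> q k" using l by auto
  then have "par (q (Suc k)) = q (Suc (Suc k))" using nb[of "Suc k"] p(1) Suc.prems by auto
  then show ?case using p(2) IH by simp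
qed

end

lemma schedule_imp_sat:
  assumes sched: "schedule V E (El u) D ti par" and u: "u < 4"
  shows "sat u"
proof -
  have v0: "vtx (El u)" using u by simp
  note par = par[OF sched v0] and par_inj = par_inj[OF sched v0] and ti_le = ti_le[OF sched v0]
    and pendant = pendant[OF sched v0] and chain = chain[OF sched v0]
  have T: "par (T k) = (if k = 0 then R else T (k - 1)) \<and> ti (T 0) + k \<le> ti (T k)" if "k < 5 * B + 9" for k
  proof (rule pendant[where L = "5 * B + 9" and q = T])
    fix k w assume "k < 5 * B + 9" "nbr w (T k)"
    then show "(Suc k < 5 * B + 9 \<and> w = T (Suc k)) \<or> w = (if k = 0 then R else T (k - 1))"
      by (cases w) (auto simp: nbr_def)
  qed (use that in auto)
  \<comment> \<open>The tail \<open>T\<close> has \<open>D - 1\<close> vertices. As the root is not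
    the originator, its call from \<open>El u\<close> in round 1 and its call to \<open>T 0\<close>
    in round 2 are forced.\<close>
  have "ti (T 0) \<le> 2" using T[of "5 * B + 8"] ti_le[of "T (5 * B + 8)"] by (simp add: D_def)
  moreover have "0 < ti R" using par(2)[of R] by simp
  moreover have "ti R < ti (T 0)" using par(2)[of "T 0"] T[of 0] by simp
  ultimately have tR: "ti R = 1" "ti (T 0) = 2" by simp_all
  have S: "par (S 0) = Cl 0"
  proof -
    have "par (S 0) = (if (0::nat) = 0 then Cl 0 else S (0 - 1)) \<and> ti (S 0) + 0 \<le> ti (S 0)"
    proof (rule pendant[where L = "4 * B + 7" and q = S])
      fix k w assume "k < 4 * B + 7" "nbr w (S k)"
      then show "(Suc k < 4 * B + 7 \<and> w = S (Suc k)) \<or> w = (if k = 0 then Cl 0 else S (k - 1))"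
        by (cases w) (auto simp: nbr_def)
    qed auto
    then show ?thesis by simp
  qed
  have Tl: "par (Tl c k) = (if k = 0 then Cl c else Tl c (k - 1)) \<and> ti (Tl c 0) + k \<le> ti (Tl c k)"
    if "c < B + 1 + nF" "k < 3 * B + 6" for c k
  proof (rule pendant[where L = "3 * B + 6" and q = "Tl c"])
    fix k w assume "k < 3 * B + 6" "nbr w (Tl c k)"
    then show "(Suc k < 3 * B + 6 \<and> w = Tl c (Suc k)) \<or> w = (if k = 0 then Cl c else Tl c (k - 1))"
      by (cases w) (auto simp: nbr_def)
  qed (use that in auto)
  have hit: "\<exists>e<2 * B + 4. inc e c \<and> ti (El e) \<le> B + 2 \<and> (e = u \<or> par (El e) = R \<and> 3 \<le> ti (El e))"
    if c: "c < B + 1 + nF" for c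
  proof -
    have "par (Tl c 0) = Cl c" using Tl[OF c, of 0] by simp
    then have 1: "ti (Cl c) < ti (Tl c 0)" using par(2)[of "Tl c 0"] c by simp
    \<comment> \<open>The \<open>3 * B + 6\<close> vertices of the tail leave the clause time until
      \<open>2 * B + 4\<close>, and the path in front of it takes \<open>B + 2\<close> rounds of
      that.\<close>
    have "ti (Tl c 0) \<le> 2 * B + 5"
      using Tl[OF c, of "3 * B + 5"] ti_le[of "Tl c (3 * B + 5)"] c by (simp add: D_def)
    with 1 have d: "ti (Cl c) \<le> 2 * B + 4" by simp
    have p: "nbr (par (Cl c)) (Cl c)" "ti (par (Cl c)) < ti (Cl c)" using par[of "Cl c"] c by auto
    have "par (Cl c) \<noteq> Tl c 0" using 1 p(2) by auto
    moreover have "c = 0 \<Longrightarrow> par (Cl c) \<noteq> S 0" using S p(2) par(2)[of "S 0"] by auto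
    ultimately obtain e where e: "par (Cl c) = Pa e c 0" "e < 2 * B + 4"
      using p(1) by (cases "par (Cl c)") (auto simp: nbr_def)
    define q where "q k = (if k = 0 then Cl c else if k < B + 2 then Pa e c (k - 1) else El e)" for k
    have q: "par (q (B + 1)) = q (Suc (B + 1)) \<and> ti (q (Suc (B + 1))) + Suc (B + 1) \<le> ti (q 0)"
    proof (rule chain[where L = "B + 2"])
      show "0 < k \<Longrightarrow> k < B + 2 \<Longrightarrow> vtx (q k) \<and> q k \<noteq> El u" for k using c e by (auto simp: q_def)
      show "w = q (k - 1) \<or> w = q (Suc k)" if "0 < k" "k < B + 2" "nbr w (q k)" for k w
        using that by (cases w) (auto simp: q_def nbr_def)
    qed (use c e in \<open>auto simp: q_def\<close>)
    then have pa: "par (Pa e c B) = El e" "ti (El e) + (B + 2) \<le> ti (Cl c)" by (simp_all add: q_def)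
    then have ie: "inc e c" using par(1)[of "Pa e c B"] c e by (simp add: nbr_def)
    have te: "ti (El e) \<le> B + 2" using pa d by simp
    \<comment> \<open>The only alternative is a signal that travels back from a clause. No clause is
      informed before round 1, so it would arrive in round \<open>B + 3\<close> or later.\<close>
    have "par (El e) = R" if ne: "e \<noteq> u"
    proof (rule ccontr)
      assume n: "par (El e) \<noteq> R"
      have "nbr (par (El e)) (El e)" using par(1)[of "El e"] e ne by simp
      with n obtain c' where c': "par (El e) = Pa e c' B" "c' < B + 1 + nF"
        by (cases "par (El e)") (auto simp: nbr_def)
      define q where "q k = (if k = 0 then El e else if k < B + 2 then Pa e c' (B + 1 - k) else Cl c')" for k
      have q: "par (q (B + 1)) = q (Suc (B + 1)) \<and> ti (q (Suc (B + 1))) + Suc (B + 1) \<le> ti (q 0)"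
      proof (rule chain[where L = "B + 2"])
        show "0 < k \<Longrightarrow> k < B + 2 \<Longrightarrow> vtx (q k) \<and> q k \<noteq> El u" for k using c' e by (auto simp: q_def)
        show "w = q (k - 1) \<or> w = q (Suc k)" if "0 < k" "k < B + 2" "nbr w (q k)" for k w
          using that by (cases w) (auto simp: q_def nbr_def)
      qed (use c' e ne in \<open>auto simp: q_def\<close>)
      then have "ti (Cl c') + (B + 2) \<le> ti (El e)" by (simp add: q_def)
      moreover have "0 < ti (Cl c')" using par(2)[of "Cl c'"] c' by simp
      ultimately show False using te by simp
    qed
    moreover have "3 \<le> ti (El e)" if "e \<noteq> u" "par (El e) = R"
    proof -
      have "ti R < ti (El e)" using par(2)[of "El e"] e that by simp
      moreover have "ti (El e) \<noteq> 2" using par_inj[of "El e" "T 0"] tR T[of 0] e that by auto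
      ultimately show ?thesis using tR by simp
    qed
    ultimately show ?thesis using e ie te by blast
  qed
  have "\<exists>e. (e = 2 * i + 4 \<or> e = 2 * i + 5) \<and> ti (El e) \<le> B + 2 \<and> par (El e) = R \<and> 3 \<le> ti (El e)" if i: "i < B" for i
  proof -
    obtain e where e: "inc e (Suc i)" "ti (El e) \<le> B + 2" "e = u \<or> par (El e) = R \<and> 3 \<le> ti (El e)"
      using hit[of "Suc i"] i by auto
    then have e': "e = 2 * i + 4 \<or> e = 2 * i + 5" using i by (auto simp: inc_def)
    then have "e \<noteq> u" using u by auto
    then show ?thesis using e e' by blast
  qed
  then obtain h where h: "\<And>i. i < B \<Longrightarrow> h i = 2 * i + 4 \<or> h i = 2 * i + 5"
    "\<And>i. i < B \<Longrightarrow> ti (El (h i)) \<le> B + 2 \<and> par (El (h i)) = R \<and> 3 \<le> ti (El (h i))" by metis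
  have hv: "vtx (El (h i)) \<and> El (h i) \<noteq> El u" if "i < B" for i using h(1)[OF that] that u by auto
  have inj: "inj_on (\<lambda>i. ti (El (h i))) {..<B}"
  proof (rule inj_onI)
    fix i j assume ij: "i \<in> {..<B}" "j \<in> {..<B}" "ti (El (h i)) = ti (El (h j))"
    then have "El (h i) = El (h j)" using par_inj[of "El (h i)" "El (h j)"] hv h(2) by simp
    then show "i = j" using h(1)[of i] h(1)[of j] ij by auto
  qed
  \<comment> \<open>The \<open>B\<close> literals have different call times in an interval of
    \<open>B\<close> rounds, so they exhaust it. Any other element called by the root in these
    rounds coincides with one of them, which excludes both values for one variable.\<close>
  have img: "(\<lambda>i. ti (El (h i))) ` {..<B} = {3..B + 2}"
  proof (rule card_subset_eq)
    show "(\<lambda>i. ti (El (h i))) ` {..<B} \<subseteq> {3..B + 2}" using h(2) by auto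
    show "card ((\<lambda>i. ti (El (h i))) ` {..<B}) = card {3..B + 2}" by (simp add: card_image[OF inj])
  qed simp
  define a where "a i \<longleftrightarrow> h i = 2 * i + 5" for i
  have ha: "h i = 4 + (2 * i + of_bool (a i))" if "i < B" for i using h(1)[OF that] by (auto simp: a_def)
  have "hits u j \<or> (\<exists>i<B. lit j (2 * i + of_bool (a i)))" if j: "j < nF" for j
  proof -
    obtain e where e: "e < 2 * B + 4" "inc e (B + 1 + j)" "ti (El e) \<le> B + 2" "e = u \<or> par (El e) = R \<and> 3 \<le> ti (El e)"
      using hit[of "B + 1 + j"] j by auto
    show ?thesis
    proof (cases "e = u")
      case True
      then show ?thesis using e(2) u by (simp add: inc_def)
    next
      case False
      then have "ti (El e) \<in> (\<lambda>i. ti (El (h i))) ` {..<B}" unfolding img using e by simp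
      then obtain i where i: "i < B" "ti (El e) = ti (El (h i))" by auto
      then have "e = h i" using par_inj[of "El e" "El (h i)"] hv[OF i(1)] h(2)[OF i(1)] e False by simp
      then show ?thesis using e(2) i(1) ha[OF i(1)] by (auto simp: inc_def)
    qed
  qed
  then show ?thesis unfolding sat_def by blast
qed

subsection \<open>A broadcast scheme\<close>

text \<open>The originator is \<open>R\<close> if \<open>z = 0\<close> and \<open>El u\<close> if \<open>z = 1\<close>. The root calls the chosen literal of the
  variable \<open>i\<close> at time \<open>3 + i\<close>, and \<open>rep c\<close> is the element that informs the clause \<open>c\<close>.\<close>

context
  fixes u :: nat and z :: nat and a :: "nat \<Rightarrow> bool" and pick :: "nat \<Rightarrow> nat"
  assumes u: "u < 4" and z: "z \<le> 1"
    and pick: "\<And>j. j < nF \<Longrightarrow> hits u j \<or> (pick j < B \<and> lit j (2 * pick j + of_bool (a (pick j))))"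
begin

definition ch :: "nat \<Rightarrow> nat" where "ch i = 2 * i + 4 + of_bool (a i)"

definition rep :: "nat \<Rightarrow> nat" where
  "rep c = (if c = 0 then u else if c \<le> B then ch (c - 1) else if hits u (c - B - 1) then u else ch (pick (c - B - 1)))"

text \<open>From this time on the element serves its clauses, with the first call in round
  \<open>st e + 1\<close>.\<close>

definition st :: "nat \<Rightarrow> nat" where "st e = (if e < 4 then 1 else 3 + (e - 4) div 2)"

text \<open>Subtraction is truncated: the delay \<open>c - B\<close> is 0 for clause 0 and for the
  clauses of the variables and \<open>j + 1\<close> for clause \<open>j\<close> of the formula. An
  element represents at most one clause of the first kind, so its calls to the paths never
  coincide.\<close>

definition tc :: "nat \<Rightarrow> nat" where "tc c = st (rep c) + (c - B) + B + 2"

fun tm' :: "vert \<Rightarrow> nat" where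
  "tm' R = z"
| "tm' (T k) = 2 + k"
| "tm' (S k) = B + 4 + k"
| "tm' (El e) = (if e = u then 1 - z else if e < 4 then B + 3 + e
     else if e = ch ((e - 4) div 2) then st e else B + 3 + e)"
| "tm' (Cl c) = tc c"
| "tm' (Tl c k) = tc c + 1 + k + of_bool (c = 0)"
| "tm' (Pa e c k) = (if e = rep c then st e + 1 + (c - B) + (B - k) else tc c + 3 + e + k)"

fun par' :: "vert \<Rightarrow> vert" where
  "par' R = El u"
| "par' (T k) = (if k = 0 then R else T (k - 1))"
| "par' (S k) = (if k = 0 then Cl 0 else S (k - 1))"
| "par' (El e) = R"
| "par' (Cl c) = Pa (rep c) c 0"
| "par' (Tl c k) = (if k = 0 then Cl c else Tl c (k - 1))"
| "par' (Pa e c k) = (if e = rep c then if k = B then El e else Pa e c (Suc k) else if k = 0 then Cl c else Pa e c (k - 1))"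

text \<open>No two calls clash, since the called vertex is a function \<open>child p t\<close> of the caller and the time.\<close>

fun child :: "vert \<Rightarrow> nat \<Rightarrow> vert" where
  "child R t = (if t \<le> 1 then El u else if t = 2 then T 0 else if t < B + 3 then El (ch (t - 3)) else El (t - B - 3))"
| "child (T k) t = T (Suc k)"
| "child (S k) t = S (Suc k)"
| "child (El e) t = (if e = u \<and> t \<le> 1 then R else
     let r = t - st e - 1 in Pa e (if r = 0 then if e < 4 then 0 else (e - 4) div 2 + 1 else B + r) B)"
| "child (Cl c) t = (let r = t - tc c in if r = 1 then if c = 0 then S 0 else Tl c 0
     else if r = 2 then Tl c 0 else Pa (r - 3) c 0)"
| "child (Tl c k) t = Tl c (Suc k)"
| "child (Pa e c k) t = (if e = rep c then if k = 0 then Cl c else Pa e c (k - 1) else Pa e c (Suc k))"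

lemma pick': "j < nF \<Longrightarrow> \<not> hits u j \<Longrightarrow> pick j < m \<and> lit j (2 * pick j + of_bool (a (pick j)))"
  using pick[of j] lit_bound[of "of_bool (a (pick j))" j "pick j"] by auto

lemma ch_bound: "i < B \<Longrightarrow> ch i < 2 * B + 4" "4 \<le> ch i" "(ch i - 4) div 2 = i"
    "\<not> ch i < 4" "ch i \<noteq> u"
  using u by (auto simp: ch_def)

lemma rep_inc: "c < B + 1 + nF \<Longrightarrow> inc (rep c) c \<and> rep c < 2 * B + 4"
proof -
  assume c: "c < B + 1 + nF"
  consider "c = 0" | "0 < c" "c \<le> B" | "B < c" "hits u (c - B - 1)" | "B < c" "\<not> hits u (c - B - 1)" by linarith
  then show ?thesis
  proof cases
    case 4
    have j: "c - B - 1 < nF" using c 4(1) by simp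
    then show ?thesis using pick'[OF j 4(2)] ch_bound(1,2)[of "pick (c - B - 1)"] size 4
      by (auto simp: inc_def rep_def ch_def)
  qed (use u in \<open>auto simp: inc_def rep_def ch_def\<close>)
qed

lemma rep_cases:
  assumes "c < B + 1 + nF"
  obtains "rep c = u" "c = 0 \<or> B < c"
    | i where "rep c = ch i" "i < B" "c = Suc i"
    | i where "rep c = ch i" "i < m" "B < c"
proof (cases "c = 0 \<or> B < c \<and> hits u (c - B - 1)")
  case True
  then show ?thesis using that(1) by (auto simp: rep_def)
next
  case False
  show ?thesis
  proof (cases "c \<le> B")
    case True
    then show ?thesis using False by (intro that(2)[of "c - 1"]) (auto simp: rep_def)
  next
    case F2: False
    then have "c - B - 1 < nF" "\<not> hits u (c - B - 1)" using assms False by auto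
    from pick'[OF this] show ?thesis using F2 False by (intro that(3)[of "pick (c - B - 1)"]) (auto simp: rep_def)
  qed
qed

lemma st_u: "st u = 1" "st (ch i) = 3 + i"
  using u by (auto simp: st_def ch_bound)

lemma rep_time:
  assumes "c < B + 1 + nF"
  shows "tm' (El (rep c)) \<le> st (rep c)" "st (rep c) + (c - B) \<le> B + 2" "tc 0 = B + 3"
proof -
  show "tm' (El (rep c)) \<le> st (rep c)"
    using assms by (cases rule: rep_cases) (use u ch_bound in \<open>auto simp: st_u\<close>)
  \<comment> \<open>The padding enters here: a literal of the formula is called by round
    \<open>m + 2\<close> and waits at most \<open>nF\<close> rounds.\<close>
  show "st (rep c) + (c - B) \<le> B + 2"
    using assms by (cases rule: rep_cases) (use size assms in \<open>auto simp: st_u\<close>)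
  show "tc 0 = B + 3" using st_u by (simp add: tc_def rep_def)
qed

lemma tc_le: "c < B + 1 + nF \<Longrightarrow> tc c \<le> 2 * B + 4"
  using rep_time(2)[of c] by (simp add: tc_def)

lemma tm'_le: "vtx v \<Longrightarrow> tm' v \<le> D"
proof (cases v)
  case (El e)
  assume "vtx v"
  then show ?thesis using El z by (auto simp: D_def st_def)
next
  case (Cl c)
  assume "vtx v"
  then show ?thesis using Cl tc_le[of c] by (simp add: D_def)
next
  case (Tl c k)
  assume "vtx v"
  then show ?thesis using Tl tc_le[of c] rep_time(3)[of c] by (cases "c = 0") (auto simp: D_def)
next
  case (Pa e c k)
  assume "vtx v"
  then show ?thesis using Pa tc_le[of c] rep_time(2)[of c] by (auto simp: D_def)
qed (use z in \<open>auto simp: D_def\<close>)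

definition root :: vert where "root = (if z = 0 then R else El u)"

lemma z_cases:
  obtains "root = R" "tm' R = 0" "tm' (El u) = 1" | "root = El u" "tm' R = 1" "tm' (El u) = 0"
proof -
  have "root = R \<and> tm' R = 0 \<and> tm' (El u) = 1 \<or> root = El u \<and> tm' R = 1 \<and> tm' (El u) = 0"
    unfolding root_def tm'.simps using z by (cases "z = 0") auto
  then show ?thesis using that by blast
qed

lemma par'_ok:
  assumes v: "vtx v" "v \<noteq> root"
  shows "nbr (par' v) v \<and> tm' (par' v) < tm' v"
proof (cases v)
  case R
  then show ?thesis using v u by (cases rule: z_cases) (auto simp: nbr_def simp del: tm'.simps)
next
  case (T k)
  then show ?thesis using v z by (cases k) (auto simp: nbr_def)
next
  case (S k)
  then show ?thesis using v rep_time(3)[of 0] by (cases k) (auto simp: nbr_def)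
next
  case (El e)
  have "tm' R \<le> 1" using z by simp
  then have "tm' R < tm' (El e)" if "e \<noteq> u" using that unfolding tm'.simps(4) by (auto simp: st_def)
  then show ?thesis using v El
    by (cases "e = u"; cases rule: z_cases) (auto simp: nbr_def simp del: tm'.simps)
next
  case (Cl c)
  then show ?thesis using v rep_inc[of c] by (auto simp: nbr_def tc_def)
next
  case (Tl c k)
  then show ?thesis using v by (cases k) (auto simp: nbr_def)
next
  case (Pa e c k)
  have "0 < B" using size by simp
  then show ?thesis using v Pa rep_inc[of c] rep_time(1)[of c]
    by (cases k) (auto simp: nbr_def simp del: tm'.simps(4))
qed

lemma child_par':
  assumes v: "vtx v" "v \<noteq> root"
  shows "child (par' v) (tm' v) = v"
proof (cases v)
  case R
  then show ?thesis using v z by auto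
next
  case (El e)
  show ?thesis
  proof (cases "e = u")
    case False
    consider "e < 4" | "4 \<le> e" "e = ch ((e - 4) div 2)" | "4 \<le> e" "e \<noteq> ch ((e - 4) div 2)" by linarith
    then show ?thesis
    proof cases
      case 2
      then have "tm' v = 3 + (e - 4) div 2" using El False by (simp add: st_def)
      moreover have "(e - 4) div 2 < B" using v El 2(1) by auto
      ultimately show ?thesis using El 2 by simp
    qed (use El False in auto)
  qed (use El in auto)
next
  case (Cl c)
  then show ?thesis by simp
next
  case (Pa e c k)
  show ?thesis
  proof (cases "e = rep c")
    case True
    have c: "c < B + 1 + nF" "k \<le> B" using v Pa by auto
    show ?thesis
    proof (cases "k = B")
      case kB: True
      have t: "tm' v = st e + 1 + (c - B)" using Pa True kB by simp
      have "0 < st e" by (simp add: st_def)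
      then have 1: "child (El e) (tm' v) = Pa e (if c - B = 0 then if e < 4 then 0 else (e - 4) div 2 + 1 else B + (c - B)) B"
        unfolding t by (simp add: Let_def)
      have "(if c - B = 0 then if e < 4 then 0 else (e - 4) div 2 + 1 else B + (c - B)) = c"
        using c(1) by (cases rule: rep_cases) (use True u ch_bound in \<open>auto simp: not_less\<close>)
      with 1 show ?thesis using Pa True kB by simp
    qed (use Pa True in auto)
  qed (use Pa in \<open>auto simp: Let_def\<close>)
next
  case (Tl c k)
  then show ?thesis by (cases k) (auto simp: Let_def)
next
  case (T k)
  then show ?thesis by (cases k) auto
next
  case (S k)
  then show ?thesis using rep_time(3)[of 0] by (cases k) (auto simp: Let_def)
qed

lemma schedule': "schedule V E root D tm' par'"
  unfolding schedule_def in_V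
proof (intro conjI ballI impI)
  show "tm' root = 0" by (cases rule: z_cases) (simp_all del: tm'.simps)
next
  fix v w assume *: "v \<in> V" "w \<in> V" "v \<noteq> root" "w \<noteq> root" "par' v = par' w" "tm' v = tm' w"
  have "v = child (par' v) (tm' v)" "w = child (par' w) (tm' w)"
    using child_par'[of v] child_par'[of w] *(1-4) unfolding in_V by simp_all
  then show "v = w" unfolding *(5,6) by (rule trans[OF _ sym])
next
  fix v assume v: "v \<in> V" "v \<noteq> root"
  then have "nbr (par' v) v \<and> tm' (par' v) < tm' v" using par'_ok unfolding in_V by blast
  then show "vtx (par' v)" "{par' v, v} \<in> E" "tm' (par' v) < tm' v"
    unfolding E_iff nbr_def by blast+
next
  fix v assume "v \<in> V"
  then show "tm' v \<le> D" using tm'_le by (simp add: in_V)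
qed

lemma broadcast_root: "(broadcast_round E ^^ D) {if z = 0 then R else El u} V"
proof -
  have "root \<in> V" using u by (cases rule: z_cases) (simp_all add: in_V)
  with schedule' show ?thesis unfolding root_def[symmetric] by (rule schedule_imp_broadcast)
qed

end

lemma sat_imp_broadcast:
  assumes "sat u" "u < 4" "r = R \<or> r = El u"
  shows "(broadcast_round E ^^ D) {r} V"
proof -
  obtain a where a: "\<forall>j<nF. hits u j \<or> (\<exists>i<B. lit j (2 * i + of_bool (a i)))"
    using assms(1) unfolding sat_def by blast
  then obtain pick where pick: "\<And>j. j < nF \<Longrightarrow> hits u j \<or> (pick j < B \<and> lit j (2 * pick j + of_bool (a (pick j))))"
    by metis
  define z where "z = (if r = R then 0 else 1::nat)"
  have z: "z \<le> 1" by (simp add: z_def)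
  have "(if z = 0 then R else El u) = r" using assms(3) by (auto simp: z_def)
  with broadcast_root[OF assms(2) z pick] show ?thesis by simp
qed

text \<open>The hypothesis makes the root attain the lower bound \<open>D\<close> of
  \<open>t_ge\<close>, by way of the special element 0. Hence \<open>D\<close> is the minimal
  broadcast time.\<close>

theorem gadget_center:
  assumes "sat 0"
  shows "broadcast_center V E = insert R (El ` {u. u < 4 \<and> sat u})"
proof -
  have "broadcast_center V E = {v \<in> V. (broadcast_round E ^^ D) {v} V}"
  proof (rule broadcast_center_eq)
    show "R \<in> V" by (simp add: in_V)
    show "(broadcast_round E ^^ D) {R} V" by (rule sat_imp_broadcast[OF assms]) auto
    fix v t assume v: "v \<in> V" "t < D"
    show "\<not> (broadcast_round E ^^ t) {v} V"
    proof
      assume "(broadcast_round E ^^ t) {v} V"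
      then obtain ti par where "schedule V E v t ti par" by (rule broadcast_imp_schedule)
      from t_ge[OF this] v show False by (simp add: in_V)
    qed
  qed
  also have "\<dots> = insert R (El ` {u. u < 4 \<and> sat u})"
  proof (intro subset_antisym subsetI)
    fix v assume "v \<in> {v \<in> V. (broadcast_round E ^^ D) {v} V}"
    then have v: "vtx v" "(broadcast_round E ^^ D) {v} V" by (simp_all add: in_V)
    from v(2) obtain ti par where s: "schedule V E v D ti par" by (rule broadcast_imp_schedule)
    from v0_cases[OF s v(1)] have "v = R \<or> (\<exists>u<4. v = El u)" by simp
    then show "v \<in> insert R (El ` {u. u < 4 \<and> sat u})"
    proof (elim disjE exE conjE)
      fix u assume u: "u < 4" "v = El u"
      then have "sat u" using schedule_imp_sat s by blast
      then show ?thesis using u by blast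
    qed simp
  next
    fix v assume "v \<in> insert R (El ` {u. u < 4 \<and> sat u})"
    then show "v \<in> {v \<in> V. (broadcast_round E ^^ D) {v} V}"
    proof (elim insertE imageE CollectE conjE)
      assume "v = R"
      then show ?thesis using sat_imp_broadcast[OF assms, of R] by (simp add: in_V)
    next
      fix u assume "v = El u" "u < 4" "sat u"
      then show ?thesis using sat_imp_broadcast[of u "El u"] by (simp add: in_V)
    qed
  qed
  finally show ?thesis .
qed

end

section \<open>Isomorphic graphs\<close>

lemma broadcast_image:
  assumes inj: "inj_on f V" and r: "r \<in> V" and b: "(broadcast_round E ^^ t) {r} V"
  shows "(broadcast_round ((`) f ` E) ^^ t) {f r} (f ` V)"
proof -
  obtain ti par where s: "schedule V E r t ti par" using b by (rule broadcast_imp_schedule)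
  define g where "g = inv_into V f"
  have g: "g (f v) = v" if "v \<in> V" for v using inj that by (simp add: g_def)
  have "schedule (f ` V) ((`) f ` E) (f r) t (\<lambda>v. ti (g v)) (\<lambda>v. f (par (g v)))"
    unfolding schedule_def
  proof (intro conjI ballI impI)
    show "ti (g (f r)) = 0" using g[OF r] s by (simp add: schedule_def)
  next
    fix v assume "v \<in> f ` V"
    then show "ti (g v) \<le> t" using g s by (auto simp: schedule_def)
  next
    fix v assume v: "v \<in> f ` V" "v \<noteq> f r"
    then obtain w where w: "w \<in> V" "v = f w" "w \<noteq> r" by auto
    then have p: "par w \<in> V" "{par w, w} \<in> E" "ti (par w) < ti w" using s by (auto simp: schedule_def)
    show "f (par (g v)) \<in> f ` V" "ti (g (f (par (g v)))) < ti (g v)" using w p g by auto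
    have "f ` {par w, w} \<in> (`) f ` E" using p(2) by (rule imageI)
    then show "{f (par (g v)), v} \<in> (`) f ` E" using w g by simp
  next
    fix v w assume *: "v \<in> f ` V" "w \<in> f ` V" "v \<noteq> f r" "w \<noteq> f r" "f (par (g v)) = f (par (g w))" "ti (g v) = ti (g w)"
    then obtain v' w' where v': "v' \<in> V" "v = f v'" "v' \<noteq> r" "w' \<in> V" "w = f w'" "w' \<noteq> r" by auto
    then have p: "par v' \<in> V" "par w' \<in> V" using s by (auto simp: schedule_def)
    have "par v' = par w'" using inj_onD[OF inj _ p] *(5) v' g by simp
    moreover have "ti v' = ti w'" using *(6) v' g by simp
    moreover have "\<forall>v\<in>V. \<forall>w\<in>V. v \<noteq> r \<longrightarrow> w \<noteq> r \<longrightarrow> par v = par w \<longrightarrow> ti v = ti w \<longrightarrow> v = w"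
      using s by (simp add: schedule_def)
    ultimately have "v' = w'" using v' by blast
    then show "v = w" using v' by simp
  qed
  then show ?thesis by (rule schedule_imp_broadcast) (use r in simp)
qed

lemma broadcast_image_iff:
  assumes inj: "inj_on f V" and r: "r \<in> V" and E: "\<forall>e\<in>E. e \<subseteq> V"
  shows "(broadcast_round ((`) f ` E) ^^ t) {f r} (f ` V) \<longleftrightarrow> (broadcast_round E ^^ t) {r} V"
proof
  assume b: "(broadcast_round ((`) f ` E) ^^ t) {f r} (f ` V)"
  define g where "g = inv_into V f"
  have g: "g (f v) = v" if "v \<in> V" for v using inj that by (simp add: g_def)
  have gi: "g ` f ` A = A" if "A \<subseteq> V" for A using g that by (force simp: image_iff)
  have "inj_on g (f ` V)" using g by (auto simp: inj_on_def)
  from broadcast_image[OF this _ b] have "(broadcast_round ((`) g ` (`) f ` E) ^^ t) {g (f r)} (g ` f ` V)"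
    using r by simp
  moreover have "(`) g ` (`) f ` E = E"
  proof -
    have "(`) g ` (`) f ` E = (\<lambda>e. e) ` E" unfolding image_image[of "(`) g" "(`) f" E]
      by (rule image_cong) (use gi E in auto)
    then show ?thesis by simp
  qed
  ultimately show "(broadcast_round E ^^ t) {r} V" using g[OF r] gi[of V] by simp
qed (rule broadcast_image[OF inj r])

lemma broadcast_center_image:
  assumes inj: "inj_on f V" and E: "\<forall>e\<in>E. e \<subseteq> V"
  shows "broadcast_center (f ` V) ((`) f ` E) = f ` broadcast_center V E"
proof -
  have bt: "broadcast_time (f ` V) ((`) f ` E) (f v) = broadcast_time V E v" if "v \<in> V" for v
    unfolding broadcast_time_def broadcast_image_iff[OF inj that E] ..
  then have "(INF u\<in>f ` V. broadcast_time (f ` V) ((`) f ` E) u) = (INF u\<in>V. broadcast_time V E u)"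
    by (simp add: image_image)
  then show ?thesis unfolding broadcast_center_def using bt by auto
qed

section \<open>Numbering the vertices\<close>

text \<open>The root and the tails \<open>T\<close> and \<open>S\<close> come first, with
  \<open>1 + (5 * B + 9) + (4 * B + 7)\<close> vertices. The elements, clauses, clause tails and
  paths follow in consecutive blocks, multiple indices being digits of mixed radix.\<close>

definition off_El :: "nat \<Rightarrow> nat" where "off_El B = 9 * B + 17"
definition off_Cl :: "nat \<Rightarrow> nat" where "off_Cl B = 11 * B + 21"
definition off_Tl :: "nat \<Rightarrow> nat \<Rightarrow> nat" where "off_Tl B nF = off_Cl B + (B + 1 + nF)"
definition off_Pa :: "nat \<Rightarrow> nat \<Rightarrow> nat" where "off_Pa B nF = off_Tl B nF + (B + 1 + nF) * (3 * B + 6)"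
definition n_vert :: "nat \<Rightarrow> nat \<Rightarrow> nat" where
  "n_vert B nF = off_Pa B nF + (2 * B + 4) * (B + 1 + nF) * (B + 1)"

fun num :: "nat \<Rightarrow> nat \<Rightarrow> vert \<Rightarrow> nat" where
  "num B nF R = 0"
| "num B nF (T k) = 1 + k"
| "num B nF (S k) = 5 * B + 10 + k"
| "num B nF (El e) = off_El B + e"
| "num B nF (Cl c) = off_Cl B + c"
| "num B nF (Tl c k) = off_Tl B nF + (c * (3 * B + 6) + k)"
| "num B nF (Pa e c k) = off_Pa B nF + ((e * (B + 1 + nF) + c) * (B + 1) + k)"

definition vert_of :: "nat \<Rightarrow> nat \<Rightarrow> nat \<Rightarrow> vert" where
  "vert_of B nF i = (if i = 0 then R else if i < 5 * B + 10 then T (i - 1) else if i < off_El B then S (i - (5 * B + 10))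
     else if i < off_Cl B then El (i - off_El B) else if i < off_Tl B nF then Cl (i - off_Cl B)
     else if i < off_Pa B nF then Tl ((i - off_Tl B nF) div (3 * B + 6)) ((i - off_Tl B nF) mod (3 * B + 6))
     else let j = i - off_Pa B nF in
       Pa (j div (B + 1) div (B + 1 + nF)) (j div (B + 1) mod (B + 1 + nF)) (j mod (B + 1)))"

text \<open>The edges are a disjunction of bounded existential statements, the form to which the
  closure rules for definability apply. Summands \<open>0\<close> are kept so that the terms have
  the shape of \<open>num\<close>.\<close>

definition arcN :: "nat \<Rightarrow> nat \<Rightarrow> (nat \<Rightarrow> nat \<Rightarrow> bool) \<Rightarrow> nat \<Rightarrow> nat \<Rightarrow> bool" where
  "arcN B nF I i j \<longleftrightarrow> i = 0 \<and> j = 1 \<or> i = 0 \<and> (\<exists>e<2 * B + 4. j = off_El B + e) \<or>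
     (\<exists>k<5 * B + 8. i = 1 + k \<and> j = 1 + Suc k) \<or>
     (\<exists>k<4 * B + 6. i = 5 * B + 10 + k \<and> j = 5 * B + 10 + Suc k) \<or>
     i = off_Cl B + 0 \<and> j = 5 * B + 10 + 0 \<or>
     (\<exists>c<B + 1 + nF. i = off_Cl B + c \<and> j = off_Tl B nF + (c * (3 * B + 6) + 0)) \<or>
     (\<exists>c<B + 1 + nF. \<exists>k<3 * B + 5. i = off_Tl B nF + (c * (3 * B + 6) + k) \<and> j = off_Tl B nF + (c * (3 * B + 6) + Suc k)) \<or>
     (\<exists>e<2 * B + 4. \<exists>c<B + 1 + nF. i = off_Cl B + c \<and> j = off_Pa B nF + ((e * (B + 1 + nF) + c) * (B + 1) + 0)) \<or>
     (\<exists>e<2 * B + 4. \<exists>c<B + 1 + nF. \<exists>k<B. i = off_Pa B nF + ((e * (B + 1 + nF) + c) * (B + 1) + k) \<and>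
        j = off_Pa B nF + ((e * (B + 1 + nF) + c) * (B + 1) + Suc k)) \<or>
     (\<exists>e<2 * B + 4. \<exists>c<B + 1 + nF. I e c \<and> i = off_Pa B nF + ((e * (B + 1 + nF) + c) * (B + 1) + B) \<and> j = off_El B + e)"

lemma mult_add_less: "a < k \<Longrightarrow> i < n \<Longrightarrow> a * n + i < k * n" for a k i n :: nat
proof -
  assume "a < k" "i < n"
  then have "a * n + i < Suc a * n" by simp
  also have "\<dots> \<le> k * n" using \<open>a < k\<close> by (intro mult_le_mono) auto
  finally show ?thesis .
qed

lemma div_mod_digit: "i < n \<Longrightarrow> (a * n + i) div n = a" "i < n \<Longrightarrow> (a * n + i) mod n = i" for a i n :: nat
  by simp_all

lemma arcN_intros:
  "arcN B nF I 0 1"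
  "e < 2 * B + 4 \<Longrightarrow> arcN B nF I 0 (off_El B + e)"
  "k < 5 * B + 8 \<Longrightarrow> arcN B nF I (1 + k) (1 + Suc k)"
  "k < 4 * B + 6 \<Longrightarrow> arcN B nF I (5 * B + 10 + k) (5 * B + 10 + Suc k)"
  "arcN B nF I (off_Cl B + 0) (5 * B + 10 + 0)"
  "c < B + 1 + nF \<Longrightarrow> arcN B nF I (off_Cl B + c) (off_Tl B nF + (c * (3 * B + 6) + 0))"
  "c < B + 1 + nF \<Longrightarrow> k < 3 * B + 5 \<Longrightarrow>
     arcN B nF I (off_Tl B nF + (c * (3 * B + 6) + k)) (off_Tl B nF + (c * (3 * B + 6) + Suc k))"
  "e < 2 * B + 4 \<Longrightarrow> c < B + 1 + nF \<Longrightarrow>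
     arcN B nF I (off_Cl B + c) (off_Pa B nF + ((e * (B + 1 + nF) + c) * (B + 1) + 0))"
  "e < 2 * B + 4 \<Longrightarrow> c < B + 1 + nF \<Longrightarrow> k < B \<Longrightarrow>
     arcN B nF I (off_Pa B nF + ((e * (B + 1 + nF) + c) * (B + 1) + k))
       (off_Pa B nF + ((e * (B + 1 + nF) + c) * (B + 1) + Suc k))"
  "e < 2 * B + 4 \<Longrightarrow> c < B + 1 + nF \<Longrightarrow> I e c \<Longrightarrow>
     arcN B nF I (off_Pa B nF + ((e * (B + 1 + nF) + c) * (B + 1) + B)) (off_El B + e)"
  subgoal unfolding arcN_def by (rule disjI1) simp
  subgoal unfolding arcN_def by (rule disjI2, rule disjI1) auto
  subgoal unfolding arcN_def by (rule disjI2, rule disjI2, rule disjI1) auto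
  subgoal unfolding arcN_def by (rule disjI2, rule disjI2, rule disjI2, rule disjI1) auto
  subgoal unfolding arcN_def by (rule disjI2, rule disjI2, rule disjI2, rule disjI2, rule disjI1) simp
  subgoal unfolding arcN_def by (rule disjI2, rule disjI2, rule disjI2, rule disjI2, rule disjI2, rule disjI1) auto
  subgoal unfolding arcN_def by (rule disjI2, rule disjI2, rule disjI2, rule disjI2, rule disjI2, rule disjI2, rule disjI1) auto
  subgoal unfolding arcN_def by (rule disjI2, rule disjI2, rule disjI2, rule disjI2, rule disjI2, rule disjI2, rule disjI2, rule disjI1) auto
  subgoal unfolding arcN_def by (rule disjI2, rule disjI2, rule disjI2, rule disjI2, rule disjI2, rule disjI2, rule disjI2, rule disjI2, rule disjI1) auto
  subgoal unfolding arcN_def by (rule disjI2, rule disjI2, rule disjI2, rule disjI2, rule disjI2, rule disjI2, rule disjI2, rule disjI2, rule disjI2) auto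
  done

context gadget
begin

lemma vert_of_num: "vtx v \<Longrightarrow> vert_of B nF (num B nF v) = v \<and> num B nF v < n_vert B nF"
proof (cases v)
  case (Tl c k)
  assume v: "vtx v"
  have "c * (3 * B + 6) + k < (B + 1 + nF) * (3 * B + 6)" using v Tl by (intro mult_add_less) auto
  then have "off_Tl B nF \<le> num B nF v" "num B nF v < off_Pa B nF" using Tl by (simp_all add: off_Pa_def)
  moreover have "(c * (3 * B + 6) + k) div (3 * B + 6) = c" "(c * (3 * B + 6) + k) mod (3 * B + 6) = k"
    using v Tl by (auto intro!: div_mod_digit)
  ultimately show ?thesis using Tl
    by (simp add: vert_of_def n_vert_def off_Tl_def off_Cl_def off_El_def)
next
  case (Pa e c k)
  assume v: "vtx v"
  let ?j = "(e * (B + 1 + nF) + c) * (B + 1) + k"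
  have "?j < (2 * B + 4) * (B + 1 + nF) * (B + 1)" using v Pa by (intro mult_add_less) auto
  moreover have "?j div (B + 1) = e * (B + 1 + nF) + c" "?j mod (B + 1) = k"
    "(e * (B + 1 + nF) + c) div (B + 1 + nF) = e" "(e * (B + 1 + nF) + c) mod (B + 1 + nF) = c"
    using v Pa by (auto intro!: div_mod_digit simp del: mult_Suc_right add_mult_distrib)
  moreover have "off_Pa B nF \<le> off_Pa B nF + ?j" "off_El B \<le> off_Pa B nF" "off_Cl B \<le> off_Pa B nF" "off_Tl B nF \<le> off_Pa B nF"
     "5 * B + 10 \<le> off_Pa B nF" "0 < off_Pa B nF"
    by (simp_all add: off_Pa_def off_Tl_def off_Cl_def off_El_def)
  ultimately show ?thesis unfolding Pa num.simps vert_of_def n_vert_def Let_def by auto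
qed (auto simp: vert_of_def n_vert_def off_Pa_def off_Tl_def off_Cl_def off_El_def)

lemma num_vert_of:
  assumes i: "i < n_vert B nF"
  shows "vtx (vert_of B nF i) \<and> num B nF (vert_of B nF i) = i"
proof -
  consider "i < off_Tl B nF" | "off_Tl B nF \<le> i" "i < off_Pa B nF" | "off_Pa B nF \<le> i" by linarith
  then show ?thesis
  proof cases
    case 1
    then show ?thesis by (auto simp: vert_of_def off_Tl_def off_Cl_def off_El_def)
  next
    case 2
    define j where "j = i - off_Tl B nF"
    have j: "i = off_Tl B nF + j" "j < (B + 1 + nF) * (3 * B + 6)" using 2 by (simp_all add: j_def off_Pa_def)
    then have "j div (3 * B + 6) < B + 1 + nF" by (simp add: less_mult_imp_div_less)
    moreover have "vert_of B nF i = Tl (j div (3 * B + 6)) (j mod (3 * B + 6))"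
      using 2 unfolding j_def by (simp add: vert_of_def off_Tl_def off_Cl_def off_El_def)
    moreover have "j div (3 * B + 6) * (3 * B + 6) + j mod (3 * B + 6) = j" by (rule div_mult_mod_eq)
    ultimately show ?thesis using j(1) by simp
  next
    case 3
    define j where "j = i - off_Pa B nF"
    have j: "i = off_Pa B nF + j" "j < (2 * B + 4) * (B + 1 + nF) * (B + 1)"
      using 3 i by (simp_all add: j_def n_vert_def)
    then have "j div (B + 1) < (2 * B + 4) * (B + 1 + nF)" by (simp add: less_mult_imp_div_less)
    then have e: "j div (B + 1) div (B + 1 + nF) < 2 * B + 4" by (rule less_mult_imp_div_less)
    have c: "j div (B + 1) mod (B + 1 + nF) < B + 1 + nF" by simp
    have k: "j mod (B + 1) < B + 1" by simp
    have "vert_of B nF i = Pa (j div (B + 1) div (B + 1 + nF)) (j div (B + 1) mod (B + 1 + nF)) (j mod (B + 1))"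
      using 3 unfolding j_def by (simp add: Let_def vert_of_def off_Pa_def off_Tl_def off_Cl_def off_El_def)
    moreover have "(j div (B + 1) div (B + 1 + nF) * (B + 1 + nF) + j div (B + 1) mod (B + 1 + nF)) * (B + 1) + j mod (B + 1) = j"
      unfolding div_mult_mod_eq ..
    ultimately show ?thesis using j(1) e c k by (simp only: vtx.simps num.simps)
  qed
qed

lemma inj_num: "inj_on (num B nF) V"
  by (rule inj_on_inverseI[of _ "vert_of B nF"]) (use vert_of_num in \<open>auto simp: in_V\<close>)

lemma num_V: "num B nF ` V = {0..<n_vert B nF}"
proof (intro subset_antisym subsetI)
  fix i assume "i \<in> {0..<n_vert B nF}"
  then show "i \<in> num B nF ` V" using num_vert_of[of i] by (intro image_eqI[of _ _ "vert_of B nF i"]) (auto simp: in_V)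
qed (use vert_of_num in \<open>auto simp: in_V\<close>)

lemma arcN_iff: "arcN B nF inc i j \<longleftrightarrow> (\<exists>u v. vtx u \<and> vtx v \<and> arc u v \<and> i = num B nF u \<and> j = num B nF v)"
proof
  assume "arcN B nF inc i j"
  then show "\<exists>u v. vtx u \<and> vtx v \<and> arc u v \<and> i = num B nF u \<and> j = num B nF v"
    unfolding arcN_def
  proof (elim disjE exE conjE)
    assume "i = 0" "j = 1"
    then show ?thesis by (intro exI[of _ R] exI[of _ "T 0"]) simp
  next
    fix e assume "i = 0" "e < 2 * B + 4" "j = off_El B + e"
    then show ?thesis by (intro exI[of _ R] exI[of _ "El e"]) simp
  next
    fix k assume "k < 5 * B + 8" "i = 1 + k" "j = 1 + Suc k"
    then show ?thesis by (intro exI[of _ "T k"] exI[of _ "T (Suc k)"]) simp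
  next
    fix k assume "k < 4 * B + 6" "i = 5 * B + 10 + k" "j = 5 * B + 10 + Suc k"
    then show ?thesis by (intro exI[of _ "S k"] exI[of _ "S (Suc k)"]) simp
  next
    assume "i = off_Cl B + 0" "j = 5 * B + 10 + 0"
    then show ?thesis by (intro exI[of _ "Cl 0"] exI[of _ "S 0"]) simp
  next
    fix c assume "c < B + 1 + nF" "i = off_Cl B + c" "j = off_Tl B nF + (c * (3 * B + 6) + 0)"
    then show ?thesis by (intro exI[of _ "Cl c"] exI[of _ "Tl c 0"]) simp
  next
    fix c k assume "c < B + 1 + nF" "k < 3 * B + 5" "i = off_Tl B nF + (c * (3 * B + 6) + k)" "j = off_Tl B nF + (c * (3 * B + 6) + Suc k)"
    then show ?thesis by (intro exI[of _ "Tl c k"] exI[of _ "Tl c (Suc k)"]) simp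
  next
    fix e c assume "e < 2 * B + 4" "c < B + 1 + nF" "i = off_Cl B + c" "j = off_Pa B nF + ((e * (B + 1 + nF) + c) * (B + 1) + 0)"
    then show ?thesis by (intro exI[of _ "Cl c"] exI[of _ "Pa e c 0"]) simp
  next
    fix e c k assume "e < 2 * B + 4" "c < B + 1 + nF" "k < B" "i = off_Pa B nF + ((e * (B + 1 + nF) + c) * (B + 1) + k)"
        "j = off_Pa B nF + ((e * (B + 1 + nF) + c) * (B + 1) + Suc k)"
    then show ?thesis by (intro exI[of _ "Pa e c k"] exI[of _ "Pa e c (Suc k)"]) simp
  next
    fix e c assume "e < 2 * B + 4" "c < B + 1 + nF" "inc e c" "i = off_Pa B nF + ((e * (B + 1 + nF) + c) * (B + 1) + B)" "j = off_El B + e"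
    then show ?thesis by (intro exI[of _ "Pa e c B"] exI[of _ "El e"]) simp
  qed
next
  assume "\<exists>u v. vtx u \<and> vtx v \<and> arc u v \<and> i = num B nF u \<and> j = num B nF v"
  then obtain u v where uv: "vtx u" "vtx v" "arc u v" "i = num B nF u" "j = num B nF v" by blast
  show "arcN B nF inc i j"
  proof (cases u)
    case R
    then have "i = 0 \<and> j = 1 \<or> (\<exists>e<2 * B + 4. i = 0 \<and> j = off_El B + e)" using uv by (cases v) auto
    then show ?thesis using arcN_intros(1,2) by blast
  next
    case (T k)
    then have "k < 5 * B + 8" "i = 1 + k" "j = 1 + Suc k" using uv by (cases v; simp)+
    then show ?thesis by (simp only: arcN_intros)
  next
    case (S k)
    then have "k < 4 * B + 6" "i = 5 * B + 10 + k" "j = 5 * B + 10 + Suc k" using uv by (cases v; simp)+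
    then show ?thesis by (simp only: arcN_intros)
  next
    case (El e)
    then show ?thesis using uv by (cases v) auto
  next
    case (Cl c)
    show ?thesis
    proof (cases v)
      case (S k)
      then have "i = off_Cl B + 0" "j = 5 * B + 10 + 0" using uv Cl by simp_all
      then show ?thesis by (simp only: arcN_intros)
    next
      case (Tl c' k)
      then have "c < B + 1 + nF" "i = off_Cl B + c" "j = off_Tl B nF + (c * (3 * B + 6) + 0)" using uv Cl by simp_all
      then show ?thesis by (simp only: arcN_intros)
    next
      case (Pa e c' k)
      then have "e < 2 * B + 4" "c < B + 1 + nF" "i = off_Cl B + c" "j = off_Pa B nF + ((e * (B + 1 + nF) + c) * (B + 1) + 0)"
        using uv Cl by simp_all
      then show ?thesis by (simp only: arcN_intros)
    qed (use uv Cl in auto)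
  next
    case (Tl c k)
    then have "c < B + 1 + nF" "k < 3 * B + 5" "i = off_Tl B nF + (c * (3 * B + 6) + k)" "j = off_Tl B nF + (c * (3 * B + 6) + Suc k)"
      using uv by (cases v; simp)+
    then show ?thesis by (simp only: arcN_intros)
  next
    case (Pa e c k)
    show ?thesis
    proof (cases v)
      case (Pa e' c' k')
      then have "e < 2 * B + 4" "c < B + 1 + nF" "k < B" "i = off_Pa B nF + ((e * (B + 1 + nF) + c) * (B + 1) + k)"
        "j = off_Pa B nF + ((e * (B + 1 + nF) + c) * (B + 1) + Suc k)" using uv \<open>u = Pa e c k\<close> by simp_all
      then show ?thesis by (simp only: arcN_intros)
    next
      case (El e')
      then have "e < 2 * B + 4" "c < B + 1 + nF" "inc e c" "i = off_Pa B nF + ((e * (B + 1 + nF) + c) * (B + 1) + B)" "j = off_El B + e"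
        using uv Pa by simp_all
      then show ?thesis by (simp only: arcN_intros)
    qed (use uv Pa in auto)
  qed
qed

lemma num_E: "{i, j} \<in> (`) (num B nF) ` E \<longleftrightarrow> arcN B nF inc i j \<or> arcN B nF inc j i"
proof -
  have "(`) (num B nF) ` E = {{num B nF u, num B nF v} | u v. vtx u \<and> vtx v \<and> arc u v}"
    unfolding E_def by (auto simp: image_def)
  then show ?thesis unfolding arcN_iff by (auto simp: doubleton_eq_iff)
qed

lemma ugraph_num: "ugraph {0..<n_vert B nF} ((`) (num B nF) ` E)"
  unfolding ugraph_def
proof (intro conjI ballI)
  fix e assume "e \<in> (`) (num B nF) ` E"
  then obtain d where d: "d \<in> E" "e = num B nF ` d" by blast
  then have "d \<subseteq> V" "card d = 2" using E_ugraph by (auto simp: ugraph_def)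
  then show "e \<subseteq> {0..<n_vert B nF}" "card e = 2"
    using d num_V inj_num by (auto simp: card_image inj_on_subset)
qed simp

lemma card_center:
  assumes "sat 0"
  shows "card (broadcast_center {0..<n_vert B nF} ((`) (num B nF) ` E)) = 2 + of_bool (sat 1) + of_bool (sat 2) + of_bool (sat 3)"
proof -
  have EV: "\<forall>e\<in>E. e \<subseteq> V" using E_ugraph by (auto simp: ugraph_def)
  have "broadcast_center {0..<n_vert B nF} ((`) (num B nF) ` E) = num B nF ` broadcast_center V E"
    using broadcast_center_image[OF inj_num EV] num_V by simp
  moreover have "broadcast_center V E \<subseteq> V" by (auto simp: broadcast_center_def)
  ultimately have "card (broadcast_center {0..<n_vert B nF} ((`) (num B nF) ` E)) = card (broadcast_center V E)"
    using inj_num by (simp add: card_image inj_on_subset)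
  also have "\<dots> = card (insert R (El ` {u. u < 4 \<and> sat u}))" unfolding gadget_center[OF assms] ..
  also have "\<dots> = Suc (card (El ` {u. u < 4 \<and> sat u}))" by (rule card_insert_disjoint) auto
  also have "card (El ` {u. u < 4 \<and> sat u}) = card {u. u < 4 \<and> sat u}" by (rule card_image) (simp add: inj_on_def)
  also have "{u. u < 4 \<and> sat u} = {0} \<union> (if sat 1 then {1} else {}) \<union> (if sat 2 then {2} else {}) \<union> (if sat 3 then {3} else {})"
    using assms by (auto simp: less_Suc_eq eval_nat_numeral)
  finally show ?thesis by (auto simp: card_insert_if)
qed

end

section \<open>The reduction from two formulas\<close>

text \<open>The literal \<open>2 * i + b\<close> gives the value \<open>b\<close> to the variable \<open>i\<close>. In base \<open>N\<close> the variables of a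
  tableau have four digits and the clauses six.\<close>

definition cnf_sat :: "nat \<Rightarrow> (nat \<Rightarrow> nat \<Rightarrow> bool) \<Rightarrow> bool" where
  "cnf_sat N lit \<longleftrightarrow> (\<exists>a :: nat \<Rightarrow> bool. \<forall>j<N ^ 6. \<exists>i<N ^ 4. lit j (2 * i + of_bool (a i)))"

definition incN :: "nat \<Rightarrow> (nat \<Rightarrow> nat \<Rightarrow> bool) \<Rightarrow> (nat \<Rightarrow> nat \<Rightarrow> bool) \<Rightarrow> nat \<Rightarrow> nat \<Rightarrow> bool" where
  "incN B hits lit e c \<longleftrightarrow> (if c = 0 then e < 4 else if c \<le> B then e = 2 * c + 2 \<or> e = 2 * c + 3
     else if e < 4 then hits e (c - B - 1) else lit (c - B - 1) (e - 4))"

lemma (in gadget) inc_eq: "inc = incN B hits lit"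
  by (simp add: fun_eq_iff inc_def incN_def)

text \<open>The variables and clauses of the first formula get even, those of the second odd numbers.\<close>

definition mix_lit :: "(nat \<Rightarrow> nat \<Rightarrow> bool) \<Rightarrow> (nat \<Rightarrow> nat \<Rightarrow> bool) \<Rightarrow> nat \<Rightarrow> nat \<Rightarrow> nat \<Rightarrow> bool" where
  "mix_lit f g N j l \<longleftrightarrow> j mod 2 = l div 2 mod 2 \<and> l div 2 < 2 * N ^ 4 \<and>
     (if j mod 2 = 0 then f (j div 2) (2 * (l div 2 div 2) + l mod 2) else g (j div 2) (2 * (l div 2 div 2) + l mod 2))"

definition mix_hits :: "nat \<Rightarrow> nat \<Rightarrow> bool" where
  "mix_hits u j \<longleftrightarrow> u = 0 \<or> u = 1 \<and> j mod 2 = 1 \<or> 2 \<le> u \<and> j mod 2 = 0"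

text \<open>The least number of variables that the gadget admits for \<open>2 * N ^ 4\<close> proper
  variables and \<open>2 * N ^ 6\<close> clauses.\<close>

definition mix_B :: "nat \<Rightarrow> nat" where "mix_B N = 2 * N ^ 4 + 2 * N ^ 6 + 1"

lemma mix_gadget: "gadget (mix_B N) (2 * N ^ 6) (2 * N ^ 4) (mix_lit f g N)"
  by standard (auto simp: mix_B_def mix_lit_def)

text \<open>The two formulas have disjoint variables, so an assignment for the clauses of one parity
  is an assignment for one formula. The padding variables occur in no literal of
  \<open>mix_lit\<close>.\<close>

lemma mix_sat:
  assumes h: "h < 2"
  shows "(\<exists>a :: nat \<Rightarrow> bool. \<forall>j<2 * N ^ 6. j mod 2 = h \<longrightarrow> (\<exists>i<mix_B N. mix_lit f g N j (2 * i + of_bool (a i)))) \<longleftrightarrow>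
    cnf_sat N (if h = 0 then f else g)"
proof -
  let ?F = "if h = 0 then f else g"
  have lit: "mix_lit f g N (2 * j + h) (2 * (2 * i + h) + of_bool b) \<longleftrightarrow> i < N ^ 4 \<and> ?F j (2 * i + of_bool b)" for j i b
  proof -
    have d: "(2 * a + c) div 2 = a" "(2 * a + c) mod 2 = c" if "c < 2" for a c :: nat using that by simp_all
    have "of_bool b < (2::nat)" by simp
    note d = d[OF h] d[OF this]
    have "2 * i + h < 2 * M \<longleftrightarrow> i < M" for M using h by presburger
    then show ?thesis unfolding mix_lit_def d by simp
  qed
  show ?thesis
  proof
    assume "\<exists>a :: nat \<Rightarrow> bool. \<forall>j<2 * N ^ 6. j mod 2 = h \<longrightarrow> (\<exists>i<mix_B N. mix_lit f g N j (2 * i + of_bool (a i)))"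
    then obtain a :: "nat \<Rightarrow> bool" where
      a: "\<And>j. j < 2 * N ^ 6 \<Longrightarrow> j mod 2 = h \<Longrightarrow> \<exists>i<mix_B N. mix_lit f g N j (2 * i + of_bool (a i))" by blast
    have "\<exists>i<N ^ 4. ?F j (2 * i + of_bool (a (2 * i + h)))" if "j < N ^ 6" for j
    proof -
      have "2 * j + h < 2 * N ^ 6" "(2 * j + h) mod 2 = h" using that h by auto
      from a[OF this] obtain i where i: "mix_lit f g N (2 * j + h) (2 * i + of_bool (a i))" by blast
      then have "i mod 2 = h" using h by (auto simp: mix_lit_def)
      then have e: "i = 2 * (i div 2) + h" by presburger
      have "i div 2 < N ^ 4 \<and> ?F j (2 * (i div 2) + of_bool (a i))" using i lit[of j "i div 2" "a i"] e by simp
      then show ?thesis using e by metis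
    qed
    then show "cnf_sat N ?F" unfolding cnf_sat_def by (intro exI[of _ "\<lambda>i. a (2 * i + h)"]) blast
  next
    assume "cnf_sat N ?F"
    then obtain a :: "nat \<Rightarrow> bool" where a: "\<And>j. j < N ^ 6 \<Longrightarrow> \<exists>i<N ^ 4. ?F j (2 * i + of_bool (a i))"
      unfolding cnf_sat_def by blast
    have "\<exists>i<mix_B N. mix_lit f g N j (2 * i + of_bool (a (i div 2)))" if j: "j < 2 * N ^ 6" "j mod 2 = h" for j
    proof -
      have e: "j = 2 * (j div 2) + h" using j(2) by presburger
      have "j div 2 < N ^ 6" using j(1) by simp
      from a[OF this] obtain i where i: "i < N ^ 4" "?F (j div 2) (2 * i + of_bool (a i))" by blast
      have "mix_lit f g N j (2 * (2 * i + h) + of_bool (a i))"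
        using lit[of "j div 2" i "a i"] i e by simp
      moreover have "(2 * i + h) div 2 = i" using h by simp
      moreover have "2 * i + h < mix_B N" using i h by (simp add: mix_B_def)
      ultimately show ?thesis by (intro exI[of _ "2 * i + h"]) simp
    qed
    then show "\<exists>a :: nat \<Rightarrow> bool. \<forall>j<2 * N ^ 6. j mod 2 = h \<longrightarrow> (\<exists>i<mix_B N. mix_lit f g N j (2 * i + of_bool (a i)))"
      by (intro exI[of _ "\<lambda>i. a (i div 2)"]) blast
  qed
qed

definition red_size :: "nat \<Rightarrow> nat" where "red_size N = n_vert (mix_B N) (2 * N ^ 6)"

definition red_arc :: "(nat \<Rightarrow> nat \<Rightarrow> bool) \<Rightarrow> (nat \<Rightarrow> nat \<Rightarrow> bool) \<Rightarrow> nat \<Rightarrow> nat \<Rightarrow> nat \<Rightarrow> bool" where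
  "red_arc f g N i j \<longleftrightarrow> arcN (mix_B N) (2 * N ^ 6) (incN (mix_B N) mix_hits (mix_lit f g N)) i j"

lemma red_center:
  obtains E where "ugraph {0..<red_size N} E" "\<And>i j. {i, j} \<in> E \<longleftrightarrow> red_arc f g N i j \<or> red_arc f g N j i"
    "card (broadcast_center {0..<red_size N} E) = 3 \<longleftrightarrow> cnf_sat N f \<and> \<not> cnf_sat N g"
proof -
  interpret gadget "mix_B N" "2 * N ^ 6" "2 * N ^ 4" mix_hits "mix_lit f g N" by (rule mix_gadget)
  have sat0: "sat 0" unfolding sat_def by (simp add: mix_hits_def)
  have sat1: "sat 1 \<longleftrightarrow> cnf_sat N f"
  proof -
    have "mix_hits 1 j \<or> Q \<longleftrightarrow> (j mod 2 = 0 \<longrightarrow> Q)" for j Q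
    proof -
      have "j mod 2 = 0 \<or> j mod 2 = 1" by presburger
      then show ?thesis unfolding mix_hits_def by auto
    qed
    then show ?thesis unfolding sat_def using mix_sat[of 0 N f g] by simp
  qed
  have sat2: "sat u \<longleftrightarrow> cnf_sat N g" if "2 \<le> u" for u
  proof -
    have "mix_hits u j \<or> Q \<longleftrightarrow> (j mod 2 = 1 \<longrightarrow> Q)" for j Q
    proof -
      have "j mod 2 = 0 \<or> j mod 2 = 1" by presburger
      then show ?thesis unfolding mix_hits_def using that by auto
    qed
    then show ?thesis unfolding sat_def using mix_sat[of 1 N f g] by simp
  qed
  show thesis
  proof (rule that)
    show "ugraph {0..<red_size N} ((`) (num (mix_B N) (2 * N ^ 6)) ` E)"
      unfolding red_size_def by (rule ugraph_num)
    show "{i, j} \<in> (`) (num (mix_B N) (2 * N ^ 6)) ` E \<longleftrightarrow> red_arc f g N i j \<or> red_arc f g N j i" for i j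
      unfolding red_arc_def num_E inc_eq ..
    show "card (broadcast_center {0..<red_size N} ((`) (num (mix_B N) (2 * N ^ 6)) ` E)) = 3 \<longleftrightarrow> cnf_sat N f \<and> \<not> cnf_sat N g"
      unfolding red_size_def card_center[OF sat0] sat1 sat2[of 2, simplified] sat2[of 3, simplified] by auto
  qed
qed

text \<open>Position \<open>red_size N\<close> is the separating false bit. The last disjunct gives
  the two bits of the constant 3, both of which are true.\<close>

definition red_bit :: "(nat \<Rightarrow> nat \<Rightarrow> bool) \<Rightarrow> (nat \<Rightarrow> nat \<Rightarrow> bool) \<Rightarrow> nat \<Rightarrow> nat \<Rightarrow> bool" where
  "red_bit f g N k \<longleftrightarrow> k < red_size N \<or>
     red_size N < k \<and> k < red_size N + 1 + red_size N * red_size N \<and>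
       (red_arc f g N ((k - red_size N - 1) div red_size N) ((k - red_size N - 1) mod red_size N) \<or>
        red_arc f g N ((k - red_size N - 1) mod red_size N) ((k - red_size N - 1) div red_size N)) \<or>
     red_size N + 1 + red_size N * red_size N \<le> k"

definition red_length :: "nat \<Rightarrow> nat" where
  "red_length N = red_size N + 1 + red_size N * red_size N + 2"

lemma nat_bits_3: "nat_bits 3 = [True, True]"
  by (simp add: nat_bits_pos)

lemma red_encode:
  assumes "\<And>i j. {i, j} \<in> E \<longleftrightarrow> red_arc f g N i j \<or> red_arc f g N j i"
  shows "map (red_bit f g N) [0..<red_length N] = encode_instance (red_size N) E 3"
proof -
  let ?n = "red_size N"
  have enc: "encode_instance ?n E 3 = replicate ?n True @ [False] @
      map (\<lambda>k. {k div ?n, k mod ?n} \<in> E) [0..<?n * ?n] @ [True, True]"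
    by (simp add: encode_instance_def concat_blocks nat_bits_3)
  have len: "length (encode_instance ?n E 3) = red_length N"
    by (simp add: enc red_length_def)
  show ?thesis
  proof (rule nth_equalityI)
    fix k assume "k < length (map (red_bit f g N) [0..<red_length N])"
    then have k: "k < red_length N" by simp
    consider "k < ?n" | "k = ?n" | "?n < k" "k < ?n + 1 + ?n * ?n" | "?n + 1 + ?n * ?n \<le> k" by linarith
    then have "red_bit f g N k = encode_instance ?n E 3 ! k"
    proof cases
      case 1
      then show ?thesis by (simp add: red_bit_def enc nth_append)
    next
      case 2
      then show ?thesis by (simp add: red_bit_def enc nth_append)
    next
      case 3
      define i where "i = k - ?n - 1"
      have i: "k = ?n + 1 + i" "i < ?n * ?n" using 3 by (simp_all add: i_def)
      have "red_bit f g N k \<longleftrightarrow> {i div ?n, i mod ?n} \<in> E"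
        unfolding red_bit_def i_def[symmetric] assms using 3 by simp
      then show ?thesis using i by (simp add: enc nth_append)
    next
      case 4
      define i where "i = k - (?n + 1 + ?n * ?n)"
      have i: "k = ?n + 1 + ?n * ?n + i" "i < 2" using 4 k by (simp_all add: i_def red_length_def)
      then have "i = 0 \<or> i = 1" by auto
      then have "encode_instance ?n E 3 ! k" unfolding i(1) by (auto simp: enc nth_append)
      then show ?thesis using 4 by (simp add: red_bit_def)
    qed
    then show "map (red_bit f g N) [0..<red_length N] ! k = encode_instance ?n E 3 ! k" using k by simp
  qed (simp add: len)
qed

section \<open>Uniqueness of the encoding\<close>

lemma nat_bits_inj: "nat_bits m = nat_bits m' \<Longrightarrow> m = m'"
proof (induction m arbitrary: m' rule: less_induct)
  case (less m)
  show ?case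
  proof (cases "m = 0 \<or> m' = 0")
    case True
    then show ?thesis using less.prems by (cases "m = 0"; cases "m' = 0") (auto simp: nat_bits_pos)
  next
    case False
    then have "odd m = odd m'" "nat_bits (m div 2) = nat_bits (m' div 2)"
      using less.prems by (simp_all add: nat_bits_pos)
    then have "odd m = odd m'" "m div 2 = m' div 2" using less.IH[of "m div 2" "m' div 2"] False by simp_all
    then show ?thesis by presburger
  qed
qed

text \<open>Membership in \<open>BC_Size\<close> only provides some graph and number with the given
  encoding; uniqueness identifies them with the constructed ones.\<close>

lemma encode_inj:
  assumes "ugraph {0..<n} E" "ugraph {0..<n'} E'" "encode_instance n E m = encode_instance n' E' m'"
  shows "n = n'" "E = E'" "m = m'"
proof -
  show n: "n = n'" using leading_encode[of n E m] leading_encode[of n' E' m'] assms(3) by simp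
  have "nat_bits m = nat_bits m'"
  proof -
    have "drop (n + 1 + n * n) (encode_instance n E m) = nat_bits m" for E m
      by (simp add: encode_instance_def length_concat_blocks)
    then show ?thesis using assms(3) n by metis
  qed
  then show "m = m'" by (rule nat_bits_inj)
  have e: "{i, j} \<in> E \<longleftrightarrow> {i, j} \<in> E'" if "i < n" "j < n" for i j
  proof -
    have "(if {i, j} \<in> E then 2 else 1::nat) = (if {i, j} \<in> E' then 2 else 1)"
      using cell_encode(3)[OF that, of E m] cell_encode(3)[OF that, of E' m'] assms(3)[folded n] by metis
    then show ?thesis by (simp split: if_splits)
  qed
  have sub: "F \<subseteq> F'" if "ugraph {0..<n} F" "\<And>i j. i < n \<Longrightarrow> j < n \<Longrightarrow> {i, j} \<in> F \<Longrightarrow> {i, j} \<in> F'" for F F'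
  proof
    fix d assume d: "d \<in> F"
    then have "d \<subseteq> {0..<n}" "card d = 2" using that(1) by (auto simp: ugraph_def)
    then obtain i j where "d = {i, j}" "i < n" "j < n" by (auto simp: card_2_iff)
    then show "d \<in> F'" using d that(2) by simp
  qed
  show "E = E'"
  proof (rule subset_antisym)
    show "E \<subseteq> E'" by (rule sub[OF assms(1)]) (use e in blast)
    show "E' \<subseteq> E" by (rule sub[OF assms(2)[folded n]]) (use e in blast)
  qed
qed

lemma encode_BC_Size:
  assumes "ugraph {0..<n} E"
  shows "encode_instance n E m \<in> BC_Size \<longleftrightarrow> card (broadcast_center {0..<n} E) = m"
proof
  assume "encode_instance n E m \<in> BC_Size"
  then obtain n' E' m' where *: "encode_instance n E m = encode_instance n' E' m'" "ugraph {0..<n'} E'"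
    "card (broadcast_center {0..<n'} E') = m'" unfolding BC_Size_def by blast
  from encode_inj[OF assms *(2,1)] *(3) show "card (broadcast_center {0..<n} E) = m" by simp
qed (use assms in \<open>auto simp: BC_Size_def\<close>)

section \<open>Definability of the reduction\<close>

lemma d_mix_B: "definable K a \<Longrightarrow> definable K (\<lambda>Tb s. mix_B (a Tb s))"
  unfolding mix_B_def by (intro d_add d_mult d_power d_const)

lemma d_off1:
  assumes "definable K a"
  shows "definable K (\<lambda>Tb s. off_El (a Tb s))" "definable K (\<lambda>Tb s. off_Cl (a Tb s))"
  unfolding off_Cl_def off_El_def by (intro d_add d_mult d_const assms)+

lemma d_off:
  assumes "definable K a" "definable K b"
  shows "definable K (\<lambda>Tb s. off_Tl (a Tb s) (b Tb s))" "definable K (\<lambda>Tb s. off_Pa (a Tb s) (b Tb s))"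
    "definable K (\<lambda>Tb s. n_vert (a Tb s) (b Tb s))"
  unfolding n_vert_def off_Pa_def off_Tl_def off_Cl_def off_El_def
  by (intro d_add d_mult d_const assms)+

lemma d_red_size: "definable K a \<Longrightarrow> definable K (\<lambda>Tb s. red_size (a Tb s))"
  unfolding red_size_def by (intro d_off d_mix_B d_mult d_power d_const)

lemma d_red_length: "definable K a \<Longrightarrow> definable K (\<lambda>Tb s. red_length (a Tb s))"
  unfolding red_length_def by (intro d_add d_mult d_const d_red_size)

theorem reduction_from_cnf:
  fixes P :: "nat poly" and f g :: "tables \<Rightarrow> nat \<Rightarrow> nat \<Rightarrow> nat \<Rightarrow> bool"
  assumes f: "dpred {0} (\<lambda>Tb s. f Tb (s 0) (s (Suc 0)) (s (Suc (Suc 0))))"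
    and g: "dpred {0} (\<lambda>Tb s. g Tb (s 0) (s (Suc 0)) (s (Suc (Suc 0))))"
    and L1: "\<And>x. x \<in> L1 \<longleftrightarrow> cnf_sat (poly P (length x)) (f (word_tables x) (length x))"
    and L2: "\<And>x. x \<in> L2 \<longleftrightarrow> cnf_sat (poly P (length x)) (g (word_tables x) (length x))"
  shows "poly_reducible (L1 \<inter> - L2) BC_Size"
proof -
  let ?N = "\<lambda>n. poly P n"
  have inc: "dpred {0} (\<lambda>Tb s. incN (mix_B (?N (a Tb s))) mix_hits
      (mix_lit (f Tb (a Tb s)) (g Tb (a Tb s)) (?N (a Tb s))) (b Tb s) (c Tb s))"
    if "definable {0} a" "definable {0} b" "definable {0} c" for a b c
  proof (rule d_subst3[OF _ that])
    show "dpred {0} (\<lambda>Tb s. incN (mix_B (?N (s 0))) mix_hits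
      (mix_lit (f Tb (s 0)) (g Tb (s 0)) (?N (s 0))) (s (Suc 0)) (s (Suc (Suc 0))))"
      unfolding incN_def mix_hits_def mix_lit_def
      by (intro p_if p_conj p_disj p_eq p_le p_less d_subst3[OF f] d_subst3[OF g] d_mix_B d_add d_mult d_sub
          d_div d_mod d_power d_poly d_const d_var)
  qed
  have arc: "dpred {0} (\<lambda>Tb s. red_arc (f Tb (a Tb s)) (g Tb (a Tb s)) (?N (a Tb s)) (b Tb s) (c Tb s))"
    if "definable {0} a" "definable {0} b" "definable {0} c" for a b c
  proof (rule d_subst3[OF _ that])
    show "dpred {0} (\<lambda>Tb s. red_arc (f Tb (s 0)) (g Tb (s 0)) (?N (s 0)) (s (Suc 0)) (s (Suc (Suc 0))))"
      unfolding red_arc_def arcN_def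
      by (intro p_disj p_conj p_ex p_eq inc d_off1 d_off d_mix_B d_add d_mult d_Suc d_power d_poly d_const d_var)
  qed
  have bit: "dpred {0} (\<lambda>Tb s. red_bit (f Tb (s (Suc 0))) (g Tb (s (Suc 0))) (?N (s (Suc 0))) (s 0))"
    unfolding red_bit_def
    by (intro p_disj p_conj p_less p_le arc d_red_size d_add d_sub d_mult d_div d_mod d_poly d_const d_var)
  have len: "definable {0} (\<lambda>Tb s. red_length (?N (s 0)))"
    by (intro d_red_length d_poly d_var)
  define r where "r x = map (red_bit (f (word_tables x) (length x)) (g (word_tables x) (length x)) (?N (length x)))
      [0..<red_length (?N (length x))]" for x
  have "poly_time_computable r"
    using definable_poly_time_computable[OF len bit] unfolding r_def by simp
  moreover have "x \<in> L1 \<inter> - L2 \<longleftrightarrow> r x \<in> BC_Size" for x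
  proof -
    let ?f = "f (word_tables x) (length x)" and ?g = "g (word_tables x) (length x)"
    obtain E where E: "ugraph {0..<red_size (?N (length x))} E"
      "\<And>i j. {i, j} \<in> E \<longleftrightarrow> red_arc ?f ?g (?N (length x)) i j \<or> red_arc ?f ?g (?N (length x)) j i"
      "card (broadcast_center {0..<red_size (?N (length x))} E) = 3 \<longleftrightarrow>
         cnf_sat (?N (length x)) ?f \<and> \<not> cnf_sat (?N (length x)) ?g"
      using red_center[of "?N (length x)" ?f ?g] by blast
    have "r x = encode_instance (red_size (?N (length x))) E 3"
      unfolding r_def by (rule red_encode[OF E(2)])
    then show ?thesis using encode_BC_Size[OF E(1)] E(3) L1 L2 by simp
  qed
  ultimately show ?thesis unfolding poly_reducible_def by blast
qed

section \<open>Tableaux\<close>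

hide_const (open) R T S

text \<open>A code \<open>a\<close> lists in base \<open>G\<close> the symbols scanned on the \<open>k\<close> tapes, followed by the state.\<close>

definition dg :: "nat \<Rightarrow> nat \<Rightarrow> nat \<Rightarrow> nat" where
  "dg G a i = a div G ^ i mod G"

lemma code_exists:
  assumes "\<And>i. i < n \<Longrightarrow> y i < G"
  shows "\<exists>a<G ^ n. \<forall>i<n. dg G a i = y i"
  using assms
proof (induction n arbitrary: y)
  case (Suc n)
  obtain a where a: "a < G ^ n" "\<forall>i<n. dg G a i = y (Suc i)"
    using Suc.IH[of "\<lambda>i. y (Suc i)"] Suc.prems by auto
  have y0: "y 0 < G" using Suc.prems by simp
  define b where "b = a * G + y 0"
  have "b < G ^ n * G" unfolding b_def by (rule mult_add_less[OF a(1) y0])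
  moreover have "dg G b i = y i" if "i < Suc n" for i
  proof (cases i)
    case 0
    then show ?thesis using div_mod_digit[OF y0, of a] by (simp add: dg_def b_def)
  next
    case (Suc i')
    then have "dg G b i = dg G a i'"
      using div_mod_digit(1)[OF y0, of a] by (simp add: dg_def b_def div_mult2_eq)
    then show ?thesis using a(2) Suc that by simp
  qed
  ultimately show ?case by (intro exI[of _ b]) (simp add: mult.commute)
qed simp

text \<open>The effect of a step depends only on the finitely many codes. Halting states idle, just
  as they are fixed points of \<open>tm_step\<close>.\<close>

definition act :: "nat \<Rightarrow> nat \<Rightarrow> machine \<Rightarrow> nat \<Rightarrow> nat \<times> (nat \<times> move) list" where
  "act k G M a = (let ss = map (dg G a) [0..<k] in
     if dg G a k < length M then
       (case M ! dg G a k of Act \<delta> \<Rightarrow> \<delta> ss | Query y n \<Rightarrow> (dg G a k, map (\<lambda>s. (s, MStay)) ss))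
     else (dg G a k, map (\<lambda>s. (s, MStay)) ss))"

definition wr :: "nat \<Rightarrow> nat \<Rightarrow> machine \<Rightarrow> nat \<Rightarrow> nat \<Rightarrow> nat" where
  "wr k G M a i = (if i < k then fst (snd (act k G M a) ! i) else fst (act k G M a))"

text \<open>Cells are numbered relative to the head, so a move shifts the contents: the new cell
  \<open>j\<close> is the old cell \<open>j + mv - 1\<close>, where the offset 1 avoids negative
  numbers. The tape of the state does not shift.\<close>

definition mv :: "nat \<Rightarrow> nat \<Rightarrow> machine \<Rightarrow> nat \<Rightarrow> nat \<Rightarrow> nat" where
  "mv k G M a i = (if i < k then case snd (snd (act k G M a) ! i) of MLeft \<Rightarrow> 0 | MStay \<Rightarrow> 1 | MRight \<Rightarrow> 2 else 1)"

text \<open>Cell \<open>W\<close> is the scanned one; the state is kept in the scanned cell of an additional tape \<open>k\<close>.\<close>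

definition tab_cell :: "nat \<Rightarrow> nat \<Rightarrow> config \<Rightarrow> nat \<Rightarrow> nat \<Rightarrow> nat" where
  "tab_cell k W c i j = (if i < k then fst (snd c ! i) (snd (snd c ! i) + int j - int W) else if j = W then fst c else 0)"

definition ok_config :: "nat \<Rightarrow> nat \<Rightarrow> machine \<Rightarrow> config \<Rightarrow> bool" where
  "ok_config k g M c \<longleftrightarrow> fst c \<le> rej M \<and> length (snd c) = k \<and> (\<forall>i<k. \<forall>j. fst (snd c ! i) j < g)"

lemma tab_cell_scanned: "i < k \<Longrightarrow> tab_cell k W c i W = tape_read (snd c ! i)" "tab_cell k W c k W = fst c"
  by (simp_all add: tab_cell_def tape_read_def)

lemma tab_cell_bound:
  assumes "ok_config k g M c" "i \<le> k"
  shows "tab_cell k W c i j < g + length M + 2"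
proof (cases "i < k")
  case True
  then have "tab_cell k W c i j < g" using assms by (simp add: ok_config_def tab_cell_def)
  then show ?thesis by simp
next
  case False
  then show ?thesis using assms by (simp add: ok_config_def tab_cell_def rej_def)
qed

lemma tm_step_act:
  assumes M: "tm k g M" and ok: "ok_config k g M c" and a: "\<And>i. i \<le> k \<Longrightarrow> dg G a i = tab_cell k W c i W"
  shows "tm_step M {} c = (fst (act k G M a), map2 tape_act (snd (act k G M a)) (snd c))"
    "length (snd (act k G M a)) = k" "fst (act k G M a) \<le> rej M" "\<forall>x\<in>set (snd (act k G M a)). fst x < g"
proof -
  obtain q ts where c: "c = (q, ts)" by (cases c)
  have len: "length ts = k" and q: "q \<le> rej M" and sym: "\<And>i j. i < k \<Longrightarrow> fst (ts ! i) j < g"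
    using ok by (auto simp: ok_config_def c)
  have ss: "map (dg G a) [0..<k] = map tape_read ts"
    by (rule nth_equalityI) (use a len in \<open>auto simp: tab_cell_scanned c\<close>)
  have dk: "dg G a k = q" using a[of k] by (simp add: tab_cell_scanned c)
  have read: "\<forall>s\<in>set (map tape_read ts). s < g"
  proof
    fix s assume "s \<in> set (map tape_read ts)"
    then obtain i where "i < length ts" "s = tape_read (ts ! i)" by (auto simp: in_set_conv_nth)
    then show "s < g" using sym len by (simp add: tape_read_def)
  qed
  have "tm_step M {} c = (fst (act k G M a), map2 tape_act (snd (act k G M a)) (snd c)) \<and>
    length (snd (act k G M a)) = k \<and> fst (act k G M a) \<le> rej M \<and> (\<forall>x\<in>set (snd (act k G M a)). fst x < g)"
  proof (cases "q < length M")
    case True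
    then have m: "M ! q \<in> set M" by simp
    then obtain \<delta> where \<delta>: "M ! q = Act \<delta>" using M unfolding tm_def by blast
    have "wf_cmd k g M (Act \<delta>)" using M m unfolding \<delta>[symmetric] tm_def oracle_tm_def by blast
    then have wf: "fst (\<delta> (map tape_read ts)) \<le> rej M \<and> length (snd (\<delta> (map tape_read ts))) = k \<and>
      (\<forall>x\<in>set (snd (\<delta> (map tape_read ts))). fst x < g)"
      unfolding wf_cmd.simps by (elim allE[of _ "map tape_read ts"] impE) (use read len in simp_all)
    have "act k G M a = \<delta> (map tape_read ts)" unfolding act_def Let_def dk ss using True \<delta> by simp
    then show ?thesis using wf True \<delta> by (simp add: tm_step_def c case_prod_unfold Let_def)
  next
    case False
    then have ac: "act k G M a = (q, map (\<lambda>s. (s, MStay)) (map tape_read ts))"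
      unfolding act_def Let_def dk ss by simp
    have "map2 tape_act (map (\<lambda>s. (s, MStay)) (map tape_read ts)) ts = ts"
      by (rule nth_equalityI) auto
    then show ?thesis using False q read len by (simp add: ac tm_step_def c)
  qed
  then show "tm_step M {} c = (fst (act k G M a), map2 tape_act (snd (act k G M a)) (snd c))"
    "length (snd (act k G M a)) = k" "fst (act k G M a) \<le> rej M" "\<forall>x\<in>set (snd (act k G M a)). fst x < g"
    by blast+
qed

text \<open>With the scanned cell fixed at \<open>W\<close>, the cells to be rewritten are known in
  advance, and head positions need no variables of their own. Treating the state as one more scanned
  symbol makes the same rule cover its change.\<close>

lemma tab_cell_step:
  assumes M: "tm k g M" and ok: "ok_config k g M c" and a: "\<And>i. i \<le> k \<Longrightarrow> dg G a i = tab_cell k W c i W"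
    and i: "i \<le> k" and j: "1 \<le> j + mv k G M a i"
  shows "tab_cell k W (tm_step M {} c) i j =
    (if j + mv k G M a i = W + 1 then wr k G M a i else tab_cell k W c i (j + mv k G M a i - 1))"
proof (cases "i < k")
  case True
  note step = tm_step_act[OF M ok a]
  have len: "length (snd c) = k" using ok by (simp add: ok_config_def)
  obtain w m where wm: "snd (act k G M a) ! i = (w, m)" by (cases "snd (act k G M a) ! i")
  have t: "snd (tm_step M {} c) ! i = tape_act (w, m) (snd c ! i)"
    using step(1,2) True len wm by simp
  have mp: "move_pos m h = h + int (mv k G M a i) - 1" for h
    using True wm by (cases m) (auto simp: mv_def)
  show ?thesis using True j wm
    by (auto simp: tab_cell_def t tape_act_def mp wr_def of_nat_diff algebra_simps)
next
  case False
  note step = tm_step_act[OF M ok a]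
  have "i = k" "mv k G M a i = 1" "wr k G M a i = fst (act k G M a)" using False i by (simp_all add: mv_def wr_def)
  then show ?thesis using step(1) by (simp add: tab_cell_def)
qed

lemma ok_config_step:
  assumes M: "tm k g M" and ok: "ok_config k g M c"
  shows "ok_config k g M (tm_step M {} c)"
proof -
  define G where "G = g + length M + 2"
  have "tab_cell k 0 c i 0 < G" if "i < Suc k" for i
    unfolding G_def using tab_cell_bound[OF ok] that by simp
  from code_exists[of "Suc k" "\<lambda>i. tab_cell k 0 c i 0", OF this]
  obtain a where a: "\<And>i. i \<le> k \<Longrightarrow> dg G a i = tab_cell k 0 c i 0" by (auto simp: less_Suc_eq_le)
  note step = tm_step_act[OF M ok a]
  have len: "length (snd c) = k" using ok by (simp add: ok_config_def)
  have "fst (snd (tm_step M {} c) ! i) j < g" if i: "i < k" for i j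
  proof -
    have "fst (snd (act k G M a) ! i) < g" using step(2,4) i by simp
    moreover have "fst (snd c ! i) j < g" using ok i by (simp add: ok_config_def)
    ultimately show ?thesis using step(1,2) i len by (simp add: tape_act_def)
  qed
  then show ?thesis using step(1-3) len by (simp add: ok_config_def)
qed

lemma ok_config_run:
  assumes M: "tm k g M"
  shows "ok_config k g M (run M {} k ws t)"
proof (induction t)
  case 0
  have "3 \<le> g" using M by (simp add: tm_def oracle_tm_def)
  then show ?case by (auto simp: run_def ok_config_def start_def tape_of_def)
next
  case (Suc t)
  then show ?case using ok_config_step[OF M] by (simp add: run_def)
qed

section \<open>Variables and clauses of a tableau\<close>

definition vcode :: "nat \<Rightarrow> nat \<Rightarrow> nat \<Rightarrow> nat \<Rightarrow> nat \<Rightarrow> nat" where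
  "vcode N t i j s = ((s * N + j) * N + i) * N + t"

lemma vcode_digits:
  assumes "t < N" "i < N" "j < N"
  shows "vcode N t i j s mod N = t" "vcode N t i j s div N mod N = i"
    "vcode N t i j s div N div N mod N = j" "vcode N t i j s div N div N div N = s"
  unfolding vcode_def div_mod_digit(1)[OF assms(1)] div_mod_digit(1)[OF assms(2)] div_mod_digit(1)[OF assms(3)]
  by (intro div_mod_digit assms refl)+

lemma vcode_less:
  assumes "t < N" "i < N" "j < N" "s < N"
  shows "vcode N t i j s < N ^ 4"
proof -
  have "vcode N t i j s < N * N * N * N" unfolding vcode_def by (intro mult_add_less assms)
  then show ?thesis by (simp add: eval_nat_numeral)
qed

text \<open>The variable \<open>vcode N t i j s\<close> says that cell \<open>j\<close> of tape \<open>i\<close> contains \<open>s\<close> after \<open>t\<close> steps.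
  The clauses say for \<open>f = 0\<close> that a step is performed correctly, for \<open>f = 1, 2, 3\<close> that the tableau
  starts with an initial configuration and for \<open>f = 4\<close> that it ends in the state \<open>ac\<close>. Indices out of
  range yield trivial clauses.\<close>

definition clause :: "nat \<Rightarrow> nat \<Rightarrow> nat \<Rightarrow> nat \<Rightarrow> (nat \<Rightarrow> nat \<Rightarrow> nat) \<Rightarrow> (nat \<Rightarrow> nat \<Rightarrow> nat) \<Rightarrow> (nat \<Rightarrow> nat \<Rightarrow> nat) \<Rightarrow>
    nat \<Rightarrow> nat \<Rightarrow> nat \<Rightarrow> nat \<Rightarrow> (nat \<Rightarrow> nat) \<Rightarrow> nat \<Rightarrow> nat \<Rightarrow> nat \<Rightarrow> nat \<Rightarrow> nat \<Rightarrow> nat \<Rightarrow> nat \<Rightarrow> bool" where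
  "clause k G K ac rd wt mt T R W N X f a t i j s l \<longleftrightarrow>
    (if f = 0 then
       a < K \<and> t < T \<and> i \<le> k \<and> j \<le> 2 * W \<and> 1 \<le> j + mt a i \<and> j + mt a i \<le> 2 * W + 1 \<and> s < G \<longrightarrow>
         (\<exists>i'<k + 1. l = 2 * vcode N t i' W (rd a i')) \<or>
         (if j + mt a i = W + 1 then l = 2 * vcode N (t + 1) i j (wt a i) + 1
          else l = 2 * vcode N t i (j + mt a i - 1) s \<or> l = 2 * vcode N (t + 1) i j s + 1)
     else if f = 1 then
       i \<le> k \<and> j \<le> 2 * W \<and> \<not> (i = 1 \<and> W \<le> j \<and> j < W + R) \<longrightarrow>
         l = 2 * vcode N 0 i j (if i = 0 \<and> W \<le> j then X (j - W) else 0) + 1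
     else if f = 2 then W \<le> j \<and> j < W + R \<longrightarrow> (\<exists>s<3. l = 2 * vcode N 0 1 j s + 1)
     else if f = 3 then
       W \<le> j \<and> j + 1 < W + R \<longrightarrow> l = 2 * vcode N 0 1 j 0 \<or> l = 2 * vcode N 0 1 (j + 1) 0 + 1
     else f = 4 \<longrightarrow> s < G \<and> s \<noteq> ac \<longrightarrow> l = 2 * vcode N T k W s)"

definition all_clauses :: "(nat \<Rightarrow> nat \<Rightarrow> nat \<Rightarrow> nat \<Rightarrow> nat \<Rightarrow> nat \<Rightarrow> nat \<Rightarrow> bool) \<Rightarrow> nat \<Rightarrow> (nat \<Rightarrow> bool) \<Rightarrow> bool" where
  "all_clauses C N y \<longleftrightarrow> (\<forall>f<N. \<forall>a<N. \<forall>t<N. \<forall>i<N. \<forall>j<N. \<forall>s<N. \<exists>v<N ^ 4. C f a t i j s (2 * v + of_bool (y v)))"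

lemma cnf_sat_all_clauses:
  "cnf_sat N (\<lambda>c l. C (dg N c 0) (dg N c 1) (dg N c 2) (dg N c 3) (dg N c 4) (dg N c 5) l) \<longleftrightarrow> (\<exists>y. all_clauses C N y)"
proof -
  have "(\<forall>c<N ^ 6. \<exists>v<N ^ 4. C (dg N c 0) (dg N c 1) (dg N c 2) (dg N c 3) (dg N c 4) (dg N c 5) (2 * v + of_bool (y v))) \<longleftrightarrow>
      all_clauses C N y" for y
  proof
    assume *: "\<forall>c<N ^ 6. \<exists>v<N ^ 4. C (dg N c 0) (dg N c 1) (dg N c 2) (dg N c 3) (dg N c 4) (dg N c 5) (2 * v + of_bool (y v))"
    show "all_clauses C N y"
      unfolding all_clauses_def
    proof (intro allI impI)
      fix f a t i j s assume lt: "f < N" "a < N" "t < N" "i < N" "j < N" "s < N"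
      define d where "d n = [f, a, t, i, j, s] ! n" for n
      have "d n < N" if "n < 6" for n
      proof -
        have "d n \<in> set [f, a, t, i, j, s]" unfolding d_def by (rule nth_mem) (use that in simp)
        then show ?thesis using lt by auto
      qed
      from code_exists[of 6 d N, OF this] obtain c where c: "c < N ^ 6" "\<forall>n<6. dg N c n = d n" by blast
      then have "dg N c 0 = f" "dg N c 1 = a" "dg N c 2 = t" "dg N c 3 = i" "dg N c 4 = j" "dg N c 5 = s"
        by (simp_all add: d_def)
      with * c(1) show "\<exists>v<N ^ 4. C f a t i j s (2 * v + of_bool (y v))" by metis
    qed
  next
    assume *: "all_clauses C N y"
    show "\<forall>c<N ^ 6. \<exists>v<N ^ 4. C (dg N c 0) (dg N c 1) (dg N c 2) (dg N c 3) (dg N c 4) (dg N c 5) (2 * v + of_bool (y v))"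
    proof (intro allI impI)
      fix c assume "c < N ^ 6"
      then have "0 < N" by (cases N) auto
      then have "dg N c n < N" for n by (simp add: dg_def)
      then show "\<exists>v<N ^ 4. C (dg N c 0) (dg N c 1) (dg N c 2) (dg N c 3) (dg N c 4) (dg N c 5) (2 * v + of_bool (y v))"
        using * unfolding all_clauses_def by blast
    qed
  qed
  then show ?thesis unfolding cnf_sat_def by blast
qed

lemma lit_eq: "2 * v + of_bool b = 2 * c + 1 \<longleftrightarrow> v = c \<and> b" "2 * v + of_bool b = 2 * c \<longleftrightarrow> v = c \<and> \<not> b"
  "2 * v + of_bool b = Suc (2 * c) \<longleftrightarrow> v = c \<and> b" for v c :: nat
  by (cases b; simp; presburger)+

lemma tab_cell_start:
  assumes "2 \<le> k" "i \<le> k"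
  shows "tab_cell k W (run M {} k [x, u] 0) i j =
    (if i = 0 \<and> W \<le> j then cell x (j - W) else if i = 1 \<and> W \<le> j then cell u (j - W) else 0)"
proof -
  have "fst (tape_of w) (int j - int W) = (if W \<le> j then cell w (j - W) else 0)" for w
  proof (cases "W \<le> j")
    case True
    then have "int j - int W = int (j - W)" by simp
    then show ?thesis using True fst_tape_of[of w "j - W"] by simp
  qed (simp add: fst_tape_of_neg)
  moreover have "cell [] n = 0" for n by (simp add: cell_def)
  ultimately show ?thesis using assms
    by (auto simp: run_def start_def tab_cell_def nth_Cons' less_Suc_eq eval_nat_numeral)
qed

text \<open>Apart from \<open>f = 4\<close> the clauses only force symbols to be present. From an
  assignment it is therefore shown by induction that the true symbol of each cell is asserted;
  further symbols asserted in the same cell do no harm. In particular the true final state is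
  asserted, and the clauses for \<open>f = 4\<close> deny every state other than the accepting
  one.\<close>

lemma tableau_correct:
  assumes M: "tm k g M" and G: "G = g + length M + 2" and K: "K = G ^ Suc k"
    and tabs: "\<And>a i. a < K \<Longrightarrow> i \<le> k \<Longrightarrow> rd a i = dg G a i \<and> wt a i = wr k G M a i \<and> mt a i = mv k G M a i"
    and N: "K \<le> N" "G \<le> N" "T < N" "2 * W < N" "4 < N" "k < N" and TW: "T \<le> W" "R \<le> W"
  shows "(\<exists>y. all_clauses (clause k G K (acc M) rd wt mt T R W N (cell x)) N y) \<longleftrightarrow>
    (\<exists>u. length u \<le> R \<and> fst (run M {} k [x, u] T) = acc M)"
proof
  have k2: "2 \<le> k" "3 \<le> g" using M by (auto simp: tm_def oracle_tm_def)
  assume "\<exists>y. all_clauses (clause k G K (acc M) rd wt mt T R W N (cell x)) N y"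
  then obtain y where y: "\<And>f a t i j s. f < N \<Longrightarrow> a < N \<Longrightarrow> t < N \<Longrightarrow> i < N \<Longrightarrow> j < N \<Longrightarrow> s < N \<Longrightarrow>
      \<exists>v. clause k G K (acc M) rd wt mt T R W N (cell x) f a t i j s (2 * v + of_bool (y v))"
    unfolding all_clauses_def by meson
  define val where "val t i j s = y (vcode N t i j s)" for t i j s
  have cl2: "\<exists>s<3. val 0 1 j s" if "W \<le> j" "j < W + R" for j
    using y[of 2 0 0 0 j 0] N TW that by (auto simp: clause_def lit_eq val_def)
  have cl3: "val 0 1 (j + 1) 0" if "val 0 1 j 0" "W \<le> j" "j + 1 < W + R" for j
    using y[of 3 0 0 0 j 0] N TW that by (auto simp: clause_def lit_eq val_def)
  \<comment> \<open>The certificate ends at the first cell asserted to be blank, and the clauses for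
    \<open>f = 3\<close> spread the blank to the right. A cell before it that asserts both bits is
    read as true.\<close>
  define len where "len = (LEAST c. c = R \<or> val 0 1 (W + c) 0)"
  have len: "len \<le> R" "len = R \<or> val 0 1 (W + len) 0"
    unfolding len_def by (rule Least_le, simp) (rule LeastI[of _ R], simp)
  have before: "\<not> val 0 1 (W + c) 0" if "c < len" for c using not_less_Least that unfolding len_def by blast
  have after: "val 0 1 (W + c) 0" if "len \<le> c" "c < R" for c
    using that
  proof (induction c rule: dec_induct)
    case base
    then show ?case using len by auto
  next
    case (step c)
    then show ?case using cl3[of "W + c"] by simp
  qed
  define u where "u = map (\<lambda>c. val 0 1 (W + c) 2) [0..<len]"
  have cert: "val 0 1 (W + c) (cell u c)" if cR: "c < R" for c
  proof (cases "c < len")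
    case True
    obtain s where s: "s < 3" "val 0 1 (W + c) s" using cl2[of "W + c"] cR by auto
    then have "s \<noteq> 0" using before[OF True] by metis
    then have "s = 1 \<or> s = 2" using s by auto
    then show ?thesis using s True by (auto simp: u_def cell_def)
  next
    case False
    then show ?thesis using after cR by (simp add: u_def cell_def)
  qed
  let ?Y = "\<lambda>t. tab_cell k W (run M {} k [x, u] t)"
  have bound: "?Y t i j < G" if "i \<le> k" for t i j
    unfolding G by (rule tab_cell_bound[OF ok_config_run[OF M] that])
  \<comment> \<open>Each step may shift a tape by one cell, so the window of known cells shrinks by
    one at both ends. Because of \<open>T \<le> W\<close> it still contains the scanned cell at time
    \<open>T\<close>.\<close>
  have main: "val t i j (?Y t i j)" if "t \<le> T" "i \<le> k" "t \<le> j" "j + t \<le> 2 * W" for t i j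
    using that
  proof (induction t arbitrary: i j)
    case 0
    show ?case
    proof (cases "i = 1 \<and> W \<le> j \<and> j < W + R")
      case True
      then have "j - W < R" by linarith
      then show ?thesis using True cert[of "j - W"] tab_cell_start[OF k2(1), of 1 W M x u j] k2 by simp
    next
      case False
      have "cell u (j - W) = 0" if "i = 1" "W \<le> j"
      proof -
        have "len \<le> j - W" using False that len(1) by auto
        then show ?thesis by (simp add: cell_def u_def)
      qed
      then have "?Y 0 i j = (if i = 0 \<and> W \<le> j then cell x (j - W) else 0)"
        using tab_cell_start[OF k2(1) 0(2), of W M x u j] by auto
      moreover have "val 0 i j (if i = 0 \<and> W \<le> j then cell x (j - W) else 0)"
        using y[of 1 0 0 i j 0] N 0 False by (auto simp: clause_def lit_eq val_def split: if_splits)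
      ultimately show ?thesis by simp
    qed
  next
    case (Suc t)
    have "?Y t i W < G" if "i < Suc k" for i using bound that by simp
    from code_exists[of "Suc k" "\<lambda>i. ?Y t i W", OF this]
    obtain a where a: "a < K" "\<And>i. i \<le> k \<Longrightarrow> dg G a i = ?Y t i W" unfolding K by (auto simp: less_Suc_eq_le)
    have mv: "mv k G M a i \<le> 2" by (simp add: mv_def split: move.split)
    have tb: "rd a i' = ?Y t i' W" if "i' \<le> k" for i' using tabs[OF a(1) that] a(2)[OF that] by simp
    have ti: "wt a i = wr k G M a i" "mt a i = mv k G M a i" using tabs[OF a(1) Suc.prems(2)] by simp_all
    have scan: "val t i' W (rd a i')" if "i' \<le> k" for i'
      unfolding tb[OF that] by (rule Suc.IH) (use Suc.prems TW that in auto)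
    define s where "s = ?Y t i (j + mt a i - 1)"
    have j1: "1 \<le> j + mt a i" "j + mt a i \<le> 2 * W + 1" using Suc.prems mv ti by auto
    have vs: "val t i (j + mt a i - 1) s"
      unfolding s_def by (rule Suc.IH) (use Suc.prems mv ti in auto)
    have sG: "s < G" unfolding s_def using bound Suc.prems by simp
    have step: "?Y (Suc t) i j = (if j + mt a i = W + 1 then wt a i else s)"
      using tab_cell_step[OF M ok_config_run[OF M, of "[x, u]" t] a(2) Suc.prems(2), of j] j1 unfolding ti s_def
      by (simp add: run_def)
    have "\<exists>v. clause k G K (acc M) rd wt mt T R W N (cell x) 0 a t i j s (2 * v + of_bool (y v))"
      by (rule y) (use N a(1) sG Suc.prems in auto)
    then have "if j + mt a i = W + 1 then val (Suc t) i j (wt a i) else val (Suc t) i j s"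
      using a(1) j1 sG Suc.prems scan vs
      by (auto simp: clause_def lit_eq val_def less_Suc_eq_le split: if_splits)
    then show ?case unfolding step by (simp split: if_splits)
  qed
  have "val T k W (fst (run M {} k [x, u] T))"
    using main[of T k W] TW by (simp add: tab_cell_scanned)
  moreover have "fst (run M {} k [x, u] T) < G" using bound[of k T W] by (simp add: tab_cell_scanned)
  ultimately have "fst (run M {} k [x, u] T) = acc M"
    using y[of 4 0 0 0 0 "fst (run M {} k [x, u] T)"] N by (auto simp: clause_def lit_eq val_def)
  moreover have "length u \<le> R" using len by (simp add: u_def)
  ultimately show "\<exists>u. length u \<le> R \<and> fst (run M {} k [x, u] T) = acc M" by blast
next
  have k2: "2 \<le> k" "3 \<le> g" using M by (auto simp: tm_def oracle_tm_def)
  assume "\<exists>u. length u \<le> R \<and> fst (run M {} k [x, u] T) = acc M"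
  then obtain u where u: "length u \<le> R" "fst (run M {} k [x, u] T) = acc M" by blast
  let ?Y = "\<lambda>t. tab_cell k W (run M {} k [x, u] t)"
  \<comment> \<open>The number of a variable is decoded into time, tape, cell and symbol, and its
    value is read off from the actual run.\<close>
  define y where "y v \<longleftrightarrow> ?Y (v mod N) (v div N mod N) (v div N div N mod N) = v div N div N div N" for v
  have y: "y (vcode N t i j s) \<longleftrightarrow> ?Y t i j = s" if "t < N" "i < N" "j < N" for t i j s
    unfolding y_def vcode_digits[OF that] ..
  have bound: "?Y t i j < G" if "i \<le> k" for t i j
    unfolding G by (rule tab_cell_bound[OF ok_config_run[OF M] that])
  have posI: "\<exists>v<N ^ 4. Q (2 * v + of_bool (y v))" if "Q (2 * vcode N t i j s + 1)" "?Y t i j = s" "t < N" "i \<le> k" "j < N" for Q t i j s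
  proof -
    have "i < N" "s < N" using that bound[OF that(4), of t j] N by auto
    then show ?thesis using that y[of t i j s] vcode_less[of t N i j s]
      by (intro exI[of _ "vcode N t i j s"]) simp
  qed
  have negI: "\<exists>v<N ^ 4. Q (2 * v + of_bool (y v))" if "Q (2 * vcode N t i j s)" "?Y t i j \<noteq> s" "t < N" "i \<le> k" "j < N" "s < N" for Q t i j s
    using that y[of t i j s] vcode_less[of t N i j s] N by (intro exI[of _ "vcode N t i j s"]) simp
  have triv: "\<exists>v<N ^ 4. Q (2 * v + of_bool (y v))" if "\<And>l. Q l" for Q :: "nat \<Rightarrow> bool"
    using that N by (intro exI[of _ 0]) simp
  have "all_clauses (clause k G K (acc M) rd wt mt T R W N (cell x)) N y"
    unfolding all_clauses_def
  proof (intro allI impI)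
    fix f a t i j s assume lt: "f < N" "a < N" "t < N" "i < N" "j < N" "s < N"
    let ?C = "clause k G K (acc M) rd wt mt T R W N (cell x) f a t i j s"
    consider "f = 0" | "f = 1" | "f = 2" | "f = 3" | "f = 4" | "4 < f" by linarith
    then show "\<exists>v<N ^ 4. ?C (2 * v + of_bool (y v))"
    proof cases
      case 1
      show ?thesis
      proof (cases "a < K \<and> t < T \<and> i \<le> k \<and> j \<le> 2 * W \<and> 1 \<le> j + mt a i \<and> j + mt a i \<le> 2 * W + 1 \<and> s < G")
        case c: True
        then have c': "a < K" "t < T" "i \<le> k" "j \<le> 2 * W" "1 \<le> j + mt a i" "j + mt a i \<le> 2 * W + 1" "s < G" by auto
        have C: "?C l \<longleftrightarrow> (\<exists>i'<k + 1. l = 2 * vcode N t i' W (rd a i')) \<or>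
         (if j + mt a i = W + 1 then l = 2 * vcode N (t + 1) i j (wt a i) + 1
          else l = 2 * vcode N t i (j + mt a i - 1) s \<or> l = 2 * vcode N (t + 1) i j s + 1)" for l
          unfolding clause_def using 1 c' by simp
        have less: "t + 1 < N" "W < N" "j + mt a i - 1 < N" using c' N by linarith+
        show ?thesis
        \<comment> \<open>A code \<open>a\<close> that differs from the scanned symbols satisfies
          the clause by one of its negative literals; otherwise \<open>act\<close> describes the
          step that was performed.\<close>
        proof (cases "\<exists>i'\<le>k. ?Y t i' W \<noteq> dg G a i'")
          case True
          then obtain i' where i': "i' \<le> k" "?Y t i' W \<noteq> dg G a i'" by blast
          have "dg G a i' < N" using N G by (auto simp: dg_def intro: less_le_trans[OF mod_less_divisor])
          moreover have "rd a i' = dg G a i'" "i' < k + 1" using tabs[OF c'(1) i'(1)] i'(1) by simp_all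
          then have "?C (2 * vcode N t i' W (dg G a i'))" unfolding C by metis
          ultimately show ?thesis using negI[of ?C t i' W "dg G a i'"] i' lt(3) less(2) by blast
        next
          case False
          then have a: "\<And>i. i \<le> k \<Longrightarrow> dg G a i = ?Y t i W" by auto
          have tb: "wt a i = wr k G M a i" "mt a i = mv k G M a i" using tabs[OF c'(1,3)] by auto
          have step: "?Y (t + 1) i j = (if j + mt a i = W + 1 then wt a i else ?Y t i (j + mt a i - 1))"
            using tab_cell_step[OF M ok_config_run[OF M, of "[x, u]" t] a c'(3), of j] c'(5) unfolding tb
            by (simp add: run_def)
          show ?thesis
          proof (cases "j + mt a i = W + 1")
            case True
            then have "?C (2 * vcode N (t + 1) i j (wt a i) + 1)" unfolding C by simp
            moreover have "?Y (t + 1) i j = wt a i" using step True by simp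
            ultimately show ?thesis using posI[of ?C "t + 1" i j "wt a i"] c'(3) less(1) lt(5) by blast
          next
            case F: False
            show ?thesis
            proof (cases "?Y t i (j + mt a i - 1) = s")
              case True
              then have "?Y (t + 1) i j = s" using step F by simp
              moreover have "?C (2 * vcode N (t + 1) i j s + 1)" unfolding C using F by simp
              ultimately show ?thesis using posI[of ?C "t + 1" i j s] c'(3) less(1) lt(5) by blast
            next
              case False
              moreover have "?C (2 * vcode N t i (j + mt a i - 1) s)" unfolding C using F by simp
              ultimately show ?thesis using negI[of ?C t i "j + mt a i - 1" s] c'(3) less(3) lt(3,6) by blast
            qed
          qed
        qed
      next
        case False
        then show ?thesis using 1 by (intro triv) (auto simp: clause_def)
      qed
    next
      case 2
      show ?thesis
      proof (cases "i \<le> k \<and> j \<le> 2 * W \<and> \<not> (i = 1 \<and> W \<le> j \<and> j < W + R)")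
        case c: True
        have "cell u (j - W) = 0" if "i = 1" "W \<le> j"
        proof -
          have "length u \<le> j - W" using c that u(1) by auto
          then show ?thesis by (simp add: cell_def)
        qed
        then have "?Y 0 i j = (if i = 0 \<and> W \<le> j then cell x (j - W) else 0)"
          using tab_cell_start[OF k2(1), of i W M x u j] c by auto
        moreover have "?C (2 * vcode N 0 i j (if i = 0 \<and> W \<le> j then cell x (j - W) else 0) + 1)"
          unfolding clause_def using 2 c by simp
        moreover have "0 < N" using N by simp
        ultimately show ?thesis using posI[of ?C 0 i j "if i = 0 \<and> W \<le> j then cell x (j - W) else 0"] c lt(5)
          by blast
      next
        case False
        then show ?thesis using 2 by (intro triv) (auto simp: clause_def)
      qed
    next
      case 3
      show ?thesis
      proof (cases "W \<le> j \<and> j < W + R")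
        case c: True
        have "?Y 0 1 j = cell u (j - W)" using tab_cell_start[OF k2(1), of 1 W M x u j] c k2 by simp
        moreover have "cell u (j - W) < 3" by (simp add: cell_def)
        then have "?C (2 * vcode N 0 1 j (cell u (j - W)) + 1)" unfolding clause_def using 3 c by auto
        moreover have "0 < N" "1 \<le> k" using N k2 by simp_all
        ultimately show ?thesis using posI[of ?C 0 1 j "cell u (j - W)"] lt(5) by blast
      next
        case False
        then show ?thesis using 3 by (intro triv) (auto simp: clause_def)
      qed
    next
      case 4
      show ?thesis
      proof (cases "W \<le> j \<and> j + 1 < W + R")
        case c: True
        have Y: "?Y 0 1 j = cell u (j - W)" "?Y 0 1 (j + 1) = cell u (j + 1 - W)"
          using tab_cell_start[OF k2(1), of 1 W M x u j] tab_cell_start[OF k2(1), of 1 W M x u "j + 1"] c k2 by simp_all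
        have C: "?C l \<longleftrightarrow> l = 2 * vcode N 0 1 j 0 \<or> l = 2 * vcode N 0 1 (j + 1) 0 + 1" for l
          unfolding clause_def using 4 c by simp
        have less: "0 < N" "1 \<le> k" "j + 1 < N" using N k2 c TW by linarith+
        show ?thesis
        proof (cases "cell u (j - W) = 0")
          case True
          then have "?Y 0 1 (j + 1) = 0" using Y(2) c by (simp add: cell_eq_0)
          moreover have "?C (2 * vcode N 0 1 (j + 1) 0 + 1)" unfolding C by simp
          ultimately show ?thesis using posI[of ?C 0 1 "j + 1" 0] less by blast
        next
          case False
          then have "?Y 0 1 j \<noteq> 0" using Y(1) by simp
          moreover have "?C (2 * vcode N 0 1 j 0)" unfolding C by simp
          ultimately show ?thesis using negI[of ?C 0 1 j 0] less lt(5) by blast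
        qed
      next
        case False
        then show ?thesis using 4 by (intro triv) (auto simp: clause_def)
      qed
    next
      case 5
      show ?thesis
      proof (cases "s < G \<and> s \<noteq> acc M")
        case c: True
        have "?Y T k W = acc M" using u(2) by (simp add: tab_cell_scanned)
        then have "?Y T k W \<noteq> s" using c by simp
        moreover have "?C (2 * vcode N T k W s)" unfolding clause_def using 5 c by simp
        moreover have "W < N" using N by linarith
        ultimately show ?thesis using negI[of ?C T k W s] lt(6) N(3) by blast
      next
        case False
        then show ?thesis using 5 by (intro triv) (auto simp: clause_def)
      qed
    next
      case 6
      then show ?thesis by (intro triv) (simp add: clause_def)
    qed
  qed
  then show "\<exists>y. all_clauses (clause k G K (acc M) rd wt mt T R W N (cell x)) N y" by blast
qed

text \<open>The two arguments are packed into one because \<open>d_finite\<close> hard-wires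
  functions of one argument.\<close>

definition table :: "nat \<Rightarrow> nat \<Rightarrow> (nat \<Rightarrow> nat \<Rightarrow> nat) \<Rightarrow> nat \<Rightarrow> nat \<Rightarrow> nat" where
  "table K n F a i = (if a * n + i < K * n then F ((a * n + i) div n) ((a * n + i) mod n) else 0)"

lemma table_eq: "a < K \<Longrightarrow> i < n \<Longrightarrow> table K n F a i = F a i"
  by (simp add: table_def mult_add_less div_mod_digit)

lemma d_table: "definable K' a \<Longrightarrow> definable K' b \<Longrightarrow> definable K' (\<lambda>Tb s. table K n F (a Tb s) (b Tb s))"
  unfolding table_def
  by (rule d_finite[of K' "\<lambda>Tb s. a Tb s * n + b Tb s" "K * n" "\<lambda>e. F (e div n) (e mod n)"])
    (intro d_add d_mult d_const)

theorem NP_imp_cnf: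
  assumes "L \<in> NP"
  obtains N0 :: "nat poly" where
    "\<And>P :: nat poly. (\<And>n. poly N0 n \<le> poly P n) \<Longrightarrow>
       \<exists>f. dpred {0} (\<lambda>Tb s. f Tb (s 0) (s (Suc 0)) (s (Suc (Suc 0)))) \<and>
         (\<forall>x. x \<in> L \<longleftrightarrow> cnf_sat (poly P (length x)) (f (word_tables x) (length x)))"
proof -
  obtain k g M and r p :: "nat poly" where M: "tm k g M"
    and L: "\<And>x. x \<in> L \<longleftrightarrow> (\<exists>u. length u \<le> poly r (length x) \<and> fst (run M {} k [x, u] (poly p (length x))) = acc M)"
    using assms unfolding NP_def by blast
  define G where "G = g + length M + 2"
  define K where "K = G ^ Suc k"
  \<comment> \<open>The window has to contain all cells within reach of the run and all certificate
    cells. \<open>N0\<close> then exceeds every digit in use: codes, symbols and states, tapes,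
    cells up to \<open>2 * W\<close> and the clause kinds up to 4.\<close>
  define W where "W = p + r"
  define N0 where "N0 = [:K + G + k + 5:] + [:2:] * W"
  show thesis
  proof (rule that)
    fix P :: "nat poly" assume P: "\<And>n. poly N0 n \<le> poly P n"
    define C where "C X n = clause k G K (acc M) (table K (Suc k) (dg G)) (table K (Suc k) (wr k G M)) (table K (Suc k) (mv k G M))
      (poly p n) (poly r n) (poly W n) (poly P n) X" for X n
    define f where "f Tb n c l = C (Tb 0) n (dg (poly P n) c 0) (dg (poly P n) c 1) (dg (poly P n) c 2)
      (dg (poly P n) c 3) (dg (poly P n) c 4) (dg (poly P n) c 5) l" for Tb :: tables and n c l
    have z: "0 \<in> {0::nat}" by simp
    have "dpred {0} (\<lambda>Tb s. f Tb (s 0) (s (Suc 0)) (s (Suc (Suc 0))))"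
      unfolding f_def C_def clause_def dg_def vcode_def
      by (intro p_if p_imp p_conj p_disj p_not p_ex p_eq p_le p_less d_if d_tab[OF z] d_table d_add d_sub d_mult
          d_div d_mod d_power d_poly d_const d_var)
    moreover have "x \<in> L \<longleftrightarrow> cnf_sat (poly P (length x)) (f (word_tables x) (length x))" for x
    proof -
      let ?n = "length x"
      have N: "poly N0 ?n \<le> poly P ?n" by (rule P)
      have "cnf_sat (poly P ?n) (f (word_tables x) ?n) \<longleftrightarrow> (\<exists>y. all_clauses (C (cell x) ?n) (poly P ?n) y)"
        using cnf_sat_all_clauses[of "poly P ?n" "C (cell x) ?n"] unfolding f_def by (simp add: word_tables_def)
      also have "\<dots> \<longleftrightarrow> (\<exists>u. length u \<le> poly r ?n \<and> fst (run M {} k [x, u] (poly p ?n)) = acc M)"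
        unfolding C_def
        by (rule tableau_correct[OF M G_def K_def]) (use N in \<open>auto simp: table_eq less_Suc_eq_le N0_def W_def\<close>)
      also have "\<dots> \<longleftrightarrow> x \<in> L" using L by simp
      finally show ?thesis by simp
    qed
    ultimately show "\<exists>f. dpred {0} (\<lambda>Tb s. f Tb (s 0) (s (Suc 0)) (s (Suc (Suc 0)))) \<and>
         (\<forall>x. x \<in> L \<longleftrightarrow> cnf_sat (poly P (length x)) (f (word_tables x) (length x)))" by blast
  qed
qed

theorem BC_Size_DP_hard: "hard_for DP BC_Size"
  unfolding hard_for_def
proof
  fix L assume "L \<in> DP"
  then obtain L1 L2 where L: "L = L1 \<inter> L2" "L1 \<in> NP" "- L2 \<in> NP" unfolding DP_def coNP_def by blast
  obtain N1 :: "nat poly" where N1: "\<And>P :: nat poly. (\<And>n. poly N1 n \<le> poly P n) \<Longrightarrow>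
       \<exists>f. dpred {0} (\<lambda>Tb s. f Tb (s 0) (s (Suc 0)) (s (Suc (Suc 0)))) \<and>
         (\<forall>x. x \<in> L1 \<longleftrightarrow> cnf_sat (poly P (length x)) (f (word_tables x) (length x)))"
    using NP_imp_cnf[OF L(2)] by blast
  obtain N2 :: "nat poly" where N2: "\<And>P :: nat poly. (\<And>n. poly N2 n \<le> poly P n) \<Longrightarrow>
       \<exists>f. dpred {0} (\<lambda>Tb s. f Tb (s 0) (s (Suc 0)) (s (Suc (Suc 0)))) \<and>
         (\<forall>x. x \<in> - L2 \<longleftrightarrow> cnf_sat (poly P (length x)) (f (word_tables x) (length x)))"
    using NP_imp_cnf[OF L(3)] by blast
  obtain f where f: "dpred {0} (\<lambda>Tb s. f Tb (s 0) (s (Suc 0)) (s (Suc (Suc 0))))"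
    "\<And>x. x \<in> L1 \<longleftrightarrow> cnf_sat (poly (N1 + N2) (length x)) (f (word_tables x) (length x))"
    using N1[of "N1 + N2"] by auto
  obtain g where g: "dpred {0} (\<lambda>Tb s. g Tb (s 0) (s (Suc 0)) (s (Suc (Suc 0))))"
    "\<And>x. x \<in> - L2 \<longleftrightarrow> cnf_sat (poly (N1 + N2) (length x)) (g (word_tables x) (length x))"
    using N2[of "N1 + N2"] by auto
  from reduction_from_cnf[OF f(1) g(1) f(2) g(2)] show "poly_reducible L BC_Size"
    unfolding L(1) by simp
qed

theorem theorem12: "BC_Size \<in> Delta2P \<and> hard_for DP BC_Size"
  using BC_Size_Delta2P BC_Size_DP_hard ..

end
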